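(* Let $(M,g)$ be a smooth Riemannian manifold of dimension $n\geq 3$. Then for every smooth Riemannian metric $g_0$ on $M$, every smooth function $k: M \rightarrow (0,+\infty)$, and every $\epsilon >0$, there exists a smooth Riemannian metric $g_{\epsilon}$ on $M$ satisfying $$\mathrm{Scal}^{g_{0}}-k - \epsilon < \mathrm{Scal}^{g_{\epsilon}}<\mathrm{Scal}^{g_{0}}-k \quad \text{on } M \qquad \text{and} \qquad \left\| g_{\epsilon} -g_0\right\|_{C^0_g} < \epsilon.$$
   Context: $\mathrm{Scal}^{h}$ denotes the scalar curvature function of a Riemannian metric $h$, i.e. the trace with respect to $h$ of its Ricci tensor (with the usual sign, so that round spheres have positive scalar curvature). $\|g_{\epsilon} - g_0\|_{C^0_g}$ is the $C^0$-norm of the symmetric 2-tensor $g_{\epsilon}-g_0$ on $M$ with respect to the reference metric $g$, i.e. the supremum over $x\in M$ of the pointwise tensor norm induced by $g_x$. *)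

theory Defs
  imports "HOL-Analysis.Analysis"
begin

section \<open>Smooth functions on open subsets of Euclidean space\<close>

text \<open>Only used for open \<open>S\<close>, where \<open>at x\<close> and \<open>at x within S\<close> agree.\<close>

primrec Ck_on ::
  "nat \<Rightarrow> ('a::real_normed_vector \<Rightarrow> 'b::real_normed_vector) \<Rightarrow> 'a set \<Rightarrow> bool" where
  "Ck_on 0 f S \<longleftrightarrow> continuous_on S f"
| "Ck_on (Suc k) f S \<longleftrightarrow>
     (\<forall>x\<in>S. f differentiable (at x)) \<and>
     (\<forall>v. Ck_on k (\<lambda>x. frechet_derivative f (at x) v) S)"

definition smooth_on ::
  "('a::real_normed_vector \<Rightarrow> 'b::real_normed_vector) \<Rightarrow> 'a set \<Rightarrow> bool" where
  "smooth_on f S \<longleftrightarrow> (\<forall>k. Ck_on k f S)"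

definition partial :: "'n \<Rightarrow> (real^'n \<Rightarrow> 'b::real_normed_vector) \<Rightarrow> real^'n \<Rightarrow> 'b" where
  "partial i f x = frechet_derivative f (at x) (axis i 1)"


section \<open>Smooth manifolds\<close>

text \<open>A chart is a pair of its domain and the coordinate map; the values of the latter
  outside the domain are irrelevant.\<close>

type_synonym ('a, 'n) chart = "'a set \<times> ('a \<Rightarrow> real^'n)"

definition chart_image :: "('a, 'n) chart \<Rightarrow> (real^'n) set" where
  "chart_image c = snd c ` fst c"

definition chart_inv :: "('a, 'n) chart \<Rightarrow> real^'n \<Rightarrow> 'a" where
  "chart_inv c = inv_into (fst c) (snd c)"

definition is_chart :: "'a topology \<Rightarrow> ('a, 'n::finite) chart \<Rightarrow> bool" where
  "is_chart X c \<longleftrightarrow>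
     openin X (fst c) \<and> open (chart_image c) \<and>
     homeomorphic_map (subtopology X (fst c)) (top_of_set (chart_image c)) (snd c)"

definition transition :: "('a, 'n) chart \<Rightarrow> ('a, 'n) chart \<Rightarrow> real^'n \<Rightarrow> real^'n" where
  "transition c d = snd d \<circ> chart_inv c"

text \<open>The atlas need not be maximal: every notion below depends only on the smooth structure
  that it generates.\<close>

definition smooth_manifold :: "'a topology \<Rightarrow> ('a, 'n::finite) chart set \<Rightarrow> bool" where
  "smooth_manifold X A \<longleftrightarrow>
     Hausdorff_space X \<and> second_countable X \<and>
     (\<forall>c\<in>A. is_chart X c) \<and> (\<Union>c\<in>A. fst c) = topspace X \<and>
     (\<forall>c\<in>A. \<forall>d\<in>A. smooth_on (transition c d) (snd c ` (fst c \<inter> fst d)))"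

definition smooth_fun :: "('a, 'n::finite) chart set \<Rightarrow> ('a \<Rightarrow> real) \<Rightarrow> bool" where
  "smooth_fun A f \<longleftrightarrow> (\<forall>c\<in>A. smooth_on (f \<circ> chart_inv c) (chart_image c))"

definition charts_at :: "('a, 'n) chart set \<Rightarrow> 'a \<Rightarrow> ('a, 'n) chart set" where
  "charts_at A p = {c\<in>A. p \<in> fst c}"

definition chart_at :: "('a, 'n) chart set \<Rightarrow> 'a \<Rightarrow> ('a, 'n) chart" where
  "chart_at A p = (SOME c. c \<in> charts_at A p)"


section \<open>Tangent spaces and Riemannian metrics\<close>

text \<open>A tangent vector at \<open>p\<close> is the family of its coordinate vectors in all the charts
  around \<open>p\<close>, which are related by the differentials of the transition maps. The value
  \<open>0\<close> at other charts makes the representation unique, so that vector space operations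
  are pointwise.\<close>

type_synonym ('a, 'n) tvec = "('a, 'n) chart \<Rightarrow> real^'n"

definition tangent_space :: "('a, 'n::finite) chart set \<Rightarrow> 'a \<Rightarrow> ('a, 'n) tvec set" where
  "tangent_space A p = {v.
     (\<forall>c\<in>charts_at A p. \<forall>d\<in>charts_at A p.
        v d = frechet_derivative (transition c d) (at (snd c p)) (v c)) \<and>
     (\<forall>c. c \<notin> charts_at A p \<longrightarrow> v c = 0)}"

definition coord_vec ::
  "('a, 'n::finite) chart set \<Rightarrow> ('a, 'n) chart \<Rightarrow> 'a \<Rightarrow> 'n \<Rightarrow> ('a, 'n) tvec" where
  "coord_vec A c p i =
     (\<lambda>d. if d \<in> charts_at A p then partial i (transition c d) (snd c p) else 0)"

type_synonym ('a, 'n) tensor2 = "'a \<Rightarrow> ('a, 'n) tvec \<Rightarrow> ('a, 'n) tvec \<Rightarrow> real"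

definition components ::
  "('a, 'n::finite) chart set \<Rightarrow> ('a, 'n) tensor2 \<Rightarrow> ('a, 'n) chart \<Rightarrow> real^'n \<Rightarrow> real^'n^'n" where
  "components A h c x =
     (let p = chart_inv c x in \<chi> i j. h p (coord_vec A c p i) (coord_vec A c p j))"

definition inner_product_on ::
  "('a, 'n::finite) tvec set \<Rightarrow> (('a, 'n) tvec \<Rightarrow> ('a, 'n) tvec \<Rightarrow> real) \<Rightarrow> bool" where
  "inner_product_on T b \<longleftrightarrow>
     (\<forall>u\<in>T. \<forall>v\<in>T. b u v = b v u) \<and>
     (\<forall>u\<in>T. \<forall>v\<in>T. \<forall>w\<in>T. \<forall>r s.
        b (\<lambda>c. r *\<^sub>R u c + s *\<^sub>R v c) w = r * b u w + s * b v w) \<and>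
     (\<forall>u\<in>T. u \<noteq> (\<lambda>c. 0) \<longrightarrow> b u u > 0)"

definition riemannian_metric ::
  "'a topology \<Rightarrow> ('a, 'n::finite) chart set \<Rightarrow> ('a, 'n) tensor2 \<Rightarrow> bool" where
  "riemannian_metric X A g \<longleftrightarrow>
     (\<forall>p\<in>topspace X. inner_product_on (tangent_space A p) (g p)) \<and>
     (\<forall>c\<in>A. \<forall>i j. smooth_on (\<lambda>x. components A g c x $ i $ j) (chart_image c))"


section \<open>Scalar curvature\<close>

text \<open>Here \<open>G\<close> is the field of matrices \<open>g\<^sub>i\<^sub>j\<close> of a metric in coordinates on an open
  subset of Euclidean space.\<close>

definition christoffel ::
  "(real^'n::finite \<Rightarrow> real^'n^'n) \<Rightarrow> 'n \<Rightarrow> 'n \<Rightarrow> 'n \<Rightarrow> real^'n \<Rightarrow> real" where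
  "christoffel G k i j x =
     (1/2) * (\<Sum>l\<in>UNIV. matrix_inv (G x) $ k $ l *
        (partial i (\<lambda>y. G y $ j $ l) x + partial j (\<lambda>y. G y $ i $ l) x
         - partial l (\<lambda>y. G y $ i $ j) x))"

text \<open>The component \<open>l\<close> of
  \<open>R(\<partial>\<^sub>i, \<partial>\<^sub>j) \<partial>\<^sub>k = \<nabla>\<^sub>i \<nabla>\<^sub>j \<partial>\<^sub>k - \<nabla>\<^sub>j \<nabla>\<^sub>i \<partial>\<^sub>k\<close>, where \<open>\<nabla>\<close> is the Levi-Civita connection.\<close>

definition riemann ::
  "(real^'n::finite \<Rightarrow> real^'n^'n) \<Rightarrow> 'n \<Rightarrow> 'n \<Rightarrow> 'n \<Rightarrow> 'n \<Rightarrow> real^'n \<Rightarrow> real" where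
  "riemann G l i j k x =
     partial i (christoffel G l j k) x - partial j (christoffel G l i k) x
     + (\<Sum>m\<in>UNIV. christoffel G l i m x * christoffel G m j k x
                  - christoffel G l j m x * christoffel G m i k x)"

text \<open>\<open>Ric(Y, Z)\<close> is the trace of \<open>X \<mapsto> R(X, Y) Z\<close>, which is positive on round spheres.\<close>

definition ricci ::
  "(real^'n::finite \<Rightarrow> real^'n^'n) \<Rightarrow> 'n \<Rightarrow> 'n \<Rightarrow> real^'n \<Rightarrow> real" where
  "ricci G j k x = (\<Sum>i\<in>UNIV. riemann G i i j k x)"

definition scal_coord :: "(real^'n::finite \<Rightarrow> real^'n^'n) \<Rightarrow> real^'n \<Rightarrow> real" where
  "scal_coord G x = (\<Sum>j\<in>UNIV. \<Sum>k\<in>UNIV. matrix_inv (G x) $ j $ k * ricci G j k x)"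

text \<open>The right-hand side does not depend on which chart around \<open>p\<close> is used.\<close>

definition scal :: "('a, 'n::finite) chart set \<Rightarrow> ('a, 'n) tensor2 \<Rightarrow> 'a \<Rightarrow> real" where
  "scal A g p = (let c = chart_at A p in scal_coord (components A g c) (snd c p))"


section \<open>The \<open>C\<^sup>0\<close>-norm of 2-tensors\<close>

text \<open>The pointwise norm is the square root of \<open>g\<^sup>i\<^sup>k g\<^sup>j\<^sup>l h\<^sub>i\<^sub>j h\<^sub>k\<^sub>l\<close>, again in any chart around \<open>p\<close>.\<close>

definition tensor_norm ::
  "('a, 'n::finite) chart set \<Rightarrow> ('a, 'n) tensor2 \<Rightarrow> ('a, 'n) tensor2 \<Rightarrow> 'a \<Rightarrow> real" where
  "tensor_norm A g h p =
     (let c = chart_at A p; x = snd c p;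
          I = matrix_inv (components A g c x); H = components A h c x
      in sqrt (\<Sum>i\<in>UNIV. \<Sum>j\<in>UNIV. \<Sum>k\<in>UNIV. \<Sum>l\<in>UNIV.
           I $ i $ k * I $ j $ l * H $ i $ j * H $ k $ l))"

text \<open>The supremum may be infinite, since the manifold need not be compact.\<close>

definition C0_norm ::
  "'a topology \<Rightarrow> ('a, 'n::finite) chart set \<Rightarrow> ('a, 'n) tensor2 \<Rightarrow> ('a, 'n) tensor2 \<Rightarrow> ennreal" where
  "C0_norm X A g h = (SUP p\<in>topspace X. ennreal (tensor_norm A g h p))"

definition tensor_diff ::
  "('a, 'n) tensor2 \<Rightarrow> ('a, 'n) tensor2 \<Rightarrow> ('a, 'n) tensor2" where
  "tensor_diff g h = (\<lambda>p u v. g p u v - h p u v)"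

end

theory Submission
  imports Defs
begin

text \<open>In a chart, a metric \<open>G\<close> is perturbed by a tensor
  \<open>s cos(l x\<^sub>a) U + s\<^sup>2 (sin(l x\<^sub>a) V\<^sub>1 + cos(2 l x\<^sub>a) V\<^sub>2)\<close> of high frequency \<open>l = 1/s\<close>. If \<open>U\<close> is
  trace free and annihilates the gradient of \<open>x\<^sub>a\<close> (a gravitational wave, which needs dimension
  three), the scalar curvature stays bounded as \<open>l\<close> grows, and its limit is lower by one eighth of
  \<open>|U|\<^sup>2 |dx\<^sub>a|\<^sup>2\<close>, up to bounded oscillating terms. The conformal terms \<open>V\<^sub>1\<close> and
  \<open>V\<^sub>2\<close> cancel the latter. Hence the scalar curvature can be lowered by any
  \<open>\<alpha>\<^sup>2\<close> with \<open>\<alpha>\<close> supported in a compact subset of a chart, up to an arbitrarily small uniform error and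
  by an arbitrarily small change of the metric.

  The manifold is covered by countably many chart balls \<open>B\<^sub>n\<close> with bump functions
  \<open>\<beta>\<^sub>n\<close> that are one on \<open>B\<^sub>n\<close>. With \<open>\<theta>\<^sub>n = \<pi> \<beta>\<^sub>n / 2\<close>, the amplitudes
  \<open>\<alpha>\<^sub>n = sqrt(k + \<epsilon>/2) (\<Prod>j<n. cos \<theta>\<^sub>j) sin \<theta>\<^sub>n\<close> are smooth, their squares telescope to
  \<open>k + \<epsilon>/2\<close>, and \<open>\<alpha>\<^sub>n\<close> vanishes on \<open>B\<^sub>m\<close> for \<open>n > m\<close>. So the successive perturbations
  are eventually constant on each ball and their limit is the desired metric.\<close>

section \<open>Smooth functions\<close>

text \<open>The term of order \<open>l\<close> in the scalar curvature is the symbol of the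
  linearised curvature, which vanishes on \<open>U\<close> for the inverse of \<open>G\<close>. It
  is however evaluated at the inverse of the perturbed matrix, which differs by order
  \<open>1/l\<close>, so a bounded term survives. With T = |dx_a|^2 |U|^2 and phase t it equals -
  cos(t)^2 T, and the terms quadratic in first derivatives add 3/4 sin(t)^2 T. The sum is - T/8 -
  7/8 cos(2t) T, the origin of the constants 8 and 7/32. No remainder estimates are made. Limits are
  computed along sequences on which the position and the cosine and sine of the phase converge, and
  compactness turns them into uniform statements. Prescribing \<alpha> and not its square keeps the
  wave smooth where \<alpha> vanishes. The amplitudes are fixed in advance, whereas each frequency
  depends on the metric reached so far. Scalar curvature is defined through an arbitrarily chosen
  chart at each point, so its invariance under coordinate changes has to be proved as well.\<close>

lemma frechet_derivative_cong_open:
  assumes "open S" "x \<in> S" "\<And>y. y \<in> S \<Longrightarrow> f y = g y"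
  shows "frechet_derivative f (at x) = frechet_derivative g (at x)"
proof -
  \<comment> \<open>\<open>frechet_derivative\<close> is a Hilbert choice from this predicate, so
    equal predicates give equal chosen maps, also where no derivative exists.\<close>
  have "(f has_derivative f') (at x) \<longleftrightarrow> (g has_derivative f') (at x)" for f'
    using has_derivative_transform_within_open[of f f' x UNIV S g]
      has_derivative_transform_within_open[of g f' x UNIV S f] assms by auto
  then show ?thesis
    unfolding frechet_derivative_def by simp
qed

lemma differentiable_cong_open:
  assumes "open S" "x \<in> S" "\<And>y. y \<in> S \<Longrightarrow> f y = g y" "f differentiable (at x)"
  shows "g differentiable (at x)"
  using assms has_derivative_transform_within_open[of f _ x UNIV S g]
  unfolding differentiable_def by blast

lemma Ck_on_cong:
  assumes "open S" "\<And>y. y \<in> S \<Longrightarrow> f y = g y" "Ck_on k f S"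
  shows "Ck_on k g S"
  using assms(2,3)
proof (induction k arbitrary: f g)
  case 0
  then show ?case by (metis Ck_on.simps(1) continuous_on_cong)
next
  case (Suc k)
  have "Ck_on k (\<lambda>x. frechet_derivative g (at x) v) S" for v
    using Suc.IH[of "\<lambda>x. frechet_derivative f (at x) v" "\<lambda>x. frechet_derivative g (at x) v"]
      frechet_derivative_cong_open[OF assms(1) _ Suc.prems(1)] Suc.prems(2) by auto
  moreover have "g differentiable (at x)" if "x \<in> S" for x
    using differentiable_cong_open[OF assms(1) that Suc.prems(1)] Suc.prems(2) that by auto
  ultimately show ?case by simp
qed

text \<open>Introduction rule for the inductions below: it accepts an explicit derivative in place
  of the chosen \<open>frechet_derivative\<close>.\<close>

lemma Ck_on_SucI:
  assumes "open S" "\<And>x. x \<in> S \<Longrightarrow> (f has_derivative f' x) (at x)"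
    and "\<And>v. Ck_on k (\<lambda>x. f' x v) S"
  shows "Ck_on (Suc k) f S"
proof -
  have "Ck_on k (\<lambda>x. frechet_derivative f (at x) v) S" for v
    by (rule Ck_on_cong[OF assms(1) _ assms(3)[of v]]) (metis assms(2) frechet_derivative_at)
  then show ?thesis using assms(2) by (auto simp: differentiable_def)
qed

lemma Ck_on_Suc_has_derivative:
  assumes "Ck_on (Suc k) f S" "x \<in> S"
  shows "(f has_derivative frechet_derivative f (at x)) (at x)"
  using assms frechet_derivative_works by auto

lemma Ck_on_Suc_imp: "Ck_on (Suc k) f S \<Longrightarrow> Ck_on k f S"
proof (induction k arbitrary: f)
  case 0
  then show ?case
    by (auto intro!: continuous_at_imp_continuous_on differentiable_imp_continuous_within)
next
  case (Suc k)
  then show ?case by (metis Ck_on.simps(2))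
qed

lemma Ck_on_subset: "Ck_on k f S \<Longrightarrow> T \<subseteq> S \<Longrightarrow> Ck_on k f T"
  by (induction k arbitrary: f) (auto intro: continuous_on_subset)

text \<open>Differentiability is a condition at points, and continuity can be glued along open sets.
  Patching in \<open>smooth_on_local\<close> and \<open>smooth_on_Un\<close> rests on this.\<close>

lemma Ck_on_Union: "(\<And>S. S \<in> \<S> \<Longrightarrow> open S) \<Longrightarrow> (\<And>S. S \<in> \<S> \<Longrightarrow> Ck_on k f S) \<Longrightarrow> Ck_on k f (\<Union>\<S>)"
  by (induction k arbitrary: f) (auto intro: continuous_on_open_Union)

lemma Ck_on_const: "Ck_on k (\<lambda>x. c) S"
  by (induction k arbitrary: c) auto

lemma Ck_on_bounded_linear: "bounded_linear f \<Longrightarrow> open S \<Longrightarrow> Ck_on k f S"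
proof (cases k)
  case 0
  then show "bounded_linear f \<Longrightarrow> ?thesis" by (simp add: linear_continuous_on)
next
  case (Suc m)
  then show "bounded_linear f \<Longrightarrow> open S \<Longrightarrow> ?thesis"
    using Ck_on_SucI[where f' = "\<lambda>_. f" and f = f and k = m and S = S]
    by (simp add: Ck_on_const bounded_linear_imp_has_derivative del: Ck_on.simps)
qed

lemma Ck_on_bounded_linear_compose:
  assumes "bounded_linear h" "open S" "Ck_on k f S"
  shows "Ck_on k (\<lambda>x. h (f x)) S"
  using assms(3)
proof (induction k arbitrary: f)
  case 0
  then show ?case using assms by (auto intro: bounded_linear.continuous_on)
next
  case (Suc k)
  then show ?case
    by (intro Ck_on_SucI[where f' = "\<lambda>x v. h (frechet_derivative f (at x) v)"] assms)
      (auto intro!: bounded_linear.has_derivative[OF assms(1)] Ck_on_Suc_has_derivative)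
qed

lemma Ck_on_add:
  assumes "open S" "Ck_on k f S" "Ck_on k g S"
  shows "Ck_on k (\<lambda>x. f x + g x) S"
  using assms(2,3)
proof (induction k arbitrary: f g)
  case 0
  then show ?case by (auto intro: continuous_on_add)
next
  case (Suc k)
  show ?case
    using Suc Ck_on_Suc_has_derivative[OF Suc.prems(1)] Ck_on_Suc_has_derivative[OF Suc.prems(2)]
    by (intro Ck_on_SucI[where f' = "\<lambda>x v. frechet_derivative f (at x) v + frechet_derivative g (at x) v"] assms)
       (auto intro!: has_derivative_add)
qed

text \<open>Arbitrary bounded bilinear maps let one induction by the product rule cover real
  products, scalar multiples and inner products.\<close>

lemma Ck_on_bilinear:
  assumes bil: "bounded_bilinear bb" and "open S" "Ck_on k f S" "Ck_on k g S"
  shows "Ck_on k (\<lambda>x. bb (f x) (g x)) S"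
  using assms(3,4)
proof (induction k arbitrary: f g)
  case 0
  then show ?case by (auto intro: bounded_bilinear.continuous_on[OF bil])
next
  case (Suc k)
  have 1: "Ck_on k (\<lambda>x. bb (f x) (frechet_derivative g (at x) v)) S"
       "Ck_on k (\<lambda>x. bb (frechet_derivative f (at x) v) (g x)) S" for v
    using Suc.prems[THEN Ck_on_Suc_imp] Suc.prems by (auto intro!: Suc.IH)
  show ?case
    by (intro Ck_on_SucI[where f' = "\<lambda>x v. bb (f x) (frechet_derivative g (at x) v)
          + bb (frechet_derivative f (at x) v) (g x)"] assms)
       (auto intro!: Ck_on_add 1 assms bounded_bilinear.FDERIV[OF bil] Ck_on_Suc_has_derivative[OF Suc.prems(1)]
          Ck_on_Suc_has_derivative[OF Suc.prems(2)])
qed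

lemma Ck_on_sum:
  assumes "open S" "\<And>i. i \<in> I \<Longrightarrow> Ck_on k (f i) S"
  shows "Ck_on k (\<lambda>x. \<Sum>i\<in>I. f i x) S"
  using assms(2)
  by (induction I rule: infinite_finite_induct) (auto simp: Ck_on_const intro!: Ck_on_add assms(1))

text \<open>In the chain rule the derivative of \<open>f\<close> is applied to a direction that
  moves with \<open>x\<close>, whereas \<open>Ck_on\<close> speaks of fixed directions. Expanding
  the direction in \<open>Basis\<close> leaves finitely many products to which the induction
  hypothesis applies; hence the Euclidean target of \<open>g\<close>.\<close>

lemma Ck_on_compose:
  fixes g :: "'a::real_normed_vector \<Rightarrow> 'b::euclidean_space"
  assumes "open S" "Ck_on k f T" "Ck_on k g S" "g ` S \<subseteq> T"
  shows "Ck_on k (\<lambda>x. f (g x)) S"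
  using assms(2,3)
proof (induction k arbitrary: f)
  case 0
  then show ?case using assms(4) by (auto intro: continuous_on_compose2)
next
  case (Suc k)
  note D = Ck_on_Suc_has_derivative[OF Suc.prems(1)] Ck_on_Suc_has_derivative[OF Suc.prems(2)]
  have lin: "linear (frechet_derivative f (at (g x)))" if "x \<in> S" for x
    using D(1)[of "g x"] that assms(4) has_derivative_linear by blast
  have "Ck_on k (\<lambda>x. frechet_derivative f (at (g x)) b) S" for b
    using Suc.IH[of "\<lambda>y. frechet_derivative f (at y) b"] Suc.prems Ck_on_Suc_imp by auto
  moreover have "Ck_on k (\<lambda>x. frechet_derivative g (at x) v \<bullet> b) S" for v b
    using Suc.prems(2) by (intro Ck_on_bounded_linear_compose[OF bounded_linear_inner_left assms(1)]) simp
  ultimately have 1: "Ck_on k (\<lambda>x. \<Sum>b\<in>Basis. (frechet_derivative g (at x) v \<bullet> b) *\<^sub>R frechet_derivative f (at (g x)) b) S" for v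
    by (intro Ck_on_sum Ck_on_bilinear[OF bounded_bilinear_scaleR] assms)
  have eq: "(\<Sum>b\<in>Basis. (frechet_derivative g (at x) v \<bullet> b) *\<^sub>R frechet_derivative f (at (g x)) b)
      = frechet_derivative f (at (g x)) (frechet_derivative g (at x) v)" if "x \<in> S" for x v
  proof -
    have "frechet_derivative f (at (g x)) (frechet_derivative g (at x) v)
      = frechet_derivative f (at (g x)) (\<Sum>b\<in>Basis. (frechet_derivative g (at x) v \<bullet> b) *\<^sub>R b)"
      by (simp add: euclidean_representation)
    then show ?thesis by (simp only: linear_sum[OF lin[OF that]] linear_scale[OF lin[OF that]])
  qed
  show ?case
  proof (rule Ck_on_SucI[where f' = "\<lambda>x v. frechet_derivative f (at (g x)) (frechet_derivative g (at x) v)"])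
    show "((\<lambda>x. f (g x)) has_derivative (\<lambda>v. frechet_derivative f (at (g x)) (frechet_derivative g (at x) v))) (at x)"
      if "x \<in> S" for x
      using has_derivative_compose[OF D(2)[OF that] D(1)[of "g x"]] that assms(4) by auto
    show "Ck_on k (\<lambda>x. frechet_derivative f (at (g x)) (frechet_derivative g (at x) v)) S" for v
      by (rule Ck_on_cong[OF assms(1) eq 1])
  qed fact
qed

lemma smooth_onD: "smooth_on f S \<Longrightarrow> x \<in> S \<Longrightarrow> f differentiable (at x)"
  unfolding smooth_on_def by (metis Ck_on.simps(2))

lemma smooth_on_imp_continuous_on: "smooth_on f S \<Longrightarrow> continuous_on S f"
  unfolding smooth_on_def by (metis Ck_on.simps(1))

lemma smooth_on_frechet: "smooth_on f S \<Longrightarrow> smooth_on (\<lambda>x. frechet_derivative f (at x) v) S"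
  unfolding smooth_on_def by (metis Ck_on.simps(2))

lemma smooth_on_partial: "smooth_on f S \<Longrightarrow> smooth_on (partial i f) S"
  unfolding partial_def[abs_def] by (rule smooth_on_frechet)

lemma smooth_on_has_derivative:
  "smooth_on f S \<Longrightarrow> x \<in> S \<Longrightarrow> (f has_derivative frechet_derivative f (at x)) (at x)"
  using smooth_onD frechet_derivative_works by blast

lemma smooth_on_cong:
  "open S \<Longrightarrow> (\<And>y. y \<in> S \<Longrightarrow> f y = g y) \<Longrightarrow> smooth_on f S \<Longrightarrow> smooth_on g S"
  unfolding smooth_on_def using Ck_on_cong by blast

lemma smooth_on_subset: "smooth_on f S \<Longrightarrow> T \<subseteq> S \<Longrightarrow> smooth_on f T"
  unfolding smooth_on_def using Ck_on_subset by blast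

lemma smooth_on_Un: "open S \<Longrightarrow> open T \<Longrightarrow> smooth_on f S \<Longrightarrow> smooth_on f T \<Longrightarrow> smooth_on f (S \<union> T)"
  unfolding smooth_on_def using Ck_on_Union[of "{S, T}"] by auto

lemma smooth_on_local:
  assumes "\<And>x. x \<in> S \<Longrightarrow> \<exists>U. open U \<and> x \<in> U \<and> smooth_on f U"
  shows "smooth_on f S"
proof -
  have "smooth_on f (\<Union>{U. open U \<and> smooth_on f U})"
    unfolding smooth_on_def by (intro allI Ck_on_Union) (auto simp: smooth_on_def)
  moreover have "S \<subseteq> \<Union>{U. open U \<and> smooth_on f U}" using assms by blast
  ultimately show ?thesis using smooth_on_subset by blast
qed

lemma smooth_on_const: "smooth_on (\<lambda>x. c) S"
  by (simp add: smooth_on_def Ck_on_const)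

lemma smooth_on_bounded_linear: "bounded_linear f \<Longrightarrow> open S \<Longrightarrow> smooth_on f S"
  by (simp add: smooth_on_def Ck_on_bounded_linear)

lemma smooth_on_bounded_linear_compose:
  "bounded_linear h \<Longrightarrow> open S \<Longrightarrow> smooth_on f S \<Longrightarrow> smooth_on (\<lambda>x. h (f x)) S"
  by (simp add: smooth_on_def Ck_on_bounded_linear_compose)

lemma smooth_on_add: "open S \<Longrightarrow> smooth_on f S \<Longrightarrow> smooth_on g S \<Longrightarrow> smooth_on (\<lambda>x. f x + g x) S"
  by (simp add: smooth_on_def Ck_on_add)

lemma smooth_on_mult:
  fixes f g :: "_ \<Rightarrow> real"
  shows "open S \<Longrightarrow> smooth_on f S \<Longrightarrow> smooth_on g S \<Longrightarrow> smooth_on (\<lambda>x. f x * g x) S"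
  by (simp add: smooth_on_def Ck_on_bilinear[OF bounded_bilinear_mult])

lemma smooth_on_uminus:
  fixes f :: "_ \<Rightarrow> real"
  shows "open S \<Longrightarrow> smooth_on f S \<Longrightarrow> smooth_on (\<lambda>x. - f x) S"
  using smooth_on_bounded_linear_compose[of uminus S f] bounded_linear_minus[OF bounded_linear_ident] by simp

lemma smooth_on_diff:
  fixes f g :: "_ \<Rightarrow> real"
  shows "open S \<Longrightarrow> smooth_on f S \<Longrightarrow> smooth_on g S \<Longrightarrow> smooth_on (\<lambda>x. f x - g x) S"
  using smooth_on_add[of S f "\<lambda>x. - g x"] smooth_on_uminus[of S g] by simp

lemma smooth_on_sum:
  "open S \<Longrightarrow> (\<And>i. i \<in> I \<Longrightarrow> smooth_on (f i) S) \<Longrightarrow> smooth_on (\<lambda>x. \<Sum>i\<in>I. f i x) S"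
  by (simp add: smooth_on_def Ck_on_sum)

lemma smooth_on_prod:
  fixes f :: "_ \<Rightarrow> _ \<Rightarrow> real"
  shows "open S \<Longrightarrow> (\<And>i. i \<in> I \<Longrightarrow> smooth_on (f i) S) \<Longrightarrow> smooth_on (\<lambda>x. \<Prod>i\<in>I. f i x) S"
  by (induction I rule: infinite_finite_induct) (auto intro: smooth_on_const smooth_on_mult)

lemma smooth_on_compose:
  fixes g :: "'a::real_normed_vector \<Rightarrow> 'b::euclidean_space"
  shows "smooth_on f T \<Longrightarrow> open S \<Longrightarrow> smooth_on g S \<Longrightarrow> g ` S \<subseteq> T \<Longrightarrow> smooth_on (\<lambda>x. f (g x)) S"
  unfolding smooth_on_def using Ck_on_compose by blast

section \<open>Smoothness of the elementary functions of one real variable\<close>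

lemma Ck_on_Suc_real:
  fixes f :: "real \<Rightarrow> real"
  assumes "open S" "\<And>x. x \<in> S \<Longrightarrow> (f has_real_derivative f' x) (at x)" "Ck_on k f' S"
  shows "Ck_on (Suc k) f S"
  using assms
  by (intro Ck_on_SucI[where f' = "\<lambda>x v. f' x * v"] Ck_on_bilinear[OF bounded_bilinear_mult] Ck_on_const)
     (auto simp: has_field_derivative_def)

lemma smooth_on_sin_cos: "smooth_on (sin :: real \<Rightarrow> real) UNIV \<and> smooth_on (cos :: real \<Rightarrow> real) UNIV"
proof -
  have "Ck_on k (sin :: real \<Rightarrow> real) UNIV \<and> Ck_on k (cos :: real \<Rightarrow> real) UNIV" for k
  proof (induction k)
    case 0
    then show ?case by (auto intro: continuous_intros)
  next
    case (Suc k)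
    have "Ck_on k (\<lambda>x::real. - sin x) UNIV"
      using Suc by (intro Ck_on_bounded_linear_compose[of uminus] bounded_linear_minus[OF bounded_linear_ident]) auto
    with Suc show ?case
      by (intro conjI Ck_on_Suc_real[where f' = cos] Ck_on_Suc_real[where f' = "\<lambda>x. - sin x"])
         (auto intro!: derivative_eq_intros)
  qed
  then show ?thesis by (auto simp: smooth_on_def)
qed

lemma smooth_on_inverse_real: "smooth_on (inverse :: real \<Rightarrow> real) (- {0})"
proof -
  have "Ck_on k (inverse :: real \<Rightarrow> real) (- {0})" for k
  proof (induction k)
    case 0
    then show ?case by (auto intro!: continuous_intros)
  next
    case (Suc k)
    have "Ck_on k (\<lambda>x::real. - (inverse x * inverse x)) (- {0})"
      using Suc by (intro Ck_on_bounded_linear_compose[of uminus] bounded_linear_minus[OF bounded_linear_ident]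
          Ck_on_bilinear[OF bounded_bilinear_mult]) auto
    then show ?case
      by (intro Ck_on_Suc_real[where f' = "\<lambda>x. - (inverse x * inverse x)"])
         (auto intro!: derivative_eq_intros simp: power2_eq_square)
  qed
  then show ?thesis by (auto simp: smooth_on_def)
qed

lemma smooth_on_sqrt_real: "smooth_on sqrt {0<..}"
proof -
  have inv: "Ck_on k (inverse :: real \<Rightarrow> real) {0<..}" for k
    using smooth_on_inverse_real Ck_on_subset[of k inverse "- {0}" "{0<..}"] by (auto simp: smooth_on_def)
  have "Ck_on k sqrt {0<..}" for k
  proof (induction k)
    case 0
    then show ?case by (auto intro!: continuous_intros)
  next
    case (Suc k)
    have "Ck_on k (\<lambda>x::real. inverse (sqrt x) / 2) {0<..}"
      using Suc by (intro Ck_on_bounded_linear_compose[of "\<lambda>x. x / 2"] Ck_on_compose[OF _ inv]) (auto intro: bounded_linear_divide)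
    then show ?case
      by (intro Ck_on_Suc_real[where f' = "\<lambda>x. inverse (sqrt x) / 2"])
         (auto intro!: derivative_eq_intros)
  qed
  then show ?thesis by (auto simp: smooth_on_def)
qed

lemma smooth_on_sin: "open S \<Longrightarrow> smooth_on f S \<Longrightarrow> smooth_on (\<lambda>x. sin (f x :: real)) S"
  using smooth_on_compose[of sin UNIV] smooth_on_sin_cos by auto

lemma smooth_on_cos: "open S \<Longrightarrow> smooth_on f S \<Longrightarrow> smooth_on (\<lambda>x. cos (f x :: real)) S"
  using smooth_on_compose[of cos UNIV] smooth_on_sin_cos by auto

lemma smooth_on_inverse:
  "open S \<Longrightarrow> smooth_on f S \<Longrightarrow> (\<And>x. x \<in> S \<Longrightarrow> f x \<noteq> 0) \<Longrightarrow> smooth_on (\<lambda>x. inverse (f x :: real)) S"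
  by (rule smooth_on_compose[OF smooth_on_inverse_real]) auto

lemma smooth_on_divide:
  "open S \<Longrightarrow> smooth_on f S \<Longrightarrow> smooth_on g S \<Longrightarrow> (\<And>x. x \<in> S \<Longrightarrow> g x \<noteq> 0) \<Longrightarrow> smooth_on (\<lambda>x. f x / g x :: real) S"
  by (simp add: divide_inverse smooth_on_mult smooth_on_inverse)

lemma smooth_on_sqrt:
  "open S \<Longrightarrow> smooth_on f S \<Longrightarrow> (\<And>x. x \<in> S \<Longrightarrow> f x > 0) \<Longrightarrow> smooth_on (\<lambda>x. sqrt (f x)) S"
  by (rule smooth_on_compose[OF smooth_on_sqrt_real]) auto

lemma smooth_on_vec_nth:
  "open S \<Longrightarrow> smooth_on f S \<Longrightarrow> smooth_on (\<lambda>x. f x $ i) S"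
  by (rule smooth_on_bounded_linear_compose[OF bounded_linear_vec_nth])

lemmas smooth_intros = smooth_on_const smooth_on_add smooth_on_mult smooth_on_uminus smooth_on_diff
  smooth_on_sum smooth_on_prod smooth_on_sin smooth_on_cos smooth_on_inverse smooth_on_divide smooth_on_sqrt

lemma smooth_on_id: "open S \<Longrightarrow> smooth_on (\<lambda>x. x) S"
  by (simp add: smooth_on_bounded_linear bounded_linear_ident)

section \<open>Bump functions\<close>

definition flat_exp :: "nat \<Rightarrow> real \<Rightarrow> real" where
  "flat_exp m x = (if x > 0 then (1/x)^m * exp (- (1/x)) else 0)"

lemma flat_exp_tendsto_0: "(flat_exp m \<longlongrightarrow> 0) (at 0)"
proof -
  have "((\<lambda>y::real. y^m / exp y) \<longlongrightarrow> 0) at_top"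
    by (rule tendsto_power_div_exp_0)
  then have "((\<lambda>x::real. (1/x)^m / exp (1/x)) \<longlongrightarrow> 0) (at_right 0)"
    by (rule filterlim_compose) (simp add: divide_inverse filterlim_inverse_at_top_right)
  then have "(flat_exp m \<longlongrightarrow> 0) (at_right 0)"
    by (rule Lim_transform_eventually)
       (auto simp: flat_exp_def exp_minus divide_inverse eventually_at_filter)
  moreover have "(flat_exp m \<longlongrightarrow> 0) (at_left 0)"
    by (rule tendsto_eventually) (auto simp: flat_exp_def eventually_at_filter)
  ultimately show ?thesis by (simp add: filterlim_split_at)
qed

text \<open>The powers of \<open>1/x\<close> close the family under differentiation up to linear
  combinations, so one induction over all \<open>m\<close> gives smoothness. At the origin the
  difference quotient of \<open>flat_exp m\<close> is \<open>flat_exp (m+1)\<close>.\<close>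

lemma flat_exp_has_derivative:
  "(flat_exp m has_real_derivative (flat_exp (m+2) x - real m * flat_exp (m+1) x)) (at x)"
proof -
  consider "x > 0" | "x < 0" | "x = 0" by linarith
  then show ?thesis
  proof cases
    case 1
    have inv: "((\<lambda>x. 1/x) has_real_derivative - ((1/x)^2)) (at x)"
      using 1 by (auto intro!: derivative_eq_intros simp: power2_eq_square)
    have "((\<lambda>x. exp (- (1/x))) has_real_derivative exp (- (1/x)) * (1/x)^2) (at x)"
      using DERIV_fun_exp[OF DERIV_minus[OF inv]] by simp
    from DERIV_mult[OF DERIV_power[OF inv, of m] this]
    have "((\<lambda>x. (1/x)^m * exp (- (1/x))) has_real_derivative (flat_exp (m+2) x - real m * flat_exp (m+1) x)) (at x)"
      by (rule back_subst[of "\<lambda>D. (_ has_real_derivative D) (at x)"])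
         (use 1 in \<open>cases m; simp add: flat_exp_def algebra_simps power2_eq_square\<close>)
    then show ?thesis
      by (rule has_field_derivative_transform_within_open[of _ _ _ "{0<..}"]) (use 1 in \<open>auto simp: flat_exp_def\<close>)
  next
    case 2
    have "((\<lambda>x. 0) has_real_derivative 0) (at x)" by simp
    then have "(flat_exp m has_real_derivative 0) (at x)"
      by (rule has_field_derivative_transform_within_open[of _ _ _ "{..<0}"]) (use 2 in \<open>auto simp: flat_exp_def\<close>)
    then show ?thesis using 2 by (simp add: flat_exp_def)
  next
    case 3
    have "((\<lambda>h. (flat_exp m (0 + h) - flat_exp m 0) / h) \<longlongrightarrow> 0) (at 0)"
      by (rule Lim_transform_eventually[OF flat_exp_tendsto_0[of "m+1"]])
         (auto simp: flat_exp_def eventually_at_filter)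
    then show ?thesis using 3 by (simp add: has_field_derivative_iff flat_exp_def)
  qed
qed

lemma smooth_on_flat_exp: "smooth_on (flat_exp m) UNIV"
proof -
  have "Ck_on k (flat_exp m) UNIV" for k
  proof (induction k arbitrary: m)
    case 0
    then show ?case
      using DERIV_isCont[OF flat_exp_has_derivative] by (simp add: continuous_at_imp_continuous_on)
  next
    case (Suc k)
    have "Ck_on k (\<lambda>x. flat_exp (m+2) x + - real m * flat_exp (m+1) x) UNIV"
      using Suc by (intro Ck_on_add Ck_on_bilinear[OF bounded_bilinear_mult] Ck_on_const) auto
    then show ?case
      by (intro Ck_on_Suc_real[where f' = "\<lambda>x. flat_exp (m+2) x - real m * flat_exp (m+1) x"] flat_exp_has_derivative)
        auto
  qed
  then show ?thesis by (simp add: smooth_on_def)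
qed

text \<open>Let q be the squared distance from \<open>z\<close> in units of \<open>r\<close>, which
  is smooth also at \<open>z\<close>. The arguments 4 - q and q - 1 of \<open>flat_exp 0\<close> add
  up to 3 and are never both nonpositive, so the denominator is positive; q \<le> 1 and q \<ge> 4
  correspond to the two radii.\<close>

lemma bump_exists:
  fixes z :: "'a::euclidean_space"
  assumes "0 < r"
  obtains f :: "'a \<Rightarrow> real" where "smooth_on f UNIV" "\<And>x. dist z x \<le> r \<Longrightarrow> f x = 1"
    "\<And>x. dist z x \<ge> 2 * r \<Longrightarrow> f x = 0"
proof -
  define q where "q x = (x - z) \<bullet> (x - z) / r\<^sup>2" for x
  define f where "f x = flat_exp 0 (4 - q x) / (flat_exp 0 (4 - q x) + flat_exp 0 (q x - 1))" for x
  have q: "smooth_on q UNIV"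
  proof -
    have "smooth_on (\<lambda>x. x + - z) UNIV" by (intro smooth_on_add smooth_on_id smooth_on_const) auto
    then have "smooth_on (\<lambda>x. (x - z) \<bullet> (x - z)) UNIV"
      using Ck_on_bilinear[OF bounded_bilinear_inner, of UNIV] by (auto simp: smooth_on_def)
    then show ?thesis unfolding q_def using assms by (intro smooth_intros) auto
  qed
  have dq: "q x = (dist z x / r)\<^sup>2" for x
    by (simp add: q_def dist_norm power_divide norm_minus_commute flip: power2_norm_eq_inner)
  have pos: "flat_exp 0 (4 - t) + flat_exp 0 (t - 1) > 0" for t
    by (auto simp: flat_exp_def add_pos_nonneg)
  have fl1: "smooth_on (\<lambda>x. flat_exp 0 (4 - q x)) UNIV"
    by (rule smooth_on_compose[OF smooth_on_flat_exp]) (auto intro!: smooth_intros q)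
  have fl2: "smooth_on (\<lambda>x. flat_exp 0 (q x - 1)) UNIV"
    by (rule smooth_on_compose[OF smooth_on_flat_exp]) (auto intro!: smooth_intros q)
  have "smooth_on f UNIV" unfolding f_def
    using fl1 fl2 pos by (intro smooth_intros) (auto simp: less_imp_neq[THEN not_sym])
  moreover have "f x = 1" if "dist z x \<le> r" for x
  proof -
    have "q x \<le> 1" using that assms by (simp add: dq power_le_one)
    then show ?thesis by (simp add: f_def flat_exp_def)
  qed
  moreover have "f x = 0" if "dist z x \<ge> 2 * r" for x
  proof -
    have "2 \<le> dist z x / r" using that assms by (simp add: field_simps)
    then have "2\<^sup>2 \<le> q x" unfolding dq by (rule power_mono) auto
    then show ?thesis by (simp add: f_def flat_exp_def)
  qed
  ultimately show thesis using that by blast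
qed

section \<open>Positive definite matrices\<close>

definition spd :: "real^'n::finite^'n \<Rightarrow> bool" where
  "spd G \<longleftrightarrow> (\<forall>i j. G $ i $ j = G $ j $ i) \<and> (\<forall>u. u \<noteq> 0 \<longrightarrow> u \<bullet> (G *v u) > 0)"

lemma inner_matrix_vector: "u \<bullet> (H *v w) = (\<Sum>i\<in>UNIV. \<Sum>j\<in>UNIV. u$i * H$i$j * w$j)"
  for H :: "real^'n::finite^'n"
  by (simp add: inner_vec_def matrix_vector_mult_def sum_distrib_left mult.assoc)

lemma inner_matrix_vector_commute:
  fixes H :: "real^'n::finite^'n"
  assumes "\<And>i j. H $ i $ j = H $ j $ i"
  shows "u \<bullet> (H *v w) = w \<bullet> (H *v u)"
  unfolding inner_matrix_vector by (subst sum.swap) (simp add: assms mult.commute mult.left_commute)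

lemma matrix_inv_works:
  assumes "invertible (A :: real^'n::finite^'n)"
  shows "A ** matrix_inv A = mat 1" "matrix_inv A ** A = mat 1"
  using assms someI_ex[of "\<lambda>A'. A ** A' = mat 1 \<and> A' ** A = mat 1"]
  unfolding invertible_def matrix_inv_def by auto

lemma matrix_inv_unique:
  fixes A B :: "real^'n::finite^'n"
  assumes "A ** B = mat 1"
  shows "matrix_inv A = B"
proof -
  have "B ** A = mat 1" using assms matrix_left_right_inverse by blast
  then have "matrix_inv A ** A = mat 1"
    using assms by (intro matrix_inv_works) (auto simp: invertible_def)
  then have "matrix_inv A ** (A ** B) = B" by (simp add: matrix_mul_assoc)
  then show ?thesis by (simp add: assms)
qed

text \<open>Cramer's rule makes every entry of the inverse a quotient of determinants. Continuity
  and smoothness of the inverse are read off from it.\<close>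

lemma matrix_inv_cramer:
  fixes A :: "real^'n::finite^'n"
  assumes "det A \<noteq> 0"
  shows "matrix_inv A $ k $ m = det (\<chi> i j. if j = k then (if i = m then 1 else 0) else A $ i $ j) / det A"
proof -
  have "A *v (matrix_inv A *v axis m 1) = axis m 1"
    using assms by (simp add: matrix_vector_mul_assoc matrix_inv_works invertible_det_nz)
  then have "matrix_inv A *v axis m 1
      = (\<chi> k. det (\<chi> i j. if j = k then axis m 1 $ i else A $ i $ j) / det A)"
    using cramer[OF assms] by blast
  then have "(matrix_inv A *v axis m 1) $ k = det (\<chi> i j. if j = k then axis m 1 $ i else A $ i $ j) / det A"
    by simp
  then show ?thesis
    by (simp add: axis_def eq_commute matrix_vector_mult_def if_distrib sum.delta cong: if_cong)
qed

lemma tendsto_det: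
  fixes A :: "_ \<Rightarrow> real^'n::finite^'n"
  assumes "\<And>i j. ((\<lambda>x. A x $ i $ j) \<longlongrightarrow> B $ i $ j) F"
  shows "((\<lambda>x. det (A x)) \<longlongrightarrow> det B) F"
  unfolding det_def by (intro tendsto_intros assms)

lemma smooth_on_det:
  fixes A :: "_ \<Rightarrow> real^'n::finite^'n"
  assumes "open S" "\<And>i j. smooth_on (\<lambda>x. A x $ i $ j) S"
  shows "smooth_on (\<lambda>x. det (A x)) S"
  unfolding det_def by (intro smooth_intros assms)

lemma tendsto_matrix_inv:
  fixes A :: "_ \<Rightarrow> real^'n::finite^'n"
  assumes "\<And>i j. ((\<lambda>x. A x $ i $ j) \<longlongrightarrow> B $ i $ j) F" "det B \<noteq> 0"
  shows "((\<lambda>x. matrix_inv (A x) $ k $ m) \<longlongrightarrow> matrix_inv B $ k $ m) F"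
proof -
  have "\<forall>\<^sub>F x in F. det (A x) \<noteq> 0"
    using tendsto_imp_eventually_ne[OF tendsto_det assms(2)] assms(1) by blast
  moreover have "((\<lambda>x. det (\<chi> i j. if j = k then (if i = m then 1 else 0) else A x $ i $ j) / det (A x)) \<longlongrightarrow>
      det (\<chi> i j. if j = k then (if i = m then 1 else 0) else B $ i $ j) / det B) F"
    by (intro tendsto_divide tendsto_det assms) (auto intro: assms)
  ultimately show ?thesis
    unfolding matrix_inv_cramer[OF assms(2)]
    by (elim Lim_transform_eventually) (auto elim!: eventually_mono simp: matrix_inv_cramer)
qed

lemma smooth_on_matrix_inv:
  fixes A :: "_ \<Rightarrow> real^'n::finite^'n"
  assumes "open S" "\<And>i j. smooth_on (\<lambda>x. A x $ i $ j) S" "\<And>x. x \<in> S \<Longrightarrow> det (A x) \<noteq> 0"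
  shows "smooth_on (\<lambda>x. matrix_inv (A x) $ k $ m) S"
proof -
  have "smooth_on (\<lambda>x. (\<chi> i j. if j = k then (if i = m then 1 else 0) else A x $ i $ j) $ i $ j) S" for i j
    by (cases "j = k") (auto intro: assms smooth_on_const)
  then have "smooth_on (\<lambda>x. det (\<chi> i j. if j = k then (if i = m then 1 else 0) else A x $ i $ j) / det (A x)) S"
    by (intro smooth_on_divide smooth_on_det assms)
  then show ?thesis
    by (rule smooth_on_cong[OF assms(1), rotated]) (simp add: matrix_inv_cramer assms(3))
qed

lemma spd_invertible: "spd G \<Longrightarrow> invertible G"
proof -
  assume "spd G"
  then have "G *v u = 0 \<Longrightarrow> u = 0" for u
    unfolding spd_def by (metis inner_zero_right less_irrefl)
  then show "invertible G"
    using matrix_left_invertible_ker invertible_left_inverse by blast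
qed

lemma spd_det: "spd G \<Longrightarrow> det G \<noteq> 0"
  using spd_invertible invertible_det_nz by blast

lemmas spd_inv = matrix_inv_works[OF spd_invertible]

lemma transpose_matrix_inv:
  assumes "invertible (A :: real^'n::finite^'n)"
  shows "transpose (matrix_inv A) = matrix_inv (transpose A)"
  using matrix_inv_works(2)[OF assms] matrix_transpose_mul[of "matrix_inv A" A]
  by (intro matrix_inv_unique[symmetric]) (simp add: transpose_mat)

lemma spd_transpose: "spd G \<Longrightarrow> transpose G = G"
  by (simp add: spd_def transpose_def vec_eq_iff)

lemma spd_inv_sym: "spd G \<Longrightarrow> matrix_inv G $ i $ j = matrix_inv G $ j $ i"
proof -
  assume "spd G"
  then have "transpose (matrix_inv G) $ j $ i = matrix_inv G $ j $ i"
    by (simp add: transpose_matrix_inv spd_invertible spd_transpose)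
  then show ?thesis by (simp add: transpose_def)
qed

lemma spd_matrix_inv: assumes "spd G" shows "spd (matrix_inv G)"
  unfolding spd_def
proof (intro conjI allI impI)
  fix u :: "real^'a" assume "u \<noteq> 0"
  define w where "w = matrix_inv G *v u"
  have u: "u = G *v w"
    by (simp add: w_def matrix_vector_mul_assoc spd_inv[OF assms])
  with \<open>u \<noteq> 0\<close> have "w \<noteq> 0" by auto
  then have "w \<bullet> (G *v w) > 0" using assms by (auto simp: spd_def)
  moreover have "u \<bullet> (matrix_inv G *v u) = w \<bullet> (G *v w)"
    unfolding w_def[symmetric] by (simp add: u inner_commute)
  ultimately show "u \<bullet> (matrix_inv G *v u) > 0" by simp
qed (rule spd_inv_sym[OF assms])

lemma spd_diag: "spd G \<Longrightarrow> G $ i $ i > 0"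
proof -
  assume "spd G"
  then have "axis i 1 \<bullet> (G *v axis i 1) > 0"
    by (simp add: spd_def)
  then show ?thesis
    by (simp add: inner_axis' matrix_vector_mult_basis column_def)
qed

section \<open>Orthonormal frames and the norm of 2-tensors\<close>

lemma spd_orthonormal_vectors:
  fixes G :: "real^'n::finite^'n"
  assumes "spd G" "finite I"
  shows "\<exists>e. \<forall>i\<in>I. \<forall>j\<in>I. e i \<bullet> (G *v e j) = (if i = (j::'n) then 1 else 0)"
  using assms(2)
proof (induction I rule: finite_induct)
  case (insert a I)
  then obtain e where e: "\<And>i j. i \<in> I \<Longrightarrow> j \<in> I \<Longrightarrow> e i \<bullet> (G *v e j) = (if i = j then 1 else 0)"
    by auto
  have "card I < CARD('n)"
    using insert psubset_card_mono[of UNIV I] by auto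
  then have "dim (span (e ` I)) < DIM(real^'n)"
    using dim_le_card'[of "e ` I"] card_image_le[OF insert(1), of e] insert(1) by (simp add: dim_span)
  then obtain w where w: "w \<notin> span (e ` I)"
    by (metis UNIV_eq_I dim_UNIV less_irrefl)
  \<comment> \<open>Gram-Schmidt step: the \<open>G\<close>-orthogonal projection is subtracted from
    a vector outside the span of the former ones, which exists while fewer than
    \<open>CARD('n)\<close> are chosen.\<close>
  define w' where "w' = w - (\<Sum>i\<in>I. (e i \<bullet> (G *v w)) *\<^sub>R e i)"
  have "w' \<noteq> 0"
  proof
    assume "w' = 0"
    then have "w = (\<Sum>i\<in>I. (e i \<bullet> (G *v w)) *\<^sub>R e i)" by (simp add: w'_def)
    also have "\<dots> \<in> span (e ` I)" by (intro span_sum span_scale span_base) auto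
    finally show False using w by simp
  qed
  then have pos: "w' \<bullet> (G *v w') > 0" using assms by (auto simp: spd_def)
  have orth: "e j \<bullet> (G *v w') = 0" if "j \<in> I" for j
  proof -
    have "e j \<bullet> (G *v w') = e j \<bullet> (G *v w) - (\<Sum>i\<in>I. (e i \<bullet> (G *v w)) * (e j \<bullet> (G *v e i)))"
      by (simp add: w'_def matrix_vector_mult_diff_distrib inner_diff_right matrix_vector_mult_scaleR
          linear_sum[OF matrix_vector_mul_linear] inner_sum_right)
    also have "(\<Sum>i\<in>I. (e i \<bullet> (G *v w)) * (e j \<bullet> (G *v e i))) = (\<Sum>i\<in>I. if i = j then e i \<bullet> (G *v w) else 0)"
      by (rule sum.cong) (auto simp: e that)
    also have "e j \<bullet> (G *v w) - \<dots> = 0" using insert(1) that by simp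
    finally show ?thesis .
  qed
  have sym: "u \<bullet> (G *v v) = v \<bullet> (G *v u)" for u v
    using assms by (intro inner_matrix_vector_commute) (auto simp: spd_def)
  define f where "f = e(a := (1 / sqrt (w' \<bullet> (G *v w'))) *\<^sub>R w')"
  have "f a \<bullet> (G *v f a) = 1"
    using pos by (simp add: f_def matrix_vector_mult_scaleR field_simps flip: power2_eq_square)
  moreover have "f j = e j" "f j \<bullet> (G *v f a) = 0" "f a \<bullet> (G *v f j) = 0" if "j \<in> I" for j
  proof -
    show 1: "f j = e j" using that insert by (auto simp: f_def)
    show "f j \<bullet> (G *v f a) = 0" unfolding 1 by (simp add: f_def matrix_vector_mult_scaleR orth that)
    then show "f a \<bullet> (G *v f j) = 0" by (simp add: sym[of "f a"])
  qed
  ultimately have "\<forall>i\<in>insert a I. \<forall>j\<in>insert a I. f i \<bullet> (G *v f j) = (if i = j then 1 else 0)"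
    using e insert by auto
  then show ?case by blast
qed auto

text \<open>With the \<open>e a\<close> as columns of E, orthonormality reads E^T G E = 1. One-sided
  inverses of square matrices are two-sided, so G E E^T = 1, which gives the inverse of
  \<open>G\<close>, and E E^T G = 1, which is the expansion of a vector in the frame.\<close>

lemma spd_frame:
  fixes G :: "real^'n::finite^'n"
  assumes "spd G"
  shows "\<exists>e. (\<forall>i j. e i \<bullet> (G *v e j) = (if i = (j::'n) then 1 else 0)) \<and>
    (\<forall>i j. matrix_inv G $ i $ j = (\<Sum>a\<in>UNIV. e a $ i * e a $ j)) \<and>
    (\<forall>u. (\<Sum>a\<in>UNIV. (u \<bullet> (G *v e a)) *\<^sub>R e a) = u)"
proof -
  obtain e :: "'n \<Rightarrow> real^'n" where e: "\<And>i j. e i \<bullet> (G *v e j) = (if i = j then 1 else 0)"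
    using spd_orthonormal_vectors[OF assms, of UNIV] by auto
  define E where "E = (\<chi> i a. e a $ i)"
  have "transpose E ** (G ** E) = mat 1"
    using e by (auto simp: vec_eq_iff E_def matrix_matrix_mult_def transpose_def mat_def inner_vec_def matrix_vector_mult_def)
  then have "(G ** E) ** transpose E = mat 1"
    using matrix_left_right_inverse by blast
  then have GE: "G ** (E ** transpose E) = mat 1" by (simp add: matrix_mul_assoc)
  then have inv: "matrix_inv G = E ** transpose E" by (rule matrix_inv_unique)
  have "(E ** transpose E) ** G = mat 1"
    using GE matrix_left_right_inverse by blast
  then have "u = (E ** transpose E) *v (G *v u)" for u
    by (simp add: matrix_vector_mul_assoc)
  also have "(E ** transpose E) *v (G *v u) = (\<Sum>a\<in>UNIV. (u \<bullet> (G *v e a)) *\<^sub>R e a)" for u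
  proof -
    have "u \<bullet> (G *v e a) = e a \<bullet> (G *v u)" for a
      using assms by (intro inner_matrix_vector_commute) (auto simp: spd_def)
    then have z: "(\<Sum>i\<in>UNIV. e a $ i * (G *v u) $ i) = u \<bullet> (G *v e a)" for a
      by (simp add: inner_vec_def)
    have "(E ** transpose E) *v w = (\<chi> i. \<Sum>a\<in>UNIV. e a $ i * (\<Sum>j\<in>UNIV. e a $ j * w $ j))" for w
      unfolding matrix_vector_mul_assoc[symmetric] by (simp add: E_def vec_eq_iff matrix_vector_mult_def vector_matrix_mult_def transpose_def mult.commute)
    then show ?thesis
      by (simp add: vec_eq_iff sum_component z mult.commute)
  qed
  finally have "(\<Sum>a\<in>UNIV. (u \<bullet> (G *v e a)) *\<^sub>R e a) = u" for u by simp
  moreover have "matrix_inv G $ i $ j = (\<Sum>a\<in>UNIV. e a $ i * e a $ j)" for i j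
    by (simp add: inv E_def matrix_matrix_mult_def transpose_def)
  ultimately show ?thesis using e by blast
qed

text \<open>The radicand of \<open>tensor_norm\<close>, as a function of the inverse matrix
  \<open>I\<close> of the metric.\<close>

definition tensor_sq :: "real^'n::finite^'n \<Rightarrow> real^'n^'n \<Rightarrow> real" where
  "tensor_sq I H = (\<Sum>i\<in>UNIV. \<Sum>j\<in>UNIV. \<Sum>k\<in>UNIV. \<Sum>l\<in>UNIV. I$i$k * I$j$l * H$i$j * H$k$l)"

text \<open>Inserting the frame for both factors \<open>I\<close> turns the contraction into a
  sixfold sum, which is regrouped into squares of the values of \<open>H\<close> on frame
  vectors.\<close>

lemma tensor_sq_frame:
  fixes e :: "'n::finite \<Rightarrow> real^'n"
  assumes "\<And>i j. I $ i $ j = (\<Sum>a\<in>UNIV. e a $ i * e a $ j)"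
  shows "tensor_sq I H = (\<Sum>a\<in>UNIV. \<Sum>b\<in>UNIV. (e a \<bullet> (H *v e b))\<^sup>2)"
proof -
  have "tensor_sq I H = (\<Sum>i\<in>UNIV. \<Sum>j\<in>UNIV. \<Sum>k\<in>UNIV. \<Sum>l\<in>UNIV. \<Sum>a\<in>UNIV. \<Sum>b\<in>UNIV.
      (e a $ i * H$i$j * e b $ j) * (e a $ k * H$k$l * e b $ l))"
    unfolding tensor_sq_def
  proof (intro sum.cong refl)
    fix i j k l
    have "I$i$k * I$j$l * H$i$j * H$k$l = (\<Sum>a\<in>UNIV. \<Sum>b\<in>UNIV. (e a $ i * e a $ k) * (e b $ j * e b $ l)) * (H$i$j * H$k$l)"
      by (simp only: assms sum_product mult.assoc)
    then show "I$i$k * I$j$l * H$i$j * H$k$l = (\<Sum>a\<in>UNIV. \<Sum>b\<in>UNIV.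
      (e a $ i * H$i$j * e b $ j) * (e a $ k * H$k$l * e b $ l))"
      by (simp only: sum_distrib_right) (simp add: mult_ac)
  qed
  also have "\<dots> = (\<Sum>(i,j,k,l,a,b)\<in>UNIV. (e a $ i * H$i$j * e b $ j) * (e a $ k * H$k$l * e b $ l))"
    by (simp add: sum.cartesian_product UNIV_Times_UNIV split_beta)
  also have "\<dots> = (\<Sum>(a,b,i,j,k,l)\<in>UNIV. (e a $ i * H$i$j * e b $ j) * (e a $ k * H$k$l * e b $ l))"
    by (rule sum.reindex_bij_witness[of _ "\<lambda>(a,b,i,j,k,l). (i,j,k,l,a,b)" "\<lambda>(i,j,k,l,a,b). (a,b,i,j,k,l)"]) auto
  also have "\<dots> = (\<Sum>a\<in>UNIV. \<Sum>b\<in>UNIV. \<Sum>i\<in>UNIV. \<Sum>j\<in>UNIV. \<Sum>k\<in>UNIV. \<Sum>l\<in>UNIV. (e a $ i * H$i$j * e b $ j) * (e a $ k * H$k$l * e b $ l))"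
    by (simp add: sum.cartesian_product UNIV_Times_UNIV split_beta)
  finally show ?thesis
    unfolding inner_matrix_vector power2_eq_square sum_distrib_right unfolding sum_distrib_left .
qed

text \<open>If \<open>H\<close> vanished on all pairs of frame vectors, expanding vectors in the
  frame would give \<open>H = 0\<close>. Positivity is what allows a polarisation to be normalised
  by its length.\<close>

lemma tensor_sq_pos:
  fixes G :: "real^'n::finite^'n"
  assumes "spd G" "H \<noteq> 0"
  shows "tensor_sq (matrix_inv G) H > 0"
proof -
  obtain e :: "'n \<Rightarrow> real^'n" where e: "\<And>i j. matrix_inv G $ i $ j = (\<Sum>a\<in>UNIV. e a $ i * e a $ j)"
    "\<And>u. (\<Sum>a\<in>UNIV. (u \<bullet> (G *v e a)) *\<^sub>R e a) = u"
    using spd_frame[OF assms(1)] by blast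
  have "\<exists>a b. e a \<bullet> (H *v e b) \<noteq> 0"
  proof (rule ccontr)
    assume "\<not> (\<exists>a b. e a \<bullet> (H *v e b) \<noteq> 0)"
    then have 0: "e a \<bullet> (H *v e b) = 0" for a b by auto
    have 1: "u \<bullet> (H *v e b) = 0" for u b
      by (subst e(2)[of u, symmetric]) (simp only: inner_sum_left inner_scaleR_left 0, simp)
    have "u \<bullet> (H *v w) = 0" for u w
      by (subst e(2)[of w, symmetric]) (simp only: linear_sum[OF matrix_vector_mul_linear] inner_sum_right matrix_vector_mult_scaleR inner_scaleR_right 1, simp)
    then have "H *v w = 0" for w by (metis inner_eq_zero_iff)
    then show False using assms(2) by (simp add: matrix_eq)
  qed
  then obtain a b where "e a \<bullet> (H *v e b) \<noteq> 0" by blast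
  then have p1: "(\<Sum>b\<in>UNIV. (e a \<bullet> (H *v e b))\<^sup>2) > 0"
    by (intro sum_pos2[of _ b]) auto
  have p2: "(\<Sum>b\<in>UNIV. (e i \<bullet> (H *v e b))\<^sup>2) \<ge> 0" for i
    by (rule sum_nonneg) simp
  show ?thesis unfolding tensor_sq_frame[OF e(1)]
    by (intro sum_pos2[of UNIV a] finite UNIV_I p1 p2)
qed

text \<open>Polarisation bounds the value of \<open>H\<close> on two frame vectors by
  \<open>d\<close>: four times this value is the difference of the quadratic form at their sum and
  at their difference, whose squared \<open>G\<close>-lengths add up to 4. There are
  \<open>CARD('n)\<close> squared such pairs.\<close>

lemma tensor_sq_bound:
  fixes G :: "real^'n::finite^'n" and d :: real
  assumes "spd G" "\<And>i j. H $ i $ j = H $ j $ i" "\<And>u. \<bar>u \<bullet> (H *v u)\<bar> \<le> d * (u \<bullet> (G *v u))"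
  shows "tensor_sq (matrix_inv G) H \<le> (CARD('n) * d)\<^sup>2"
proof -
  obtain e :: "'n \<Rightarrow> real^'n" where e: "\<And>i j. e i \<bullet> (G *v e j) = (if i = j then 1 else 0)"
    "\<And>i j. matrix_inv G $ i $ j = (\<Sum>a\<in>UNIV. e a $ i * e a $ j)"
    using spd_frame[OF assms(1)] by blast
  have "\<bar>e a \<bullet> (H *v e b)\<bar> \<le> d" for a b
  proof -
    have "4 * (e a \<bullet> (H *v e b)) = (e a + e b) \<bullet> (H *v (e a + e b)) - (e a - e b) \<bullet> (H *v (e a - e b))"
      using inner_matrix_vector_commute[OF assms(2), of "e a" "e b"]
      by (simp add: matrix_vector_right_distrib matrix_vector_mult_diff_distrib inner_add_left inner_add_right
          inner_diff_left inner_diff_right)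
    moreover have "(e a + e b) \<bullet> (G *v (e a + e b)) + (e a - e b) \<bullet> (G *v (e a - e b)) = 4"
      by (simp add: matrix_vector_right_distrib matrix_vector_mult_diff_distrib inner_add_left inner_add_right
          inner_diff_left inner_diff_right e)
    then have "d * ((e a + e b) \<bullet> (G *v (e a + e b))) + d * ((e a - e b) \<bullet> (G *v (e a - e b))) = d * 4"
      unfolding distrib_left[symmetric] by (rule arg_cong)
    ultimately show ?thesis using assms(3)[of "e a + e b"] assms(3)[of "e a - e b"] by linarith
  qed
  then have "(e a \<bullet> (H *v e b))\<^sup>2 \<le> d\<^sup>2" for a b
    by (metis abs_ge_zero power2_abs power_mono)
  then have "tensor_sq (matrix_inv G) H \<le> (\<Sum>a\<in>(UNIV::'n set). \<Sum>b\<in>(UNIV::'n set). d\<^sup>2)"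
    unfolding tensor_sq_frame[OF e(2)] by (intro sum_mono)
  then show ?thesis by (simp add: power_mult_distrib power2_eq_square mult_ac)
qed

section \<open>Partial derivatives\<close>

lemma partial_eqI: "(f has_derivative f') (at x) \<Longrightarrow> partial i f x = f' (axis i 1)"
  by (metis partial_def frechet_derivative_at)

lemma partial_const: "partial i (\<lambda>x. c) x = 0"
  by (simp add: partial_def)

lemma partial_add:
  "f differentiable (at x) \<Longrightarrow> g differentiable (at x) \<Longrightarrow>
   partial i (\<lambda>x. f x + g x) x = partial i f x + partial i g x"
  unfolding partial_def frechet_derivative_works
  by (subst frechet_derivative_at[OF has_derivative_add, symmetric]) auto

lemma partial_diff:
  "f differentiable (at x) \<Longrightarrow> g differentiable (at x) \<Longrightarrow>
   partial i (\<lambda>x. f x - g x) x = partial i f x - partial i g x"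
  unfolding partial_def frechet_derivative_works
  by (subst frechet_derivative_at[OF has_derivative_diff, symmetric]) auto

lemma partial_mult:
  fixes f g :: "real^'n \<Rightarrow> real"
  shows "f differentiable (at x) \<Longrightarrow> g differentiable (at x) \<Longrightarrow>
   partial i (\<lambda>x. f x * g x) x = f x * partial i g x + partial i f x * g x"
  unfolding partial_def frechet_derivative_works
  by (subst frechet_derivative_at[OF has_derivative_mult, symmetric]) auto

lemma partial_cmult:
  fixes f :: "real^'n \<Rightarrow> real"
  shows "f differentiable (at x) \<Longrightarrow> partial i (\<lambda>x. c * f x) x = c * partial i f x"
  using partial_mult[of "\<lambda>_. c" x f i] by (simp add: partial_const)

lemma partial_sum:
  assumes "\<And>j. j \<in> J \<Longrightarrow> f j differentiable (at x)"
  shows "partial i (\<lambda>x. \<Sum>j\<in>J. f j x) x = (\<Sum>j\<in>J. partial i (f j) x)"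
  using assms unfolding partial_def frechet_derivative_works
  by (subst frechet_derivative_at[OF has_derivative_sum, symmetric]) auto

lemma partial_cong:
  assumes "open S" "x \<in> S" "\<And>y. y \<in> S \<Longrightarrow> f y = g y"
  shows "partial i f x = partial i g x"
  unfolding partial_def using frechet_derivative_cong_open[OF assms] by simp

lemma partial_compose:
  fixes T :: "real^'m::finite \<Rightarrow> real^'n::finite" and f :: "real^'n \<Rightarrow> real"
  assumes "f differentiable (at (T x))" "T differentiable (at x)"
  shows "partial i (\<lambda>x. f (T x)) x = (\<Sum>k\<in>UNIV. partial i T x $ k * partial k f (T x))"
proof -
  let ?f' = "frechet_derivative f (at (T x))"
  have lin: "linear ?f'"
    using assms(1) by (rule linear_frechet_derivative)
  have "partial i (\<lambda>x. f (T x)) x = ?f' (partial i T x)"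
    using has_derivative_compose assms unfolding frechet_derivative_works partial_def[of i T]
    by (intro partial_eqI) blast
  also have "partial i T x = (\<Sum>k\<in>UNIV. partial i T x $ k *\<^sub>R axis k 1)"
    by (simp add: vec_eq_iff sum_component axis_def if_distrib sum.delta' cong: if_cong)
  also have "?f' \<dots> = (\<Sum>k\<in>UNIV. partial i T x $ k * ?f' (axis k 1))"
    by (simp add: linear_sum[OF lin] linear_scale[OF lin])
  finally show ?thesis by (simp add: partial_def)
qed

lemma partial_component:
  assumes "T differentiable (at x)"
  shows "partial i (\<lambda>x. T x $ k) x = partial i T x $ k"
  using assms unfolding partial_def[of i T] frechet_derivative_works
  by (intro partial_eqI bounded_linear.has_derivative[OF bounded_linear_vec_nth])

lemma real_compose_has_partial:
  fixes f :: "real^'n::finite \<Rightarrow> real"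
  assumes "(T has_real_derivative d) (at (f x))" "f differentiable (at x)"
  shows "(\<lambda>x. T (f x)) differentiable (at x)" "partial i (\<lambda>x. T (f x)) x = d * partial i f x"
proof -
  have "((\<lambda>x. T (f x)) has_derivative (\<lambda>v. d * frechet_derivative f (at x) v)) (at x)"
    using has_derivative_compose[of f _ x UNIV T "(*) d"] assms unfolding frechet_derivative_works has_field_derivative_def by auto
  then show "(\<lambda>x. T (f x)) differentiable (at x)" "partial i (\<lambda>x. T (f x)) x = d * partial i f x"
    by (auto simp: differentiable_def partial_def[of i f] intro: partial_eqI)
qed

lemma partial_coordinate: "partial i (\<lambda>x. x $ j) x = (if i = j then 1 else 0)"
  for x :: "real^'n::finite"
  by (subst partial_eqI[OF bounded_linear_imp_has_derivative[OF bounded_linear_vec_nth]]) (auto simp: axis_def)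

section \<open>Symmetry of second derivatives\<close>

lemma second_difference:
  fixes f :: "real^'n::finite \<Rightarrow> real"
  assumes f: "smooth_on f (ball x (2 * h))" and "h > 0" and ab: "norm u = 1" "norm v = 1"
    and nuv: "\<And>w. frechet_derivative f (at w) u = fu w"
    and nv: "\<And>w. frechet_derivative fu (at w) v = fuv w"
  obtains w where "dist x w < 2 * h" 
    "f (x + (h/2) *\<^sub>R u + (h/2) *\<^sub>R v) - f (x + (h/2) *\<^sub>R u) - (f (x + (h/2) *\<^sub>R v) - f x) = (h/2)^2 * fuv w"
proof -
  have near: "x + s *\<^sub>R u + t *\<^sub>R v \<in> ball x (2 * h)" if "\<bar>s\<bar> \<le> h/2" "\<bar>t\<bar> \<le> h/2" for s t
  proof -
    have "norm (s *\<^sub>R u + t *\<^sub>R v) \<le> \<bar>s\<bar> + \<bar>t\<bar>"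
      using norm_triangle_ineq[of "s *\<^sub>R u" "t *\<^sub>R v"] ab by simp
    moreover have "x - (x + s *\<^sub>R u + t *\<^sub>R v) = - (s *\<^sub>R u + t *\<^sub>R v)" by simp
    then have "dist x (x + s *\<^sub>R u + t *\<^sub>R v) = norm (s *\<^sub>R u + t *\<^sub>R v)"
      by (simp only: dist_norm norm_minus_cancel)
    ultimately show ?thesis
      using that \<open>h > 0\<close> unfolding mem_ball by linarith
  qed
  have fu: "smooth_on fu (ball x (2 * h))"
    using smooth_on_frechet[OF f, of u] nuv by simp
  have d1: "((\<lambda>s. f (x + s *\<^sub>R u + t *\<^sub>R v)) has_real_derivative fu (x + s *\<^sub>R u + t *\<^sub>R v)) (at s)"
    if "\<bar>s\<bar> \<le> h/2" "\<bar>t\<bar> \<le> h/2" for s t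
  proof -
    let ?f' = "frechet_derivative f (at (x + s *\<^sub>R u + t *\<^sub>R v))"
    have D: "(f has_derivative ?f') (at (x + s *\<^sub>R u + t *\<^sub>R v))"
      using smooth_on_has_derivative[OF f near[OF that]] .
    have "((\<lambda>s. x + s *\<^sub>R u + t *\<^sub>R v) has_derivative (\<lambda>r. r *\<^sub>R u)) (at s)"
      by (auto intro!: derivative_eq_intros)
    from has_derivative_compose[OF this D]
    have "((\<lambda>s. f (x + s *\<^sub>R u + t *\<^sub>R v)) has_derivative (\<lambda>r. ?f' (r *\<^sub>R u))) (at s)" .
    moreover have "(\<lambda>r. ?f' (r *\<^sub>R u)) = (*) (fu (x + s *\<^sub>R u + t *\<^sub>R v))"
      using linear_scale[OF has_derivative_linear[OF D]] nuv by (auto simp: mult.commute)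
    ultimately show ?thesis by (simp add: has_field_derivative_def)
  qed
  have d2: "((\<lambda>t. fu (x + s *\<^sub>R u + t *\<^sub>R v)) has_real_derivative fuv (x + s *\<^sub>R u + t *\<^sub>R v)) (at t)"
    if "\<bar>s\<bar> \<le> h/2" "\<bar>t\<bar> \<le> h/2" for s t
  proof -
    let ?f' = "frechet_derivative fu (at (x + s *\<^sub>R u + t *\<^sub>R v))"
    have D: "(fu has_derivative ?f') (at (x + s *\<^sub>R u + t *\<^sub>R v))"
      using smooth_on_has_derivative[OF fu near[OF that]] .
    have "((\<lambda>t. x + s *\<^sub>R u + t *\<^sub>R v) has_derivative (\<lambda>r. r *\<^sub>R v)) (at t)"
      by (auto intro!: derivative_eq_intros)
    from has_derivative_compose[OF this D]
    have "((\<lambda>t. fu (x + s *\<^sub>R u + t *\<^sub>R v)) has_derivative (\<lambda>r. ?f' (r *\<^sub>R v))) (at t)" .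
    moreover have "(\<lambda>r. ?f' (r *\<^sub>R v)) = (*) (fuv (x + s *\<^sub>R u + t *\<^sub>R v))"
      using linear_scale[OF has_derivative_linear[OF D]] nv by (auto simp: mult.commute)
    ultimately show ?thesis by (simp add: has_field_derivative_def)
  qed
  \<comment> \<open>Taking the difference in direction \<open>v\<close> before applying the mean
    value theorem in direction \<open>u\<close> gives both values of \<open>fu\<close> the same
    \<open>s\<close>, so that a second application, in direction \<open>v\<close>, reaches
    \<open>fuv\<close> at a single point.\<close>
  define F where "F s = f (x + s *\<^sub>R u + (h/2) *\<^sub>R v) - f (x + s *\<^sub>R u + 0 *\<^sub>R v)" for s
  have "\<exists>s. 0 < s \<and> s < h/2 \<and> F (h/2) - F 0 = (h/2 - 0) * (fu (x + s *\<^sub>R u + (h/2) *\<^sub>R v) - fu (x + s *\<^sub>R u + 0 *\<^sub>R v))"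
    using \<open>h > 0\<close> unfolding F_def by (intro MVT2) (auto intro!: DERIV_diff d1 d1[of _ 0, simplified])
  then obtain s where s: "0 < s" "s < h/2"
    "F (h/2) - F 0 = (h/2) * (fu (x + s *\<^sub>R u + (h/2) *\<^sub>R v) - fu (x + s *\<^sub>R u + 0 *\<^sub>R v))" by auto
  have "\<exists>t. 0 < t \<and> t < h/2 \<and> fu (x + s *\<^sub>R u + (h/2) *\<^sub>R v) - fu (x + s *\<^sub>R u + 0 *\<^sub>R v) = (h/2 - 0) * fuv (x + s *\<^sub>R u + t *\<^sub>R v)"
    using \<open>h > 0\<close> s by (intro MVT2) (auto intro!: d2)
  then obtain t where t: "0 < t" "t < h/2"
    "fu (x + s *\<^sub>R u + (h/2) *\<^sub>R v) - fu (x + s *\<^sub>R u + 0 *\<^sub>R v) = (h/2) * fuv (x + s *\<^sub>R u + t *\<^sub>R v)" by auto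
  have "F (h/2) - F 0 = (h/2)^2 * fuv (x + s *\<^sub>R u + t *\<^sub>R v)"
    unfolding s(3) t(3) by (simp add: power2_eq_square)
  then show thesis
    using near[of s t] s(1,2) t(1,2) by (intro that[of "x + s *\<^sub>R u + t *\<^sub>R v"]) (simp_all add: F_def)
qed

text \<open>The mixed second difference is the same for both orders of the directions, and it is
  \<open>(h/2)^2\<close> times either mixed derivative at some point near \<open>x\<close>.
  Continuity then excludes a gap between the two.\<close>

lemma partial_commute:
  fixes f :: "real^'n::finite \<Rightarrow> real"
  assumes "open S" "smooth_on f S" "x \<in> S"
  shows "partial i (partial j f) x = partial j (partial i f) x"
proof (rule ccontr)
  assume ne: "\<not> ?thesis"
  define e where "e = \<bar>partial i (partial j f) x - partial j (partial i f) x\<bar> / 2"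
  have "e > 0" using ne by (simp add: e_def)
  obtain r where r: "r > 0" "ball x r \<subseteq> S" using assms openE by blast
  have "continuous_on S (partial i (partial j f))" "continuous_on S (partial j (partial i f))"
    by (intro smooth_on_imp_continuous_on smooth_on_partial assms)+
  then have "isCont (partial i (partial j f)) x" "isCont (partial j (partial i f)) x"
    using assms continuous_on_eq_continuous_at by blast+
  then obtain d1 d2 where d: "d1 > 0" "d2 > 0"
     "\<And>y. dist y x < d1 \<Longrightarrow> dist (partial i (partial j f) y) (partial i (partial j f) x) < e"
     "\<And>y. dist y x < d2 \<Longrightarrow> dist (partial j (partial i f) y) (partial j (partial i f) x) < e"
    using \<open>e > 0\<close> unfolding continuous_at_eps_delta dist_real_def[symmetric]
    by (metis dist_commute continuous_at_eps_delta)
  define h where "h = min r (min d1 d2) / 2"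
  have h: "h > 0" "2 * h \<le> r" "2 * h \<le> d1" "2 * h \<le> d2" using r d by (auto simp: h_def)
  have sm: "smooth_on f (ball x (2 * h))" using r h by (intro smooth_on_subset[OF assms(2)]) auto
  obtain w1 where w1: "dist x w1 < 2 * h"
    "f (x + (h/2) *\<^sub>R axis j 1 + (h/2) *\<^sub>R axis i 1) - f (x + (h/2) *\<^sub>R axis j 1) - (f (x + (h/2) *\<^sub>R axis i 1) - f x) = (h/2)^2 * partial i (partial j f) w1"
    by (rule second_difference[OF sm h(1), of "axis j 1" "axis i 1" "partial j f" "partial i (partial j f)"])
       (auto simp: partial_def)
  obtain w2 where w2: "dist x w2 < 2 * h"
    "f (x + (h/2) *\<^sub>R axis i 1 + (h/2) *\<^sub>R axis j 1) - f (x + (h/2) *\<^sub>R axis i 1) - (f (x + (h/2) *\<^sub>R axis j 1) - f x) = (h/2)^2 * partial j (partial i f) w2"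
    by (rule second_difference[OF sm h(1), of "axis i 1" "axis j 1" "partial i f" "partial j (partial i f)"])
       (auto simp: partial_def)
  have "x + (h/2) *\<^sub>R axis i 1 + (h/2) *\<^sub>R axis j 1 = x + (h/2) *\<^sub>R axis j 1 + (h/2) *\<^sub>R axis i 1"
    by (simp add: add_ac)
  then have "(h/2)^2 * partial i (partial j f) w1 = (h/2)^2 * partial j (partial i f) w2"
    using w1(2) w2(2) by (simp only:)
  then have "partial i (partial j f) w1 = partial j (partial i f) w2" using h by simp
  moreover have "dist (partial i (partial j f) w1) (partial i (partial j f) x) < e"
    "dist (partial j (partial i f) w2) (partial j (partial i f) x) < e"
    using w1(1) w2(1) h by (auto intro!: d(3,4) simp: dist_commute)
  ultimately show False unfolding e_def dist_real_def by argo
qed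

section \<open>Scalar curvature in terms of the 2-jet\<close>

lemma matrix_add_rdistrib: "((A + B) ** C) = (A ** C) + (B ** C)" for A :: "'a::semiring_1^'n::finite^'m"
  by (vector matrix_matrix_mult_def sum.distrib[symmetric] distrib_right)

lemma matrix_diff_ldistrib: "(A ** (B - C)) = (A ** B) - (A ** C)" for A :: "'a::ring_1^'n::finite^'m"
  by (vector matrix_matrix_mult_def sum_subtractf[symmetric] right_diff_distrib)

lemma matrix_diff_rdistrib: "((A - B) ** C) = (A ** C) - (B ** C)" for A :: "'a::ring_1^'n::finite^'m"
  by (vector matrix_matrix_mult_def sum_subtractf[symmetric] left_diff_distrib)

type_synonym 'n arr2 = "'n \<Rightarrow> 'n \<Rightarrow> real"
type_synonym 'n arr3 = "'n \<Rightarrow> 'n arr2"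
type_synonym 'n arr4 = "'n \<Rightarrow> 'n arr3"

text \<open>Throughout, \<open>I j k\<close>, \<open>D i j k\<close> and \<open>E h i j k\<close> stand for \<open>g\<^sup>j\<^sup>k\<close>, \<open>\<partial>\<^sub>i g\<^sub>j\<^sub>k\<close> and
  \<open>\<partial>\<^sub>h \<partial>\<^sub>i g\<^sub>j\<^sub>k\<close>. The scalar curvature is a sum of a term linear in the second derivatives
  and a term quadratic in the first ones.\<close>

definition chr :: "'n::finite arr3 \<Rightarrow> 'n arr3" where
  "chr D l i j = (D i j l + D j i l - D l i j) / 2"

definition dchr :: "'n::finite arr4 \<Rightarrow> 'n arr4" where
  "dchr E m l i j = (E m i j l + E m j i l - E m l i j) / 2"

definition chr2 :: "'n::finite arr2 \<Rightarrow> 'n arr3 \<Rightarrow> 'n arr3" where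
  "chr2 I D k i j = (\<Sum>l\<in>UNIV. I k l * chr D l i j)"

text \<open>Derivative of the inverse matrix, from d(g^-1) = - g^-1 (dg) g^-1.\<close>

definition dinv :: "'n::finite arr2 \<Rightarrow> 'n arr3 \<Rightarrow> 'n arr3" where
  "dinv I D m k l = - (\<Sum>a\<in>UNIV. \<Sum>b\<in>UNIV. I k a * D m a b * I b l)"

definition scal_lin :: "'n::finite arr2 \<Rightarrow> 'n arr4 \<Rightarrow> real" where
  "scal_lin I E = (\<Sum>j\<in>UNIV. \<Sum>k\<in>UNIV. I j k * (\<Sum>i\<in>UNIV. \<Sum>l\<in>UNIV.
     I i l * (dchr E i l j k - dchr E j l i k)))"

text \<open>The quadratic part is polarised: \<open>D\<close> enters through the derivative of the
  inverse and the left Christoffel factor, \<open>D'\<close> through the other factors. Bilinearity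
  then separates the terms mixed between background and wave.\<close>

definition scal_quad :: "'n::finite arr2 \<Rightarrow> 'n arr3 \<Rightarrow> 'n arr3 \<Rightarrow> real" where
  "scal_quad I D D' = (\<Sum>j\<in>UNIV. \<Sum>k\<in>UNIV. I j k * (\<Sum>i\<in>UNIV.
     (\<Sum>l\<in>UNIV. dinv I D i i l * chr D' l j k - dinv I D j i l * chr D' l i k) +
     (\<Sum>m\<in>UNIV. chr2 I D i i m * chr2 I D' m j k - chr2 I D i j m * chr2 I D' m i k)))"

text \<open>The zeroth jet is stored as the inverse matrix, the form in which the metric enters
  \<open>scal_lin\<close> and \<open>scal_quad\<close>.\<close>

definition jet0 :: "(real^'n::finite \<Rightarrow> real^'n^'n) \<Rightarrow> real^'n \<Rightarrow> 'n arr2" where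
  "jet0 G x i j = matrix_inv (G x) $ i $ j"

definition jet1 :: "(real^'n::finite \<Rightarrow> real^'n^'n) \<Rightarrow> real^'n \<Rightarrow> 'n arr3" where
  "jet1 G x i j k = partial i (\<lambda>y. G y $ j $ k) x"

definition jet2 :: "(real^'n::finite \<Rightarrow> real^'n^'n) \<Rightarrow> real^'n \<Rightarrow> 'n arr4" where
  "jet2 G x i j k l = partial i (partial j (\<lambda>y. G y $ k $ l)) x"

text \<open>Differentiate the identity g^-1 g = 1 and multiply by g^-1 from the right.\<close>

lemma partial_matrix_inv:
  fixes G :: "real^'m::finite \<Rightarrow> real^'n::finite^'n"
  assumes S: "open S" "x \<in> S" and G: "\<And>i j. smooth_on (\<lambda>y. G y $ i $ j) S"
    and det: "\<And>y. y \<in> S \<Longrightarrow> det (G y) \<noteq> 0"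
  shows "partial m (\<lambda>y. matrix_inv (G y) $ k $ l) x
    = - (\<Sum>a\<in>UNIV. \<Sum>b\<in>UNIV. matrix_inv (G x) $ k $ a * partial m (\<lambda>y. G y $ a $ b) x * matrix_inv (G x) $ b $ l)"
proof -
  let ?I = "\<lambda>y. matrix_inv (G y)"
  let ?dI = "\<chi> k l. partial m (\<lambda>y. ?I y $ k $ l) x"
  let ?dG = "\<chi> k l. partial m (\<lambda>y. G y $ k $ l) x"
  have inv: "?I y ** G y = mat 1" "G y ** ?I y = mat 1" if "y \<in> S" for y
    using det[OF that] by (simp_all add: matrix_inv_works invertible_det_nz)
  have dif: "(\<lambda>y. G y $ a $ b) differentiable (at x)" "(\<lambda>y. ?I y $ a $ b) differentiable (at x)" for a b
    using smooth_onD[OF G S(2)] smooth_onD[OF smooth_on_matrix_inv[OF S(1) G det] S(2)] by auto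
  have "?dI ** G x + ?I x ** ?dG = 0"
  proof -
    have "partial m (\<lambda>y. \<Sum>a\<in>UNIV. ?I y $ k $ a * G y $ a $ l) x = partial m (\<lambda>y. mat 1 $ k $ l) x" for k l
      by (rule partial_cong[OF S]) (use inv(1) in \<open>simp add: matrix_matrix_mult_def vec_eq_iff\<close>)
    moreover have "partial m (\<lambda>y. \<Sum>a\<in>UNIV. ?I y $ k $ a * G y $ a $ l) x
        = (\<Sum>a\<in>UNIV. partial m (\<lambda>y. ?I y $ k $ a) x * G x $ a $ l + ?I x $ k $ a * partial m (\<lambda>y. G y $ a $ l) x)" for k l
      by (subst partial_sum) (auto simp: dif partial_mult differentiable_mult add.commute)
    ultimately show ?thesis
      by (simp add: vec_eq_iff matrix_matrix_mult_def sum.distrib partial_const)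
  qed
  then have "(?dI ** G x + ?I x ** ?dG) ** ?I x = 0 ** ?I x" by simp
  then have "?dI ** (G x ** ?I x) + ?I x ** ?dG ** ?I x = 0"
    by (simp add: matrix_add_rdistrib matrix_mul_assoc)
  then have "?dI = - (?I x ** ?dG ** ?I x)"
    by (simp add: inv S eq_neg_iff_add_eq_0)
  then have "?dI $ k $ l = - (?I x ** ?dG ** ?I x) $ k $ l" by simp
  also have "(?I x ** ?dG ** ?I x) $ k $ l = (\<Sum>b\<in>UNIV. \<Sum>a\<in>UNIV. ?I x $ k $ a * ?dG $ a $ b * ?I x $ b $ l)"
    by (simp add: matrix_matrix_mult_def sum_distrib_right)
  also have "\<dots> = (\<Sum>a\<in>UNIV. \<Sum>b\<in>UNIV. ?I x $ k $ a * ?dG $ a $ b * ?I x $ b $ l)"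
    by (rule sum.swap)
  finally show ?thesis by simp
qed

lemma christoffel_jet: "christoffel G k i j x = chr2 (jet0 G x) (jet1 G x) k i j"
  by (simp add: christoffel_def chr2_def jet0_def jet1_def chr_def sum_distrib_left)

text \<open>By the product rule a derivative of \<open>christoffel\<close> splits into a part with
  second derivatives and one with the derivative of the inverse. The separation matters because only
  second derivatives of the perturbed metric grow with the frequency.\<close>

lemma scal_coord_jet:
  fixes G :: "real^'n::finite \<Rightarrow> real^'n^'n"
  assumes S: "open S" "x \<in> S" and G: "\<And>i j. smooth_on (\<lambda>y. G y $ i $ j) S"
    and det: "\<And>y. y \<in> S \<Longrightarrow> det (G y) \<noteq> 0"
  shows "scal_coord G x = scal_lin (jet0 G x) (jet2 G x) + scal_quad (jet0 G x) (jet1 G x) (jet1 G x)"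
proof -
  have sm: "smooth_on (\<lambda>y. matrix_inv (G y) $ k $ l) S" for k l
    by (rule smooth_on_matrix_inv[OF S(1) G det])
  have sm1: "smooth_on (partial m (\<lambda>y. G y $ k $ l)) S" for m k l
    by (rule smooth_on_partial[OF G])
  note dif = smooth_onD[OF sm S(2)] smooth_onD[OF G S(2)] smooth_onD[OF sm1 S(2)]
  have dchr: "partial m (\<lambda>y. chr (jet1 G y) l i j) x = dchr (jet2 G x) m l i j"
    "(\<lambda>y. chr (jet1 G y) l i j) differentiable (at x)" for m l i j
  proof -
    have "partial m (\<lambda>y. (1/2) * (partial i (\<lambda>y. G y $ j $ l) y + partial j (\<lambda>y. G y $ i $ l) y - partial l (\<lambda>y. G y $ i $ j) y)) x
      = (1/2) * (partial m (partial i (\<lambda>y. G y $ j $ l)) x + partial m (partial j (\<lambda>y. G y $ i $ l)) x - partial m (partial l (\<lambda>y. G y $ i $ j)) x)"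
      by (subst partial_cmult partial_diff partial_add; (intro dif differentiable_add differentiable_diff)?)+ (rule refl)
    then show "partial m (\<lambda>y. chr (jet1 G y) l i j) x = dchr (jet2 G x) m l i j"
      by (simp add: chr_def dchr_def jet1_def jet2_def)
    show "(\<lambda>y. chr (jet1 G y) l i j) differentiable (at x)"
      unfolding chr_def jet1_def by (intro dif differentiable_add differentiable_diff differentiable_divide) auto
  qed
  have pc: "partial m (christoffel G k i j) x =
    (\<Sum>l\<in>UNIV. jet0 G x k l * dchr (jet2 G x) m l i j + dinv (jet0 G x) (jet1 G x) m k l * chr (jet1 G x) l i j)" for m k i j
  proof -
    have "partial m (\<lambda>y. \<Sum>l\<in>UNIV. matrix_inv (G y) $ k $ l * chr (jet1 G y) l i j) x
      = (\<Sum>l\<in>UNIV. matrix_inv (G x) $ k $ l * partial m (\<lambda>y. chr (jet1 G y) l i j) x + partial m (\<lambda>y. matrix_inv (G y) $ k $ l) x * chr (jet1 G x) l i j)"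
      by (subst partial_sum) (auto simp: dif dchr(2) partial_mult differentiable_mult)
    moreover have "christoffel G k i j = (\<lambda>y. \<Sum>l\<in>UNIV. matrix_inv (G y) $ k $ l * chr (jet1 G y) l i j)"
      by (simp add: fun_eq_iff christoffel_jet chr2_def jet0_def)
    ultimately show ?thesis
      by (simp add: dchr jet0_def dinv_def jet1_def partial_matrix_inv[OF S G det])
  qed
  have "scal_coord G x = (\<Sum>j\<in>UNIV. \<Sum>k\<in>UNIV. jet0 G x j k * (\<Sum>i\<in>UNIV. 
     ((\<Sum>l\<in>UNIV. jet0 G x i l * (dchr (jet2 G x) i l j k - dchr (jet2 G x) j l i k))
      + ((\<Sum>l\<in>UNIV. dinv (jet0 G x) (jet1 G x) i i l * chr (jet1 G x) l j k - dinv (jet0 G x) (jet1 G x) j i l * chr (jet1 G x) l i k) +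
     (\<Sum>m\<in>UNIV. chr2 (jet0 G x) (jet1 G x) i i m * chr2 (jet0 G x) (jet1 G x) m j k - chr2 (jet0 G x) (jet1 G x) i j m * chr2 (jet0 G x) (jet1 G x) m i k)))))"
    unfolding scal_coord_def ricci_def riemann_def pc
    by (simp add: christoffel_jet jet0_def[symmetric] sum.distrib sum_subtractf right_diff_distrib algebra_simps)
  also have "\<dots> = scal_lin (jet0 G x) (jet2 G x) + scal_quad (jet0 G x) (jet1 G x) (jet1 G x)"
    unfolding scal_lin_def scal_quad_def by (simp add: sum.distrib distrib_left)
  finally show ?thesis .
qed

lemma scal_lin_linear: "scal_lin I (\<lambda>a b c d. E a b c d + s * E' a b c d) = scal_lin I E + s * scal_lin I E'"
proof -
  have "dchr (\<lambda>a b c d. E a b c d + s * E' a b c d) m l i j = dchr E m l i j + s * dchr E' m l i j" for m l i j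
    by (simp add: dchr_def field_simps)
  then show ?thesis
    by (simp add: scal_lin_def sum_distrib_left distrib_left algebra_simps sum.distrib sum_subtractf)
qed

lemma chr_linear: "chr (\<lambda>a b c. D a b c + s * D' a b c) l i j = chr D l i j + s * chr D' l i j"
  by (simp add: chr_def field_simps)

lemma chr2_linear: "chr2 I (\<lambda>a b c. D a b c + s * D' a b c) l i j = chr2 I D l i j + s * chr2 I D' l i j"
  by (simp add: chr2_def chr_linear sum_distrib_left sum.distrib algebra_simps)

lemma dinv_linear: "dinv I (\<lambda>a b c. D a b c + s * D' a b c) l i j = dinv I D l i j + s * dinv I D' l i j"
  by (simp add: dinv_def sum_distrib_left sum.distrib algebra_simps)

lemma scal_quad_linear_left:
  "scal_quad I (\<lambda>a b c. D a b c + s * D' a b c) F = scal_quad I D F + s * scal_quad I D' F"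
  unfolding scal_quad_def chr2_linear dinv_linear
  by (simp add: sum_distrib_left sum.distrib sum_subtractf algebra_simps)

lemma scal_quad_linear_right:
  "scal_quad I F (\<lambda>a b c. D a b c + s * D' a b c) = scal_quad I F D + s * scal_quad I F D'"
  unfolding scal_quad_def chr2_linear chr_linear
  by (simp add: sum_distrib_left sum.distrib sum_subtractf algebra_simps)

lemma scal_lin_tendsto:
  assumes "\<And>i j. ((\<lambda>n. I n i j) \<longlongrightarrow> I0 i j) F" "\<And>i j k l. ((\<lambda>n. E n i j k l) \<longlongrightarrow> E0 i j k l) F"
  shows "((\<lambda>n. scal_lin (I n) (E n)) \<longlongrightarrow> scal_lin I0 E0) F"
  unfolding scal_lin_def dchr_def by (intro tendsto_intros assms) auto

lemma scal_quad_tendsto: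
  assumes "\<And>i j. ((\<lambda>n. I n i j) \<longlongrightarrow> I0 i j) F" "\<And>i j k. ((\<lambda>n. D n i j k) \<longlongrightarrow> D0 i j k) F"
    "\<And>i j k. ((\<lambda>n. D' n i j k) \<longlongrightarrow> D0' i j k) F"
  shows "((\<lambda>n. scal_quad (I n) (D n) (D' n)) \<longlongrightarrow> scal_quad I0 D0 D0') F"
  unfolding scal_quad_def dinv_def chr2_def chr_def by (intro tendsto_intros assms) auto

lemma sum_indicator_left: "(\<Sum>i\<in>UNIV. (if i = a then 1 else 0) * f i) = (f a :: real)" for a :: "'n::finite"
proof -
  have "(\<Sum>i\<in>UNIV. (if i = a then 1 else 0) * f i) = (\<Sum>i\<in>UNIV. if i = a then f i else 0)"
    by (rule sum.cong) auto
  then show ?thesis by simp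
qed

section \<open>Leading curvature terms of a plane wave with phase direction \<open>a\<close> and
  amplitude \<open>U\<close>\<close>

locale oscillation_direction =
  fixes I U :: "'n::finite \<Rightarrow> 'n \<Rightarrow> real" and a :: 'n
  assumes I_sym: "I i j = I j i" and U_sym: "U i j = U j i"
begin

abbreviation "\<delta> i \<equiv> (if i = a then 1 else 0 :: real)"
definition "Q k j = (\<Sum>l\<in>UNIV. I k l * U l j)"

text \<open>This is the symbol of the linearised scalar curvature, divergence of the divergence
  minus Laplacian of the trace, at the covector dx_a. It vanishes on a trace free \<open>U\<close>
  that annihilates the gradient of x_a; on the metric itself it is |dx_a|^2 times one minus the
  dimension.\<close>

lemma scal_lin_rank_one:
  "scal_lin I (\<lambda>i j k l. \<delta> i * \<delta> j * U k l)
   = (\<Sum>j\<in>UNIV. \<Sum>k\<in>UNIV. I a j * U j k * I k a) - I a a * (\<Sum>j\<in>UNIV. \<Sum>k\<in>UNIV. I j k * U j k)"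
proof -
  let ?E = "\<lambda>i j k l. \<delta> i * \<delta> j * U k l"
  have d: "dchr ?E i l j k - dchr ?E j l i k = (\<delta> i * \<delta> k * U j l - \<delta> i * \<delta> l * U j k - \<delta> j * \<delta> k * U i l + \<delta> j * \<delta> l * U i k) / 2"
    for i j k l
    using U_sym[of l k] U_sym[of i k] U_sym[of i j] by (simp add: dchr_def field_simps)
  have t: "I i l * ((\<delta> i * \<delta> k * U j l - \<delta> i * \<delta> l * U j k - \<delta> j * \<delta> k * U i l + \<delta> j * \<delta> l * U i k) / 2)
    = \<delta> i * (\<delta> k * I i l * U j l / 2) - \<delta> i * (\<delta> l * (I i l * U j k / 2)) - \<delta> j * \<delta> k * (I i l * U i l) / 2 + \<delta> l * (\<delta> j * I i l * U i k / 2)"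
    for i j k l
    by (simp add: field_simps)
  have inner: "(\<Sum>i\<in>UNIV. \<Sum>l\<in>UNIV. I i l * (dchr ?E i l j k - dchr ?E j l i k))
    = \<delta> k * (\<Sum>l\<in>UNIV. I a l * U j l) / 2 - I a a * U j k / 2 - \<delta> j * \<delta> k * (\<Sum>i\<in>UNIV. \<Sum>l\<in>UNIV. I i l * U i l) / 2
      + \<delta> j * (\<Sum>i\<in>UNIV. I i a * U i k) / 2" for j k
    unfolding d t sum.distrib sum_subtractf sum_distrib_left[symmetric] sum_indicator_left
    by (simp add: sum_distrib_left sum_divide_distrib mult.assoc)
  have t2: "I j k * (\<delta> k * (\<Sum>l\<in>UNIV. I a l * U j l) / 2 - I a a * U j k / 2 - \<delta> j * \<delta> k * T / 2
      + \<delta> j * (\<Sum>i\<in>UNIV. I i a * U i k) / 2)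
    = \<delta> k * (I j k * (\<Sum>l\<in>UNIV. I a l * U j l) / 2) - I a a / 2 * (I j k * U j k) - \<delta> j * (\<delta> k * (I j k * T / 2))
      + \<delta> j * (I j k * (\<Sum>i\<in>UNIV. I i a * U i k) / 2)" for j k T
    by (simp add: field_simps)
  have s1: "(\<Sum>j\<in>UNIV. I j a * (\<Sum>l\<in>UNIV. I a l * U j l)) = (\<Sum>j\<in>UNIV. \<Sum>k\<in>UNIV. I a j * U j k * I k a)"
    by (simp add: sum_distrib_left mult_ac I_sym[of _ a])
  have s2: "(\<Sum>k\<in>UNIV. I a k * (\<Sum>i\<in>UNIV. I i a * U i k)) = (\<Sum>j\<in>UNIV. \<Sum>k\<in>UNIV. I a j * U j k * I k a)"
    by (simp add: sum_distrib_left mult_ac I_sym[of _ a] U_sym)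
  show ?thesis
    unfolding scal_lin_def inner t2 sum.distrib sum_subtractf sum_distrib_left[symmetric] sum_indicator_left
      sum_divide_distrib[symmetric] s1 s2
    by (simp add: field_simps)
qed

text \<open>\<open>T1\<close> vanishes with row \<open>a\<close> of \<open>W\<close>, and
  \<open>T3\<close> because the contracted Christoffel symbols are zero. In units of
  \<open>I a a * ?T\<close>, the derivative of the inverse (\<open>T2\<close>) yields 1/2 and the
  products of Christoffel symbols (\<open>T4\<close>) yield -1/4 + 1/4 + 1/4.\<close>

lemma scal_quad_rank_one:
  assumes null: "\<And>j. (\<Sum>l\<in>UNIV. U j l * I l a) = 0" and tr: "(\<Sum>j\<in>UNIV. \<Sum>k\<in>UNIV. I j k * U j k) = 0"
  shows "scal_quad I (\<lambda>i j k. \<delta> i * U j k) (\<lambda>i j k. \<delta> i * U j k)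
    = 3/4 * I a a * (\<Sum>i\<in>UNIV. \<Sum>j\<in>UNIV. \<Sum>k\<in>UNIV. \<Sum>l\<in>UNIV. I i k * I j l * U i j * U k l)"
    (is "scal_quad I ?D ?D = 3/4 * I a a * ?T")
proof -
  \<comment> \<open>\<open>W\<close> is \<open>U\<close> with both indices raised, \<open>Q\<close>
    with the first one only. As \<open>U\<close> annihilates the gradient of x_a, their entries with
    a raised index \<open>a\<close> vanish.\<close>
  define W where "W k l = (\<Sum>i\<in>UNIV. \<Sum>j\<in>UNIV. I k i * U i j * I j l)" for k l
  have null': "(\<Sum>l\<in>UNIV. I a l * U l j) = 0" for j
    using null[of j] by (simp add: I_sym[of a] U_sym[of _ j] mult.commute)
  have Qa: "Q a j = 0" for j unfolding Q_def by (rule null')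
  have Qv: "(\<Sum>j\<in>UNIV. Q i j * I j a) = 0" for i
  proof -
    have "(\<Sum>j\<in>UNIV. Q i j * I j a) = (\<Sum>l\<in>UNIV. I i l * (\<Sum>j\<in>UNIV. U l j * I j a))"
      unfolding Q_def sum_distrib_right sum_distrib_left by (subst sum.swap) (simp add: mult.assoc)
    then show ?thesis by (simp add: null)
  qed
  have trQ: "(\<Sum>i\<in>UNIV. Q i i) = 0"
    using tr by (simp add: Q_def U_sym)
  have WQ: "W k l = (\<Sum>j\<in>UNIV. Q k j * I j l)" for k l
    unfolding W_def Q_def sum_distrib_right by (rule sum.swap)
  have Wa: "W a l = 0" for l by (simp add: WQ Qa)
  have Wa': "W k a = 0" for k by (simp add: WQ Qv)
  have WU: "(\<Sum>i\<in>UNIV. \<Sum>l\<in>UNIV. W i l * U i l) = ?T"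
  proof -
    have "(\<Sum>i\<in>UNIV. \<Sum>l\<in>UNIV. W i l * U i l) = (\<Sum>(i,l,p,q)\<in>UNIV. I i p * U p q * I q l * U i l)"
      by (simp add: W_def sum_distrib_right sum.cartesian_product UNIV_Times_UNIV split_beta)
    also have "\<dots> = (\<Sum>(i,j,k,l)\<in>UNIV. I i k * I j l * U i j * U k l)"
      by (rule sum.reindex_bij_witness[of _ "\<lambda>(i,j,k,l). (i,j,k,l)" "\<lambda>(i,l,p,q). (i,l,p,q)"])
         (auto simp: I_sym mult_ac)
    also have "\<dots> = ?T"
      by (simp add: sum.cartesian_product UNIV_Times_UNIV split_beta)
    finally show ?thesis .
  qed
  have QQ: "(\<Sum>i\<in>UNIV. \<Sum>m\<in>UNIV. Q i m * Q m i) = ?T"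
  proof -
    have "(\<Sum>m\<in>UNIV. Q i m * Q m i) = (\<Sum>l\<in>UNIV. W i l * U i l)" for i
    proof -
      have "Q i m * Q m i = (\<Sum>l\<in>UNIV. Q i m * I m l * U i l)" for m
        unfolding Q_def[of m i] by (simp add: sum_distrib_left mult.assoc U_sym[of _ i])
      then have "(\<Sum>m\<in>UNIV. Q i m * Q m i) = (\<Sum>m\<in>UNIV. \<Sum>l\<in>UNIV. Q i m * I m l * U i l)" by simp
      also have "\<dots> = (\<Sum>l\<in>UNIV. W i l * U i l)"
        unfolding WQ sum_distrib_right by (rule sum.swap)
      finally show ?thesis .
    qed
    then show ?thesis using WU by simp
  qed
  have c1: "chr ?D l j k = (\<delta> j * U k l + \<delta> k * U j l - \<delta> l * U j k) / 2" for l j k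
    by (simp add: chr_def)
  have c2: "chr2 I ?D i j k = (\<delta> j * Q i k + \<delta> k * Q i j - I i a * U j k) / 2" for i j k
  proof -
    have "I i l * chr ?D l j k = \<delta> j * (I i l * U l k) / 2 + \<delta> k * (I i l * U l j) / 2 - \<delta> l * (I i l * U j k / 2)" for l
      unfolding c1 U_sym[of l k] U_sym[of l j] by (simp add: field_simps)
    then show ?thesis
      unfolding chr2_def Q_def
      by (simp only: sum.distrib sum_subtractf sum_indicator_left sum_distrib_left[symmetric] sum_divide_distrib[symmetric])
         (simp add: field_simps)
  qed
  have di: "dinv I ?D m k l = - (\<delta> m * W k l)" for m k l
    by (simp add: dinv_def W_def)
  have T1: "(\<Sum>i\<in>UNIV. \<Sum>l\<in>UNIV. dinv I ?D i i l * chr ?D l j k) = 0" for j k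
  proof -
    have "(\<Sum>l\<in>UNIV. dinv I ?D i i l * chr ?D l j k) = \<delta> i * - (\<Sum>l\<in>UNIV. W i l * chr ?D l j k)" for i
      unfolding di by (simp add: sum_negf)
    then show ?thesis by (simp only: sum_indicator_left) (simp add: Wa)
  qed
  have T2: "(\<Sum>i\<in>UNIV. \<Sum>l\<in>UNIV. dinv I ?D j i l * chr ?D l i k) = - (\<delta> j * \<delta> k * ?T / 2)" for j k
  proof -
    have "dinv I ?D j i l * chr ?D l i k = - \<delta> j * (\<delta> i * (W i l * U k l / 2) + \<delta> k / 2 * (W i l * U i l) - \<delta> l * (W i l * U i k / 2))" for i l
      unfolding di c1 by (simp add: field_simps)
    then show ?thesis
      by (simp only: sum.distrib sum_subtractf sum_indicator_left sum_distrib_left[symmetric] WU) (simp add: Wa Wa')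
  qed
  have T3: "(\<Sum>i\<in>UNIV. \<Sum>m\<in>UNIV. chr2 I ?D i i m * chr2 I ?D m j k) = 0" for j k
  proof -
    have "(\<Sum>i\<in>UNIV. chr2 I ?D i i m) = 0" for m
    proof -
      have "chr2 I ?D i i m = \<delta> i * (Q i m / 2) + \<delta> m / 2 * Q i i - 1/2 * (U m i * I i a)" for i
        unfolding c2 U_sym[of i m] by (simp add: field_simps)
      then show ?thesis
        by (simp only: sum.distrib sum_subtractf sum_indicator_left sum_distrib_left[symmetric] trQ null) (simp add: Qa)
    qed
    then show ?thesis
      by (subst sum.swap) (simp add: sum_distrib_right[symmetric])
  qed
  have T4: "(\<Sum>i\<in>UNIV. \<Sum>m\<in>UNIV. chr2 I ?D i j m * chr2 I ?D m i k)
     = (\<delta> j * \<delta> k * ?T - I a a * (\<Sum>i\<in>UNIV. Q i j * U i k) - I a a * (\<Sum>m\<in>UNIV. U j m * Q m k)) / 4" for j k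
  proof -
    have e: "chr2 I ?D i j m * chr2 I ?D m i k =
        \<delta> i * (\<delta> j * Q i m * Q m k / 4) + \<delta> j * \<delta> k / 4 * (Q i m * Q m i) - \<delta> j / 4 * (U i k * (Q i m * I m a))
      + \<delta> m * (\<delta> i * (Q i j * Q m k / 4)) + \<delta> m * (\<delta> k * Q i j * Q m i / 4) - \<delta> m * (Q i j * I m a * U i k / 4)
      - \<delta> i * (I i a * U j m * Q m k / 4) - \<delta> k / 4 * (U j m * (Q m i * I i a)) + I i a * U i k / 4 * (U j m * I m a)" for i m
      unfolding c2 by (simp add: field_simps)
    have z: "(\<Sum>i\<in>UNIV. \<Sum>m\<in>UNIV. U j m * (Q m i * I i a)) = 0"
      by (subst sum.swap) (simp add: sum_distrib_left[symmetric] Qv)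
    show ?thesis
      unfolding e
      by (simp only: sum.distrib sum_subtractf sum_indicator_left sum_distrib_left[symmetric] QQ null Qv z)
         (simp add: Qa sum_divide_distrib[symmetric] sum_distrib_left[symmetric] mult.assoc mult.left_commute[of _ "I a a"] field_simps)
  qed
  have S1: "(\<Sum>j\<in>UNIV. \<Sum>k\<in>UNIV. I j k * (\<Sum>i\<in>UNIV. Q i j * U i k)) = ?T"
  proof -
    have "(\<Sum>j\<in>UNIV. \<Sum>k\<in>UNIV. I j k * (\<Sum>i\<in>UNIV. Q i j * U i k)) = (\<Sum>(j,k,i)\<in>UNIV. Q i j * I j k * U i k)"
      by (simp add: sum_distrib_left sum.cartesian_product UNIV_Times_UNIV split_beta mult_ac)
    also have "\<dots> = (\<Sum>(i,k,j)\<in>UNIV. Q i j * I j k * U i k)"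
      by (rule sum.reindex_bij_witness[of _ "\<lambda>(i,k,j). (j,k,i)" "\<lambda>(j,k,i). (i,k,j)"]) auto
    also have "\<dots> = ?T" unfolding WU[symmetric] WQ
      by (simp add: sum_distrib_right sum.cartesian_product UNIV_Times_UNIV split_beta)
    finally show ?thesis .
  qed
  have S2: "(\<Sum>j\<in>UNIV. \<Sum>k\<in>UNIV. I j k * (\<Sum>m\<in>UNIV. U j m * Q m k)) = ?T"
    using S1 by (subst sum.swap) (simp add: I_sym U_sym mult.commute)
  have "scal_quad I ?D ?D = (\<Sum>j\<in>UNIV. \<Sum>k\<in>UNIV. I j k * (\<delta> j * \<delta> k * ?T / 2 -
      (\<delta> j * \<delta> k * ?T - I a a * (\<Sum>i\<in>UNIV. Q i j * U i k) - I a a * (\<Sum>m\<in>UNIV. U j m * Q m k)) / 4))"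
    unfolding scal_quad_def sum.distrib sum_subtractf T1 T2 T3 T4 by simp
  also have "\<dots> = (\<Sum>j\<in>UNIV. \<Sum>k\<in>UNIV. \<delta> k * (\<delta> j * (I j k * ?T / 4)) + I a a / 4 * (I j k * (\<Sum>i\<in>UNIV. Q i j * U i k))
      + I a a / 4 * (I j k * (\<Sum>m\<in>UNIV. U j m * Q m k)))"
    by (intro sum.cong refl) (simp add: field_simps)
  also have "\<dots> = 3/4 * I a a * ?T"
    by (simp only: sum.distrib sum_indicator_left sum_distrib_left[symmetric] S1 S2)
  finally show ?thesis .
qed

end

section \<open>High frequency perturbations in a chart\<close>

lemma smooth_on_tendsto:
  assumes "smooth_on f S" "open S" "x \<in> S" "(X \<longlongrightarrow> x) F"
  shows "((\<lambda>n. f (X n)) \<longlongrightarrow> f x) F"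
proof -
  have "isCont f x"
    using assms smooth_on_imp_continuous_on continuous_on_eq_continuous_at by blast
  then show ?thesis using assms(4) isCont_tendsto_compose by blast
qed

lemma oscillating_partial:
  fixes f :: "real^'n::finite \<Rightarrow> real"
  assumes "f differentiable (at x)" "\<And>t. (T has_real_derivative T' t) (at t)"
  shows "(\<lambda>x. f x * T (l * x $ a)) differentiable (at x)"
    "partial i (\<lambda>x. f x * T (l * x $ a)) x
      = partial i f x * T (l * x $ a) + l * (if i = a then 1 else 0) * (f x * T' (l * x $ a))"
proof -
  have d: "(\<lambda>x::real^'n. l * x $ a) differentiable (at x)"
    by (auto intro!: derivative_intros bounded_linear_imp_differentiable bounded_linear_vec_nth)
  have "(\<lambda>x::real^'n. x $ a) differentiable (at x)"
    by (auto intro!: bounded_linear_imp_differentiable bounded_linear_vec_nth)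
  then have p: "partial i (\<lambda>x::real^'n. l * x $ a) x = l * (if i = a then 1 else 0)"
    by (simp add: partial_cmult partial_coordinate)
  note T = real_compose_has_partial[OF assms(2) d]
  show "(\<lambda>x. f x * T (l * x $ a)) differentiable (at x)"
    by (intro differentiable_mult assms T)
  show "partial i (\<lambda>x. f x * T (l * x $ a)) x
      = partial i f x * T (l * x $ a) + l * (if i = a then 1 else 0) * (f x * T' (l * x $ a))"
    by (simp add: partial_mult[OF assms(1) T(1)] T(2) p)
qed

lemma oscillating_partial2:
  fixes f :: "real^'n::finite \<Rightarrow> real"
  assumes S: "open S" "x \<in> S" and f: "smooth_on f S"
    and T: "\<And>t. (T has_real_derivative T' t) (at t)" "\<And>t. (T' has_real_derivative T'' t) (at t)"
  shows "partial i (partial j (\<lambda>x. f x * T (l * x $ a))) x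
      = partial i (partial j f) x * T (l * x $ a)
        + l * ((if j = a then 1 else 0) * partial i f x + (if i = a then 1 else 0) * partial j f x) * T' (l * x $ a)
        + l\<^sup>2 * ((if i = a then 1 else 0) * (if j = a then 1 else 0) * f x * T'' (l * x $ a))"
proof -
  have "partial i (partial j (\<lambda>x. f x * T (l * x $ a))) x
    = partial i (\<lambda>x. partial j f x * T (l * x $ a) + (l * (if j = a then 1 else 0)) * (f x * T' (l * x $ a))) x"
    by (rule partial_cong[OF S]) (simp add: oscillating_partial(2)[OF smooth_onD[OF f] T(1)])
  also have "\<dots> = partial i (\<lambda>x. partial j f x * T (l * x $ a)) x
      + (l * (if j = a then 1 else 0)) * partial i (\<lambda>x. f x * T' (l * x $ a)) x"
    using oscillating_partial(1)[OF smooth_onD[OF smooth_on_partial[OF f] S(2)] T(1)]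
      oscillating_partial(1)[OF smooth_onD[OF f S(2)] T(2)]
    by (simp only: partial_add partial_cmult differentiable_mult differentiable_const)
  finally show ?thesis
    unfolding oscillating_partial(2)[OF smooth_onD[OF smooth_on_partial[OF f] S(2)] T(1)]
      oscillating_partial(2)[OF smooth_onD[OF f S(2)] T(2)]
    by (simp add: power2_eq_square algebra_simps)
qed

lemma partial_combination:
  fixes f u v w :: "real^'n::finite \<Rightarrow> real"
  assumes "f differentiable (at x)" "u differentiable (at x)" "v differentiable (at x)" "w differentiable (at x)"
  shows "partial i (\<lambda>y. f y + c * u y + d * (v y + w y)) x
    = partial i f x + c * partial i u x + d * (partial i v x + partial i w x)"
  using assms by (simp add: partial_add partial_cmult differentiable_mult differentiable_add)

definition oscillate ::
  "'n::finite \<Rightarrow> (real^'n \<Rightarrow> real^'n^'n) \<Rightarrow> (real^'n \<Rightarrow> real^'n^'n) \<Rightarrow> (real^'n \<Rightarrow> real^'n^'n) \<Rightarrow> real \<Rightarrow> real^'n \<Rightarrow> real^'n^'n"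
  where "oscillate a U V1 V2 l x = (\<chi> j k. (1/l) * (U x $ j $ k * cos (l * x $ a))
     + (1/l)\<^sup>2 * (V1 x $ j $ k * sin (l * x $ a) + V2 x $ j $ k * cos (2 * (l * x $ a))))"

lemma smooth_on_coordinate: "open S \<Longrightarrow> smooth_on (\<lambda>x::real^'n::finite. x $ a) S"
  by (rule smooth_on_vec_nth[OF _ smooth_on_id])

lemma smooth_on_oscillate:
  assumes "open S" "\<And>j k. smooth_on (\<lambda>x. U x $ j $ k) S" "\<And>j k. smooth_on (\<lambda>x. V1 x $ j $ k) S"
    "\<And>j k. smooth_on (\<lambda>x. V2 x $ j $ k) S"
  shows "smooth_on (\<lambda>x. oscillate a U V1 V2 l x $ j $ k) S"
  unfolding oscillate_def vec_lambda_beta by (intro smooth_intros smooth_on_coordinate assms)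

text \<open>The terms are sorted by powers of \<open>l\<close>. First derivatives stay bounded; in
  the second ones the last summand is the only unbounded one, kept apart in the shape to which
  \<open>scal_lin_rank_one\<close> applies.\<close>

lemma jet_oscillate:
  fixes G U V1 V2 :: "real^'n::finite \<Rightarrow> real^'n^'n" and a :: 'n
  defines "M \<equiv> \<lambda>l x. G x + oscillate a U V1 V2 l x"
  assumes S: "open S" "x \<in> S" and l: "l > 0"
    and sm: "\<And>j k. smooth_on (\<lambda>x. G x $ j $ k) S" "\<And>j k. smooth_on (\<lambda>x. U x $ j $ k) S"
      "\<And>j k. smooth_on (\<lambda>x. V1 x $ j $ k) S" "\<And>j k. smooth_on (\<lambda>x. V2 x $ j $ k) S"
  shows "jet1 (M l) x i j k = jet1 G x i j k - sin (l * x $ a) * ((if i = a then 1 else 0) * U x $ j $ k)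
      + (1/l) * (jet1 U x i j k * cos (l * x $ a) + (if i = a then 1 else 0) * (V1 x $ j $ k * cos (l * x $ a) - 2 * V2 x $ j $ k * sin (2 * (l * x $ a))))
      + (1/l)\<^sup>2 * (jet1 V1 x i j k * sin (l * x $ a) + jet1 V2 x i j k * cos (2 * (l * x $ a)))" (is ?first)
    and "jet2 (M l) x h i j k = (jet2 G x h i j k
      - sin (l * x $ a) * ((if i = a then 1 else 0) * jet1 U x h j k + (if h = a then 1 else 0) * jet1 U x i j k)
      - (if h = a then 1 else 0) * (if i = a then 1 else 0) * (V1 x $ j $ k * sin (l * x $ a) + 4 * V2 x $ j $ k * cos (2 * (l * x $ a)))
      + (1/l) * (jet2 U x h i j k * cos (l * x $ a)
         + ((if i = a then 1 else 0) * jet1 V1 x h j k + (if h = a then 1 else 0) * jet1 V1 x i j k) * cos (l * x $ a)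
         - 2 * ((if i = a then 1 else 0) * jet1 V2 x h j k + (if h = a then 1 else 0) * jet1 V2 x i j k) * sin (2 * (l * x $ a)))
      + (1/l)\<^sup>2 * (jet2 V1 x h i j k * sin (l * x $ a) + jet2 V2 x h i j k * cos (2 * (l * x $ a))))
      + (- (l * cos (l * x $ a))) * ((if h = a then 1 else 0) * (if i = a then 1 else 0) * U x $ j $ k)" (is ?second)
proof -
  let ?c = "\<lambda>t. cos t :: real" and ?s = "\<lambda>t. sin t :: real" and ?c2 = "\<lambda>t. cos (2 * t) :: real"
  have D: "(cos has_real_derivative - sin t) (at t)" "((\<lambda>t. - sin t) has_real_derivative - cos t) (at t)"
    "(sin has_real_derivative cos t) (at t)"
    "(?c2 has_real_derivative - 2 * sin (2 * t)) (at t)" "((\<lambda>t. - 2 * sin (2 * t)) has_real_derivative - 4 * cos (2 * t)) (at t)" for t :: real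
    by (auto intro!: derivative_eq_intros)
  define u where "u = (\<lambda>x. U x $ j $ k * cos (l * x $ a))"
  define v where "v = (\<lambda>x. V1 x $ j $ k * sin (l * x $ a))"
  define w where "w = (\<lambda>x. V2 x $ j $ k * cos (2 * (l * x $ a)))"
  have su: "smooth_on u S" "smooth_on v S" "smooth_on w S"
    unfolding u_def v_def w_def by (intro smooth_intros smooth_on_coordinate sm S)+
  have M: "(\<lambda>y. M l y $ j $ k) = (\<lambda>y. G y $ j $ k + (1/l) * u y + (1/l)\<^sup>2 * (v y + w y))"
    by (simp add: M_def oscillate_def u_def v_def w_def add.assoc)
  have p1: "partial i (\<lambda>y. M l y $ j $ k) y = partial i (\<lambda>y. G y $ j $ k) y + (1/l) * partial i u y + (1/l)\<^sup>2 * (partial i v y + partial i w y)"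
    if "y \<in> S" for y i
    unfolding M by (intro partial_combination smooth_onD[OF _ that] su sm)
  have "partial h (partial i (\<lambda>y. M l y $ j $ k)) x = partial h (\<lambda>y. partial i (\<lambda>y. G y $ j $ k) y + (1/l) * partial i u y + (1/l)\<^sup>2 * (partial i v y + partial i w y)) x"
    by (rule partial_cong[OF S]) (rule p1)
  also have "\<dots> = partial h (partial i (\<lambda>y. G y $ j $ k)) x + (1/l) * partial h (partial i u) x + (1/l)\<^sup>2 * (partial h (partial i v) x + partial h (partial i w) x)"
    by (intro partial_combination smooth_onD[OF _ S(2)] smooth_on_partial su sm)
  finally have p2: "partial h (partial i (\<lambda>y. M l y $ j $ k)) x = \<dots>" .
  show ?first
    unfolding jet1_def p1[OF S(2)] unfolding u_def v_def w_def
      oscillating_partial(2)[OF smooth_onD[OF sm(2) S(2)] D(1)]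
      oscillating_partial(2)[OF smooth_onD[OF sm(3) S(2)] D(3)]
      oscillating_partial(2)[OF smooth_onD[OF sm(4) S(2)] D(4)]
    using l by (simp add: power2_eq_square field_simps)
  show ?second
    unfolding jet2_def jet1_def p2 unfolding u_def v_def w_def
      oscillating_partial2[OF S sm(2) D(1) D(2)] oscillating_partial2[OF S sm(3) D(3) D(1)]
      oscillating_partial2[OF S sm(4) D(4) D(5)]
    using l by (simp add: power2_eq_square field_simps)
qed

section \<open>Limit of the scalar curvature for a trace free wave and arbitrary corrections of
  second order\<close>

locale chart_perturbation =
  fixes S :: "(real^'n::finite) set" and G U V1 V2 :: "real^'n \<Rightarrow> real^'n^'n" and a :: 'n
  assumes S: "open S"
    and smG: "\<And>j k. smooth_on (\<lambda>x. G x $ j $ k) S" and smU: "\<And>j k. smooth_on (\<lambda>x. U x $ j $ k) S"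
    and smV1: "\<And>j k. smooth_on (\<lambda>x. V1 x $ j $ k) S" and smV2: "\<And>j k. smooth_on (\<lambda>x. V2 x $ j $ k) S"
    and spdG: "\<And>x. x \<in> S \<Longrightarrow> spd (G x)"
    and symU: "\<And>x j k. x \<in> S \<Longrightarrow> U x $ j $ k = U x $ k $ j"
    and symV1: "\<And>x j k. x \<in> S \<Longrightarrow> V1 x $ j $ k = V1 x $ k $ j"
    and symV2: "\<And>x j k. x \<in> S \<Longrightarrow> V2 x $ j $ k = V2 x $ k $ j"
    and null: "\<And>x j. x \<in> S \<Longrightarrow> (\<Sum>l\<in>UNIV. U x $ j $ l * jet0 G x l a) = 0"
    and tr: "\<And>x. x \<in> S \<Longrightarrow> (\<Sum>j\<in>UNIV. \<Sum>k\<in>UNIV. jet0 G x j k * U x $ j $ k) = 0"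
begin

abbreviation "\<delta> i \<equiv> (if i = a then 1 else 0 :: real)"

definition "M l x = G x + oscillate a U V1 V2 l x"

lemma smooth_M: "smooth_on (\<lambda>x. M l x $ j $ k) S"
  unfolding M_def using smooth_on_oscillate[OF S smU smV1 smV2] by (auto intro!: smooth_on_add S smG)

lemma sym_M: "x \<in> S \<Longrightarrow> M l x $ j $ k = M l x $ k $ j"
  using spdG[of x] symU[of x j k] symV1[of x j k] symV2[of x j k] by (simp add: M_def oscillate_def spd_def)

text \<open>The exact identity J = I - J W I for the inverse J of the perturbed matrix. It acts as a
  first-order expansion whose error is carried by J itself, so limits can be taken without
  estimating a remainder.\<close>

lemma matrix_inv_resolvent:
  assumes "x \<in> S" "det (M l x) \<noteq> 0"
  shows "jet0 (M l) x j k = jet0 G x j k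
    - (\<Sum>p\<in>UNIV. \<Sum>q\<in>UNIV. jet0 (M l) x j p * oscillate a U V1 V2 l x $ p $ q * jet0 G x q k)"
proof -
  let ?I = "matrix_inv (G x)" and ?J = "matrix_inv (M l x)" and ?W = "oscillate a U V1 V2 l x"
  have "?J ** (G x + ?W) = mat 1"
    using assms(2) matrix_inv_works(2)[of "M l x"] by (simp add: M_def[symmetric] invertible_det_nz)
  then have "(?J ** G x + ?J ** ?W) ** ?I = ?I"
    by (simp add: matrix_add_ldistrib)
  then have "?J ** (G x ** ?I) + ?J ** ?W ** ?I = ?I"
    by (simp add: matrix_add_rdistrib matrix_mul_assoc)
  then have "?J = ?I - ?J ** ?W ** ?I"
    by (simp add: spd_inv[OF spdG[OF assms(1)]] eq_diff_eq)
  then have "?J $ j $ k = ?I $ j $ k - (?J ** ?W ** ?I) $ j $ k"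
    by (metis vector_minus_component)
  also have "(?J ** ?W ** ?I) $ j $ k = (\<Sum>q\<in>UNIV. \<Sum>p\<in>UNIV. ?J $ j $ p * ?W $ p $ q * ?I $ q $ k)"
    by (simp add: matrix_matrix_mult_def sum_distrib_right)
  also have "\<dots> = (\<Sum>p\<in>UNIV. \<Sum>q\<in>UNIV. ?J $ j $ p * ?W $ p $ q * ?I $ q $ k)"
    by (rule sum.swap)
  finally show ?thesis by (simp add: jet0_def)
qed

text \<open>The fast phase is treated as a variable of its own: \<open>c\<close> and
  \<open>s\<close> are the limits of its cosine and sine along points converging to \<open>x\<close>
  and frequencies tending to infinity. The limits below depend on \<open>x\<close>, \<open>c\<close>
  and \<open>s\<close> only.\<close>

context
  fixes l :: "nat \<Rightarrow> real" and X :: "nat \<Rightarrow> real^'n" and x c s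
  assumes l: "filterlim l at_top sequentially" and XS: "\<And>n. X n \<in> S" and x: "x \<in> S" and X: "X \<longlonglongrightarrow> x"
    and c: "(\<lambda>n. cos (l n * X n $ a)) \<longlonglongrightarrow> c" and s: "(\<lambda>n. sin (l n * X n $ a)) \<longlonglongrightarrow> s"
begin

lemma inv_l: "(\<lambda>n. 1 / l n) \<longlonglongrightarrow> 0"
  by (intro tendsto_divide_0[OF tendsto_const] filterlim_at_top_imp_at_infinity l)

lemma cos2: "(\<lambda>n. cos (2 * (l n * X n $ a))) \<longlonglongrightarrow> c\<^sup>2 - s\<^sup>2"
  unfolding cos_double by (intro tendsto_intros c s)

lemma sin2: "(\<lambda>n. sin (2 * (l n * X n $ a))) \<longlonglongrightarrow> 2 * s * c"
  unfolding sin_double by (intro tendsto_intros c s)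

lemmas X_tendsto = smooth_on_tendsto[OF _ S x X]

lemma jet1_tendsto: "(\<And>j k. smooth_on (\<lambda>x. F x $ j $ k) S) \<Longrightarrow> (\<lambda>n. jet1 F (X n) i j k) \<longlonglongrightarrow> jet1 F x i j k"
  unfolding jet1_def by (intro X_tendsto smooth_on_partial)

lemma jet2_tendsto: "(\<And>j k. smooth_on (\<lambda>x. F x $ j $ k) S) \<Longrightarrow> (\<lambda>n. jet2 F (X n) h i j k) \<longlonglongrightarrow> jet2 F x h i j k"
  unfolding jet2_def by (intro X_tendsto smooth_on_partial)

lemmas limits = inv_l cos2 sin2 c s X_tendsto[OF smG] X_tendsto[OF smU] X_tendsto[OF smV1] X_tendsto[OF smV2]
  jet1_tendsto[OF smG] jet1_tendsto[OF smU] jet1_tendsto[OF smV1] jet1_tendsto[OF smV2]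
  jet2_tendsto[OF smG] jet2_tendsto[OF smU] jet2_tendsto[OF smV1] jet2_tendsto[OF smV2]

lemma oscillate_tendsto: "(\<lambda>n. oscillate a U V1 V2 (l n) (X n) $ j $ k) \<longlonglongrightarrow> 0"
proof -
  have "(\<lambda>n. oscillate a U V1 V2 (l n) (X n) $ j $ k) \<longlonglongrightarrow> 0 * (U x $ j $ k * c) + 0\<^sup>2 * (V1 x $ j $ k * s + V2 x $ j $ k * (c\<^sup>2 - s\<^sup>2))"
    unfolding oscillate_def vec_lambda_beta by (intro tendsto_intros limits)
  then show ?thesis by simp
qed

lemma M_tendsto: "(\<lambda>n. M (l n) (X n) $ j $ k) \<longlonglongrightarrow> G x $ j $ k"
  using tendsto_add[OF X_tendsto[OF smG] oscillate_tendsto] by (simp add: M_def)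

lemma jet0_tendsto: "(\<lambda>n. jet0 (M (l n)) (X n) j k) \<longlonglongrightarrow> jet0 G x j k"
  unfolding jet0_def by (intro tendsto_matrix_inv M_tendsto spd_det spdG x)

lemma eventually_good: "\<forall>\<^sub>F n in sequentially. l n > 0 \<and> det (M (l n) (X n)) \<noteq> 0"
proof -
  have "(\<lambda>n. det (M (l n) (X n))) \<longlonglongrightarrow> det (G x)"
    by (intro tendsto_det M_tendsto)
  then have "\<forall>\<^sub>F n in sequentially. det (M (l n) (X n)) \<noteq> 0"
    using tendsto_imp_eventually_ne spd_det[OF spdG[OF x]] by blast
  moreover have "\<forall>\<^sub>F n in sequentially. l n > 0"
    using l filterlim_at_top_dense by blast
  ultimately show ?thesis by eventually_elim simp
qed

text \<open>The second derivatives of \<open>M (l n)\<close> at \<open>X n\<close> without their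
  summand of order \<open>l n\<close>. \<open>E0\<close> is the limit of these, \<open>D0\<close>
  that of the first derivatives.\<close>

definition "EE n h i j k = jet2 G (X n) h i j k
      - sin (l n * X n $ a) * (\<delta> i * jet1 U (X n) h j k + \<delta> h * jet1 U (X n) i j k)
      - \<delta> h * \<delta> i * (V1 (X n) $ j $ k * sin (l n * X n $ a) + 4 * V2 (X n) $ j $ k * cos (2 * (l n * X n $ a)))
      + (1/l n) * (jet2 U (X n) h i j k * cos (l n * X n $ a)
         + (\<delta> i * jet1 V1 (X n) h j k + \<delta> h * jet1 V1 (X n) i j k) * cos (l n * X n $ a)
         - 2 * (\<delta> i * jet1 V2 (X n) h j k + \<delta> h * jet1 V2 (X n) i j k) * sin (2 * (l n * X n $ a)))
      + (1/l n)\<^sup>2 * (jet2 V1 (X n) h i j k * sin (l n * X n $ a) + jet2 V2 (X n) h i j k * cos (2 * (l n * X n $ a)))"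

definition "D0 i j k = jet1 G x i j k - s * (\<delta> i * U x $ j $ k)"

definition "E0 h i j k = jet2 G x h i j k - s * (\<delta> i * jet1 U x h j k + \<delta> h * jet1 U x i j k)
   - \<delta> h * \<delta> i * (V1 x $ j $ k * s + 4 * V2 x $ j $ k * (c\<^sup>2 - s\<^sup>2))"

lemma EE_tendsto: "(\<lambda>n. EE n h i j k) \<longlonglongrightarrow> E0 h i j k"
proof -
  have "(\<lambda>n. EE n h i j k) \<longlonglongrightarrow> E0 h i j k + 0 * (jet2 U x h i j k * c
         + (\<delta> i * jet1 V1 x h j k + \<delta> h * jet1 V1 x i j k) * c
         - 2 * (\<delta> i * jet1 V2 x h j k + \<delta> h * jet1 V2 x i j k) * (2 * s * c))
      + 0\<^sup>2 * (jet2 V1 x h i j k * s + jet2 V2 x h i j k * (c\<^sup>2 - s\<^sup>2))"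
    unfolding EE_def E0_def by (intro tendsto_intros limits)
  then show ?thesis by simp
qed

lemma DD_tendsto: "(\<lambda>n. jet1 (M (l n)) (X n) i j k) \<longlonglongrightarrow> D0 i j k"
proof -
  let ?f = "\<lambda>n. jet1 G (X n) i j k - sin (l n * X n $ a) * (\<delta> i * U (X n) $ j $ k)
      + (1/l n) * (jet1 U (X n) i j k * cos (l n * X n $ a) + \<delta> i * (V1 (X n) $ j $ k * cos (l n * X n $ a) - 2 * V2 (X n) $ j $ k * sin (2 * (l n * X n $ a))))
      + (1/l n)\<^sup>2 * (jet1 V1 (X n) i j k * sin (l n * X n $ a) + jet1 V2 (X n) i j k * cos (2 * (l n * X n $ a)))"
  have "?f \<longlonglongrightarrow> D0 i j k + 0 * (jet1 U x i j k * c + \<delta> i * (V1 x $ j $ k * c - 2 * V2 x $ j $ k * (2 * s * c)))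
      + 0\<^sup>2 * (jet1 V1 x i j k * s + jet1 V2 x i j k * (c\<^sup>2 - s\<^sup>2))"
    unfolding D0_def by (intro tendsto_intros limits)
  then have "?f \<longlonglongrightarrow> D0 i j k" by simp
  then show ?thesis
  proof (rule Lim_transform_eventually)
    show "\<forall>\<^sub>F n in sequentially. ?f n = jet1 (M (l n)) (X n) i j k"
      using eventually_good
    proof eventually_elim
      case (elim n)
      show ?case
        unfolding M_def by (rule jet_oscillate(1)[symmetric, OF S XS _ smG smU smV1 smV2]) (use elim in simp)
    qed
  qed
qed

text \<open>The symbol vanishes for the inverse of \<open>G\<close>, but it is taken at the inverse
  J of the perturbed matrix, which differs by order 1/l; so \<open>l\<close> times the symbol
  converges. The contraction with the gradient contributes nothing in the limit, because
  \<open>U\<close> annihilates the gradient and J changes it only at order 1/l^2. The trace,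
  multiplied by \<open>l\<close>, tends to \<open>- c\<close> times |U|^2.\<close>

lemma singular_part_tendsto:
  "(\<lambda>n. - (l n * cos (l n * X n $ a)) * scal_lin (jet0 (M (l n)) (X n)) (\<lambda>h i j k. \<delta> h * \<delta> i * U (X n) $ j $ k))
    \<longlonglongrightarrow> - c\<^sup>2 * jet0 G x a a * tensor_sq (matrix_inv (G x)) (U x)"
proof -
  define V where "V n p q = V1 (X n) $ p $ q * sin (l n * X n $ a) + V2 (X n) $ p $ q * cos (2 * (l n * X n $ a))" for n p q
  define V' where "V' p q = V1 x $ p $ q * s + V2 x $ p $ q * (c\<^sup>2 - s\<^sup>2)" for p q
  have V_lim: "(\<lambda>n. V n p q) \<longlonglongrightarrow> V' p q" for p q
    unfolding V_def V'_def by (intro tendsto_intros limits)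
  define z where "z n p = (\<Sum>q\<in>UNIV. V n p q * jet0 G (X n) q a)" for n p
  have I_lim: "(\<lambda>n. jet0 G (X n) p q) \<longlonglongrightarrow> jet0 G x p q" for p q
    unfolding jet0_def by (intro tendsto_matrix_inv spd_det spdG x limits)
  define J where "J n = jet0 (M (l n)) (X n)" for n
  have J_lim: "(\<lambda>n. J n p q) \<longlonglongrightarrow> jet0 G x p q" for p q
    unfolding J_def by (rule jet0_tendsto)
  \<comment> \<open>\<open>A n\<close> and \<open>B n\<close> are \<open>l n\<close> times the two
    terms of the symbol, with the factor \<open>l n\<close> already cancelled; facts
    \<open>1\<close> and \<open>2\<close> below establish this.\<close>
  define A where "A n = - (1/l n) * (\<Sum>j\<in>UNIV. \<Sum>k\<in>UNIV. J n a j * U (X n) $ j $ k * (\<Sum>p\<in>UNIV. J n k p * z n p))" for n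
  define B where "B n = - (\<Sum>j\<in>UNIV. \<Sum>k\<in>UNIV. \<Sum>p\<in>UNIV. \<Sum>q\<in>UNIV.
      J n j p * (U (X n) $ p $ q * cos (l n * X n $ a) + (1/l n) * V n p q) * jet0 G (X n) q k * U (X n) $ j $ k)" for n
  have eq: "- (l n * cos (l n * X n $ a)) * scal_lin (J n) (\<lambda>h i j k. \<delta> h * \<delta> i * U (X n) $ j $ k)
      = - cos (l n * X n $ a) * (A n - J n a a * B n)" if "l n > 0" "det (M (l n) (X n)) \<noteq> 0" for n
  proof -
    have W: "oscillate a U V1 V2 (l n) (X n) $ p $ q = (1/l n) * (U (X n) $ p $ q * cos (l n * X n $ a) + (1/l n) * V n p q)" for p q
      by (simp add: oscillate_def V_def power2_eq_square algebra_simps)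
    have Jsym: "J n p q = J n q p" for p q
    proof -
      have "transpose (M (l n) (X n)) = M (l n) (X n)"
        using sym_M[OF XS] by (simp add: transpose_def vec_eq_iff)
      then have "transpose (matrix_inv (M (l n) (X n))) = matrix_inv (M (l n) (X n))"
        using that(2) by (simp add: transpose_matrix_inv invertible_det_nz)
      then have "transpose (matrix_inv (M (l n) (X n))) $ q $ p = matrix_inv (M (l n) (X n)) $ q $ p" by simp
      then show ?thesis by (simp add: transpose_def J_def jet0_def)
    qed
    have od: "oscillation_direction (J n) (\<lambda>j k. U (X n) $ j $ k)"
      by (rule oscillation_direction.intro) (rule Jsym symU[OF XS])+
    have Uz: "(\<Sum>q\<in>UNIV. U (X n) $ p $ q * jet0 G (X n) q a) = 0" for p using null[OF XS] .
    \<comment> \<open>In column \<open>a\<close> the term of order 1/l of the resolvent identity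
      drops out by \<open>Uz\<close>, which leaves the order 1/l^2.\<close>
    have Ja: "J n k a = jet0 G (X n) k a - (1/l n)\<^sup>2 * (\<Sum>p\<in>UNIV. J n k p * z n p)" for k
    proof -
      have "(\<Sum>q\<in>UNIV. oscillate a U V1 V2 (l n) (X n) $ p $ q * jet0 G (X n) q a) = (1/l n)\<^sup>2 * z n p" for p
      proof -
        have "oscillate a U V1 V2 (l n) (X n) $ p $ q * jet0 G (X n) q a = (1/l n * cos (l n * X n $ a)) * (U (X n) $ p $ q * jet0 G (X n) q a)
            + (1/l n)\<^sup>2 * (V n p q * jet0 G (X n) q a)" for q
          unfolding W by (simp add: power2_eq_square algebra_simps)
        then show ?thesis
          by (simp only: sum.distrib sum_distrib_left[symmetric] Uz z_def mult_zero_right add_0_left)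
      qed
      moreover have "J n k a = jet0 G (X n) k a - (\<Sum>p\<in>UNIV. J n k p * (\<Sum>q\<in>UNIV. oscillate a U V1 V2 (l n) (X n) $ p $ q * jet0 G (X n) q a))"
        using matrix_inv_resolvent[OF XS that(2), of k a] by (simp add: J_def sum_distrib_left mult.assoc)
      ultimately show ?thesis
        by (simp add: sum_distrib_left mult_ac)
    qed
    define Y where "Y j = (\<Sum>k\<in>UNIV. U (X n) $ j $ k * (\<Sum>p\<in>UNIV. J n k p * z n p))" for j
    have R: "(\<Sum>k\<in>UNIV. U (X n) $ j $ k * J n k a) = - ((1/l n)\<^sup>2 * Y j)" for j
      unfolding Ja[of _] right_diff_distrib sum_subtractf Uz Y_def by (simp add: sum_distrib_left mult.left_commute)
    have "(\<Sum>j\<in>UNIV. \<Sum>k\<in>UNIV. J n a j * U (X n) $ j $ k * J n k a) = (\<Sum>j\<in>UNIV. - ((1/l n)\<^sup>2) * (J n a j * Y j))"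
      by (simp only: mult.assoc sum_distrib_left[symmetric] R) (simp add: sum_distrib_left mult.left_commute)
    moreover have "A n = - (1/l n) * (\<Sum>j\<in>UNIV. J n a j * Y j)"
      by (simp only: A_def mult.assoc Y_def sum_distrib_left[symmetric])
    ultimately have 1: "l n * (\<Sum>j\<in>UNIV. \<Sum>k\<in>UNIV. J n a j * U (X n) $ j $ k * J n k a) = A n"
      using that(1) by (simp only: sum_distrib_left[symmetric]) (simp add: power2_eq_square)
    have "J n j k * U (X n) $ j $ k = jet0 G (X n) j k * U (X n) $ j $ k - (1/l n) * (\<Sum>p\<in>UNIV. \<Sum>q\<in>UNIV. J n j p * (U (X n) $ p $ q * cos (l n * X n $ a) + (1/l n) * V n p q) * jet0 G (X n) q k * U (X n) $ j $ k)" for j k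
      unfolding J_def matrix_inv_resolvent[OF XS that(2), of j k] W
      by (simp only: left_diff_distrib right_diff_distrib sum_distrib_right sum_distrib_left mult_ac)
    then have "(\<Sum>j\<in>UNIV. \<Sum>k\<in>UNIV. J n j k * U (X n) $ j $ k) = (1/l n) * B n"
      by (simp only: sum_subtractf tr[OF XS] B_def sum_distrib_left[symmetric])
    then have 2: "l n * (\<Sum>j\<in>UNIV. \<Sum>k\<in>UNIV. J n j k * U (X n) $ j $ k) = B n"
      using that(1) by simp
    show ?thesis
      unfolding oscillation_direction.scal_lin_rank_one[OF od] 1[symmetric] 2[symmetric] by (simp add: algebra_simps)
  qed
  have z_lim: "(\<lambda>n. z n p) \<longlonglongrightarrow> (\<Sum>q\<in>UNIV. V' p q * jet0 G x q a)" for p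
    unfolding z_def by (intro tendsto_intros V_lim I_lim)
  have "A \<longlonglongrightarrow> - 0 * (\<Sum>j\<in>UNIV. \<Sum>k\<in>UNIV. jet0 G x a j * U x $ j $ k * (\<Sum>p\<in>UNIV. jet0 G x k p * (\<Sum>q\<in>UNIV. V' p q * jet0 G x q a)))"
    unfolding A_def by (intro tendsto_intros limits J_lim z_lim)
  moreover have "B \<longlonglongrightarrow> - (\<Sum>j\<in>UNIV. \<Sum>k\<in>UNIV. \<Sum>p\<in>UNIV. \<Sum>q\<in>UNIV.
      jet0 G x j p * (U x $ p $ q * c + 0 * V' p q) * jet0 G x q k * U x $ j $ k)"
    unfolding B_def by (intro tendsto_intros limits J_lim V_lim I_lim)
  moreover have "(\<Sum>j\<in>UNIV. \<Sum>k\<in>UNIV. \<Sum>p\<in>UNIV. \<Sum>q\<in>UNIV.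
      jet0 G x j p * (U x $ p $ q * c + 0 * V' p q) * jet0 G x q k * U x $ j $ k) = c * tensor_sq (matrix_inv (G x)) (U x)"
    unfolding tensor_sq_def sum_distrib_left
    by (intro sum.cong refl) (simp add: jet0_def spd_inv_sym[OF spdG[OF x], of _ k for k] mult_ac)
  ultimately have "(\<lambda>n. - cos (l n * X n $ a) * (A n - J n a a * B n)) \<longlonglongrightarrow> - c * (0 - jet0 G x a a * - (c * tensor_sq (matrix_inv (G x)) (U x)))"
    by (intro tendsto_intros c J_lim) auto
  then have "(\<lambda>n. - cos (l n * X n $ a) * (A n - J n a a * B n)) \<longlonglongrightarrow> - c\<^sup>2 * jet0 G x a a * tensor_sq (matrix_inv (G x)) (U x)"
    by (simp add: power2_eq_square mult_ac)
  then show ?thesis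
    unfolding J_def[symmetric]
    by (rule Lim_transform_eventually) (use eventually_good in eventually_elim, blast intro: eq[symmetric])
qed

lemma scal_coord_tendsto:
  "(\<lambda>n. scal_coord (M (l n)) (X n)) \<longlonglongrightarrow>
     scal_lin (jet0 G x) E0 + scal_quad (jet0 G x) D0 D0 - c\<^sup>2 * jet0 G x a a * tensor_sq (matrix_inv (G x)) (U x)"
proof -
  have eq: "scal_coord (M (l n)) (X n) = scal_lin (jet0 (M (l n)) (X n)) (EE n)
     + scal_quad (jet0 (M (l n)) (X n)) (jet1 (M (l n)) (X n)) (jet1 (M (l n)) (X n))
     + - (l n * cos (l n * X n $ a)) * scal_lin (jet0 (M (l n)) (X n)) (\<lambda>h i j k. \<delta> h * \<delta> i * U (X n) $ j $ k)"
    if "l n > 0" "det (M (l n) (X n)) \<noteq> 0" for n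
  proof -
    \<comment> \<open>\<open>scal_coord_jet\<close> asks for invertibility on an open set, while
      \<open>M (l n)\<close> is known to be invertible only at \<open>X n\<close>; this open subset
      provides it.\<close>
    let ?S = "S \<inter> (\<lambda>y. det (M (l n) y)) -` (- {0})"
    have "continuous_on S (\<lambda>y. det (M (l n) y))"
      by (intro smooth_on_imp_continuous_on smooth_on_det S smooth_M)
    then have "open ?S" by (intro continuous_open_preimage S) auto
    moreover have "X n \<in> ?S" using that XS by auto
    moreover have "smooth_on (\<lambda>y. M (l n) y $ i $ j) ?S" for i j
      using smooth_M by (rule smooth_on_subset) auto
    ultimately have "scal_coord (M (l n)) (X n) = scal_lin (jet0 (M (l n)) (X n)) (jet2 (M (l n)) (X n))
     + scal_quad (jet0 (M (l n)) (X n)) (jet1 (M (l n)) (X n)) (jet1 (M (l n)) (X n))"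
      by (rule scal_coord_jet) auto
    moreover have "jet2 (M (l n)) (X n) = (\<lambda>h i j k. EE n h i j k + - (l n * cos (l n * X n $ a)) * (\<delta> h * \<delta> i * U (X n) $ j $ k))"
      unfolding M_def fun_eq_iff EE_def
      by (intro allI jet_oscillate(2)[OF S XS that(1) smG smU smV1 smV2])
    ultimately show ?thesis by (simp only: scal_lin_linear add_ac)
  qed
  have "(\<lambda>n. scal_lin (jet0 (M (l n)) (X n)) (EE n)
     + scal_quad (jet0 (M (l n)) (X n)) (jet1 (M (l n)) (X n)) (jet1 (M (l n)) (X n))
     + - (l n * cos (l n * X n $ a)) * scal_lin (jet0 (M (l n)) (X n)) (\<lambda>h i j k. \<delta> h * \<delta> i * U (X n) $ j $ k))
   \<longlonglongrightarrow> scal_lin (jet0 G x) E0 + scal_quad (jet0 G x) D0 D0 + - c\<^sup>2 * jet0 G x a a * tensor_sq (matrix_inv (G x)) (U x)"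
    by (intro tendsto_add scal_lin_tendsto scal_quad_tendsto jet0_tendsto EE_tendsto DD_tendsto singular_part_tendsto)
  then have "(\<lambda>n. scal_coord (M (l n)) (X n)) \<longlonglongrightarrow> scal_lin (jet0 G x) E0 + scal_quad (jet0 G x) D0 D0 + - c\<^sup>2 * jet0 G x a a * tensor_sq (matrix_inv (G x)) (U x)"
    by (rule Lim_transform_eventually) (use eventually_good in eventually_elim, simp add: eq)
  then show ?thesis by simp
qed

end

end

lemma scal_coord_cong:
  assumes "open S" "x \<in> S" "\<And>y. y \<in> S \<Longrightarrow> F y = G y"
  shows "scal_coord F x = scal_coord G x"
proof -
  have p: "partial i (\<lambda>y. F y $ j $ k) y = partial i (\<lambda>y. G y $ j $ k) y" if "y \<in> S" for i j k y
    using assms(3) by (intro partial_cong[OF assms(1) that]) simp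
  have c: "christoffel F k i j y = christoffel G k i j y" if "y \<in> S" for i j k y
    unfolding christoffel_def p[OF that] assms(3)[OF that] ..
  have "partial m (christoffel F k i j) x = partial m (christoffel G k i j) x" for m k i j
    by (intro partial_cong[OF assms(1,2)] c)
  then show ?thesis
    unfolding scal_coord_def ricci_def riemann_def c[OF assms(2)] assms(3)[OF assms(2)] by simp
qed

text \<open>Failures at frequencies above every bound form a sequence. The points lie in a compact
  set and the cosines and sines in [-1, 1], so a subsequence satisfies the premises of
  \<open>step\<close>, and a single index with \<open>Q\<close> is a contradiction. The type of
  points is left open because the lemma is applied both to points and to pairs of a point and a unit
  vector.\<close>

lemma uniform_large_frequency:
  fixes C :: "'b::metric_space set" and p :: "'b \<Rightarrow> real"
  assumes "compact C"
    and step: "\<And>l Y y c s. filterlim l at_top sequentially \<Longrightarrow> (\<And>n. Y n \<in> C) \<Longrightarrow> y \<in> C \<Longrightarrow> Y \<longlonglongrightarrow> y \<Longrightarrow>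
      (\<lambda>n. cos (l n * p (Y n))) \<longlonglongrightarrow> c \<Longrightarrow> (\<lambda>n. sin (l n * p (Y n))) \<longlonglongrightarrow> s \<Longrightarrow> c\<^sup>2 + s\<^sup>2 = 1 \<Longrightarrow>
      \<exists>n::nat. Q (l n) (Y n)"
  shows "\<exists>\<Lambda>. \<forall>l\<ge>\<Lambda>. \<forall>y\<in>C. Q l y"
proof (rule ccontr)
  assume "\<not> ?thesis"
  then have "\<forall>n. \<exists>l y. l \<ge> real n \<and> y \<in> C \<and> \<not> Q l y" by blast
  then obtain l Y where l: "\<And>n. l n \<ge> real n" and Y: "\<And>n. Y n \<in> C" and nQ: "\<And>n. \<not> Q (l n) (Y n)"
    by metis
  define Z where "Z n = (Y n, cos (l n * p (Y n)), sin (l n * p (Y n)))" for n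
  have "compact (C \<times> {-1..1::real} \<times> {-1..1::real})"
    using assms(1) by (intro compact_Times) auto
  moreover have "Z n \<in> C \<times> {-1..1} \<times> {-1..1}" for n
    using Y by (simp add: Z_def)
  ultimately obtain z r where r: "strict_mono r" "(Z \<circ> r) \<longlonglongrightarrow> z" "z \<in> C \<times> {-1..1} \<times> {-1..1}"
    unfolding compact_eq_seq_compact_metric seq_compact_def by metis
  obtain y c s where z: "z = (y, c, s)" by (cases z) auto
  have lim: "(\<lambda>n. Y (r n)) \<longlonglongrightarrow> y" "(\<lambda>n. cos (l (r n) * p (Y (r n)))) \<longlonglongrightarrow> c" "(\<lambda>n. sin (l (r n) * p (Y (r n)))) \<longlonglongrightarrow> s"
    using tendsto_fst[OF r(2)] tendsto_fst[OF tendsto_snd[OF r(2)]] tendsto_snd[OF tendsto_snd[OF r(2)]]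
    by (simp_all add: z Z_def o_def)
  have "(\<lambda>n. (cos (l (r n) * p (Y (r n))))\<^sup>2 + (sin (l (r n) * p (Y (r n))))\<^sup>2) \<longlonglongrightarrow> c\<^sup>2 + s\<^sup>2"
    by (intro tendsto_intros lim)
  then have "c\<^sup>2 + s\<^sup>2 = 1" by (simp add: LIMSEQ_const_iff)
  moreover have "filterlim (\<lambda>n. l (r n)) at_top sequentially"
  proof (rule filterlim_at_top_mono[OF filterlim_real_sequentially always_eventually], rule allI)
    show "real n \<le> l (r n)" for n
      using l[of "r n"] seq_suble[OF r(1), of n] by linarith
  qed
  ultimately have "\<exists>n. Q (l (r n)) (Y (r n))"
    using r(3) z lim by (intro step[where y = y and c = c and s = s] Y) auto
  then show False using nQ by blast
qed

lemma tensor_sq_scaleR: "tensor_sq I (w *\<^sub>R H) = w\<^sup>2 * tensor_sq I H"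
  by (simp add: tensor_sq_def sum_distrib_left power2_eq_square mult_ac)

section \<open>Choice of the polarisation and of the conformal corrections\<close>

locale oscillation_setup =
  fixes S :: "(real^'n::finite) set" and G :: "real^'n \<Rightarrow> real^'n^'n" and \<alpha> :: "real^'n \<Rightarrow> real" and a b c :: 'n
  assumes S: "open S"
    and smG: "\<And>j k. smooth_on (\<lambda>x. G x $ j $ k) S" and sma: "smooth_on \<alpha> S"
    and spdG: "\<And>x. x \<in> S \<Longrightarrow> spd (G x)"
    and abc: "a \<noteq> b" "a \<noteq> c" "b \<noteq> c"
begin

abbreviation "\<delta>\<delta> i j \<equiv> (if i = (j::'n) then 1 else 0 :: real)"

abbreviation "I \<equiv> jet0 G"

text \<open>The covector \<open>cov j\<close> is the projection of \<open>dx\<^sub>j\<close> orthogonal to \<open>dx\<^sub>a\<close>. The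
  form \<open>P\<close> is trace free and annihilates the gradient of \<open>x\<^sub>a\<close>, so that the scalar curvature has
  no terms of the order of the frequency. \<open>V1\<close> and \<open>V2\<close> are conformal corrections of second
  order that cancel the bounded oscillating terms (of frequencies one and two), and \<open>w\<close> is
  normalised so that the mean of the remaining term is \<open>- \<alpha>\<^sup>2\<close>.\<close>

definition "cov j x = (\<chi> i. \<delta>\<delta> i j - I x a j / I x a a * \<delta>\<delta> i a)"

definition "sqn j x = (\<Sum>i\<in>UNIV. \<Sum>k\<in>UNIV. I x i k * (cov j x $ i * cov j x $ k))"

definition "P x = (\<chi> i j. sqn c x * (cov b x $ i * cov b x $ j) - sqn b x * (cov c x $ i * cov c x $ j))"

definition "w x = \<alpha> x * sqrt (8 / (I x a a * tensor_sq (matrix_inv (G x)) (P x)))"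

definition "U x = (\<chi> i j. w x * P x $ i $ j)"

text \<open>The coefficient of minus the sine of the phase in the limit of the scalar curvature
  without corrections: derivatives of the amplitude, and products of the wave with first derivatives
  of the background.\<close>

definition "L x = scal_lin (I x) (\<lambda>h i j k. \<delta>\<delta> i a * jet1 U x h j k + \<delta>\<delta> h a * jet1 U x i j k)
  + scal_quad (I x) (jet1 G x) (\<lambda>i j k. \<delta>\<delta> i a * U x $ j $ k)
  + scal_quad (I x) (\<lambda>i j k. \<delta>\<delta> i a * U x $ j $ k) (jet1 G x)"

definition "n1 = real CARD('n) - 1"

definition "V1 x = (\<chi> i j. L x / (n1 * I x a a) * G x $ i $ j)"

text \<open>The wave leaves - 7/8 cos(2t) |dx_a|^2 |U|^2, where t is the phase. Two derivatives of
  cos(2t) give a factor 4, and the symbol on the metric a factor \<open>n1\<close> |dx_a|^2; hence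
  7/32 and the division by \<open>n1\<close>.\<close>

definition "V2 x = (\<chi> i j. 7 / 32 * tensor_sq (matrix_inv (G x)) (U x) / n1 * G x $ i $ j)"

lemma n1_pos: "n1 > 0"
proof -
  have "card {a, b} \<le> CARD('n)" by (intro card_mono) auto
  then show ?thesis using abc by (simp add: n1_def)
qed

lemma I_pos: "x \<in> S \<Longrightarrow> I x a a > 0"
  using spd_diag[OF spd_matrix_inv[OF spdG]] by (simp add: jet0_def)

lemma I_sym: "x \<in> S \<Longrightarrow> I x i j = I x j i"
  using spd_inv_sym[OF spdG] by (simp add: jet0_def)

lemma cov_orth: "x \<in> S \<Longrightarrow> (\<Sum>l\<in>UNIV. cov j x $ l * I x l a) = 0"
proof -
  assume x: "x \<in> S"
  have "cov j x $ l * I x l a = (if l = j then 1 else 0) * I x l a - I x a j / I x a a * ((if l = a then 1 else 0) * I x l a)" for l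
    by (simp add: cov_def algebra_simps)
  then show ?thesis
    using I_pos[OF x] I_sym[OF x]
    by (simp only: sum_subtractf sum_distrib_left[symmetric] sum_indicator_left) simp
qed

lemma sqn_pos: "x \<in> S \<Longrightarrow> j \<noteq> a \<Longrightarrow> sqn j x > 0"
proof -
  assume x: "x \<in> S" "j \<noteq> a"
  have "cov j x $ j = 1" using x by (simp add: cov_def)
  then have "cov j x \<noteq> 0" by (metis zero_index zero_neq_one)
  then have "cov j x \<bullet> (matrix_inv (G x) *v cov j x) > 0"
    using spd_matrix_inv[OF spdG[OF x(1)]] by (simp add: spd_def)
  then show ?thesis
    by (simp add: inner_matrix_vector sqn_def jet0_def mult_ac)
qed

lemma P_nonzero: "x \<in> S \<Longrightarrow> P x \<noteq> 0"
proof -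
  assume x: "x \<in> S"
  \<comment> \<open>Component \<open>b\<close> of \<open>cov b\<close> is 1 and that of
    \<open>cov c\<close> is 0, as the three indices are distinct.\<close>
  have "P x $ b $ b = sqn c x" using abc by (simp add: P_def cov_def)
  then show ?thesis using sqn_pos[OF x, of c] abc by auto
qed

lemma N_pos: "x \<in> S \<Longrightarrow> tensor_sq (matrix_inv (G x)) (P x) > 0"
  by (intro tensor_sq_pos spdG P_nonzero)

lemma tensor_sq_U: "x \<in> S \<Longrightarrow> I x a a * tensor_sq (matrix_inv (G x)) (U x) = 8 * (\<alpha> x)\<^sup>2"
proof -
  assume x: "x \<in> S"
  have "U x = w x *\<^sub>R P x" by (simp add: U_def vec_eq_iff)
  then show ?thesis using I_pos[OF x] N_pos[OF x]
    by (simp add: tensor_sq_scaleR w_def power_mult_distrib)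
qed

lemma smooth_I: "smooth_on (\<lambda>x. I x i j) S"
  unfolding jet0_def by (intro smooth_on_matrix_inv S smG spd_det spdG)

lemma smooth_I': "smooth_on (\<lambda>x. matrix_inv (G x) $ i $ j) S"
  by (intro smooth_on_matrix_inv S smG spd_det spdG)

lemma smooth_cov: "smooth_on (\<lambda>x. cov j x $ i) S"
  unfolding cov_def vec_lambda_beta using I_pos
  by (intro smooth_intros smooth_I S) (auto simp: less_imp_neq[THEN not_sym])

lemma smooth_P: "smooth_on (\<lambda>x. P x $ i $ j) S"
  unfolding P_def vec_lambda_beta sqn_def by (intro smooth_intros smooth_I smooth_cov S)

lemma smooth_U: "smooth_on (\<lambda>x. U x $ i $ j) S"
  unfolding U_def vec_lambda_beta w_def tensor_sq_def
proof (intro smooth_intros smooth_I smooth_I' smooth_P S sma)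
  fix x assume "x \<in> S"
  then have p: "0 < I x a a * tensor_sq (matrix_inv (G x)) (P x)"
    using I_pos N_pos by simp
  show "I x a a * (\<Sum>i\<in>UNIV. \<Sum>j\<in>UNIV. \<Sum>k\<in>UNIV. \<Sum>l\<in>UNIV. matrix_inv (G x) $ i $ k * matrix_inv (G x) $ j $ l * P x $ i $ j * P x $ k $ l) \<noteq> 0"
    using p unfolding tensor_sq_def by (rule less_imp_neq[THEN not_sym])
  show "0 < 8 / (I x a a * (\<Sum>i\<in>UNIV. \<Sum>j\<in>UNIV. \<Sum>k\<in>UNIV. \<Sum>l\<in>UNIV. matrix_inv (G x) $ i $ k * matrix_inv (G x) $ j $ l * P x $ i $ j * P x $ k $ l))"
    using p unfolding tensor_sq_def by (intro divide_pos_pos) auto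
qed

lemma smooth_jet1: "(\<And>j k. smooth_on (\<lambda>x. F x $ j $ k) S) \<Longrightarrow> smooth_on (\<lambda>x. jet1 F x i j k) S"
  unfolding jet1_def by (rule smooth_on_partial)

lemma smooth_L: "smooth_on L S"
  unfolding L_def scal_lin_def scal_quad_def dchr_def chr2_def chr_def dinv_def
  by (intro smooth_intros smooth_I smooth_jet1 smG smooth_U S) auto

lemma smooth_V1: "smooth_on (\<lambda>x. V1 x $ i $ j) S"
  unfolding V1_def vec_lambda_beta using I_pos n1_pos
  by (intro smooth_intros smooth_I smooth_L smG S) (auto simp: less_imp_neq[THEN not_sym])

lemma smooth_V2: "smooth_on (\<lambda>x. V2 x $ i $ j) S"
  unfolding V2_def vec_lambda_beta tensor_sq_def using n1_pos
  by (intro smooth_intros smooth_I' smooth_U smG S) auto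

text \<open>The weights in \<open>P\<close> make the trace cancel as
  \<open>sqn c x * sqn b x - sqn b x * sqn c x\<close>; annihilation of the gradient is inherited
  from the two covectors.\<close>

sublocale chart_perturbation S G U V1 V2 a
proof
  fix x j k assume x: "x \<in> S"
  show "U x $ j $ k = U x $ k $ j" by (simp add: U_def P_def mult_ac)
  show "V1 x $ j $ k = V1 x $ k $ j" "V2 x $ j $ k = V2 x $ k $ j"
    using spdG[OF x] by (auto simp: V1_def V2_def spd_def)
  have "U x $ j $ l * I x l a = w x * sqn c x * cov b x $ j * (cov b x $ l * I x l a) - w x * sqn b x * cov c x $ j * (cov c x $ l * I x l a)" for l
    by (simp add: U_def P_def algebra_simps)
  then show "(\<Sum>l\<in>UNIV. U x $ j $ l * I x l a) = 0"
    by (simp only: sum_subtractf sum_distrib_left[symmetric] cov_orth[OF x])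
  have "I x j k * U x $ j $ k = w x * sqn c x * (I x j k * (cov b x $ j * cov b x $ k)) - w x * sqn b x * (I x j k * (cov c x $ j * cov c x $ k))" for j k
    by (simp add: U_def P_def algebra_simps)
  then show "(\<Sum>j\<in>UNIV. \<Sum>k\<in>UNIV. I x j k * U x $ j $ k) = 0"
    by (simp only: sum_subtractf sum_distrib_left[symmetric] sqn_def[symmetric]) simp
qed (rule S smG smooth_U smooth_V1 smooth_V2 spdG; assumption?)+

text \<open>The limit is independent of the phase. The terms linear in \<open>st\<close> cancel
  against \<open>V1\<close>. In units of \<alpha>^2 there remain -8 ct^2 from the singular part, 6
  st^2 from the quadratic part and 7 (ct^2 - st^2) from \<open>V2\<close>, and ct^2 + st^2 = 1 makes
  their sum -1.\<close>

lemma scal_limit: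
  assumes x: "x \<in> S" and cs: "ct\<^sup>2 + st\<^sup>2 = (1::real)"
  shows "scal_lin (I x) (\<lambda>h i j k. jet2 G x h i j k - st * (\<delta>\<delta> i a * jet1 U x h j k + \<delta>\<delta> h a * jet1 U x i j k)
       - \<delta>\<delta> h a * \<delta>\<delta> i a * (V1 x $ j $ k * st + 4 * V2 x $ j $ k * (ct\<^sup>2 - st\<^sup>2)))
     + scal_quad (I x) (\<lambda>i j k. jet1 G x i j k - st * (\<delta>\<delta> i a * U x $ j $ k)) (\<lambda>i j k. jet1 G x i j k - st * (\<delta>\<delta> i a * U x $ j $ k))
     - ct\<^sup>2 * I x a a * tensor_sq (matrix_inv (G x)) (U x) = scal_coord G x - (\<alpha> x)\<^sup>2"
proof -
  let ?T = "tensor_sq (matrix_inv (G x)) (U x)"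
  \<comment> \<open>Both corrections are multiples of \<open>G x\<close>, so they enter the limit
    through this one scalar.\<close>
  define \<kappa> where "\<kappa> = L x / (n1 * I x a a) * st + 4 * (7 / 32 * ?T / n1) * (ct\<^sup>2 - st\<^sup>2)"
  let ?A = "\<lambda>h i j k. \<delta>\<delta> i a * jet1 U x h j k + \<delta>\<delta> h a * jet1 U x i j k"
  let ?B = "\<lambda>h i j k. \<delta>\<delta> h a * \<delta>\<delta> i a * (\<kappa> * G x $ j $ k)"
  let ?D = "\<lambda>i j k. \<delta>\<delta> i a * U x $ j $ k"
  have E: "(\<lambda>h i j k. jet2 G x h i j k - st * ?A h i j k - \<delta>\<delta> h a * \<delta>\<delta> i a * (V1 x $ j $ k * st + 4 * V2 x $ j $ k * (ct\<^sup>2 - st\<^sup>2)))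
    = (\<lambda>h i j k. (jet2 G x h i j k + (- st) * ?A h i j k) + (- 1) * ?B h i j k)"
  proof -
    have "V1 x $ j $ k * st + 4 * V2 x $ j $ k * (ct\<^sup>2 - st\<^sup>2) = \<kappa> * G x $ j $ k" for j k
      by (simp only: V1_def V2_def \<kappa>_def vec_lambda_beta distrib_right distrib_left mult_ac)
    then show ?thesis by simp
  qed
  have D: "(\<lambda>i j k. jet1 G x i j k - st * ?D i j k) = (\<lambda>i j k. jet1 G x i j k + (- st) * ?D i j k)"
    by simp
  have IG: "(\<Sum>k\<in>UNIV. G x $ j $ k * I x k i) = \<delta>\<delta> j i" for i j
  proof -
    have "(G x ** matrix_inv (G x)) $ j $ i = mat 1 $ j $ i" using spd_inv[OF spdG[OF x]] by simp
    then show ?thesis by (simp add: matrix_matrix_mult_def jet0_def mat_def)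
  qed
  have od: "oscillation_direction (I x) (\<lambda>j k. \<kappa> * G x $ j $ k)"
    using spdG[OF x] I_sym[OF x] by (intro oscillation_direction.intro) (auto simp: spd_def)
  have "(\<Sum>j\<in>UNIV. \<Sum>k\<in>UNIV. I x a j * (\<kappa> * G x $ j $ k) * I x k a) = (\<Sum>j\<in>UNIV. \<kappa> * (\<delta>\<delta> j a * I x a j))"
    unfolding IG[symmetric] by (simp add: sum_distrib_left sum_distrib_right mult_ac)
  also have "\<dots> = \<kappa> * I x a a"
    by (simp only: sum_distrib_left[symmetric] sum_indicator_left)
  finally have 1: "(\<Sum>j\<in>UNIV. \<Sum>k\<in>UNIV. I x a j * (\<kappa> * G x $ j $ k) * I x k a) = \<kappa> * I x a a" .
  have "I x j k * (\<kappa> * G x $ j $ k) = \<kappa> * (G x $ j $ k * I x k j)" for j k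
    using I_sym[OF x, of j k] by simp
  then have 2: "(\<Sum>j\<in>UNIV. \<Sum>k\<in>UNIV. I x j k * (\<kappa> * G x $ j $ k)) = \<kappa> * real CARD('n)"
    by (simp only: sum_distrib_left[symmetric] IG) simp
  have linB: "scal_lin (I x) ?B = - (\<kappa> * n1 * I x a a)"
    unfolding oscillation_direction.scal_lin_rank_one[OF od] 1 2 by (simp add: n1_def algebra_simps)
  have od2: "oscillation_direction (I x) (\<lambda>j k. U x $ j $ k)"
    using I_sym[OF x] symU[OF x] by (intro oscillation_direction.intro) auto
  have quadD: "scal_quad (I x) ?D ?D = 3/4 * I x a a * ?T"
    using oscillation_direction.scal_quad_rank_one[OF od2 null[OF x] tr[OF x]]
    by (simp only: tensor_sq_def jet0_def[of G x, symmetric])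
  have G: "scal_coord G x = scal_lin (I x) (jet2 G x) + scal_quad (I x) (jet1 G x) (jet1 G x)"
    by (rule scal_coord_jet[OF S x smG]) (simp add: spd_det spdG)
  have T: "I x a a * ?T = 8 * (\<alpha> x)\<^sup>2" by (rule tensor_sq_U[OF x])
  have ct: "ct\<^sup>2 = 1 - st\<^sup>2" using cs by simp
  have F: "ct\<^sup>2 * I x a a * ?T = (1 - st\<^sup>2) * (8 * (\<alpha> x)\<^sup>2)" "3/4 * I x a a * ?T = 6 * (\<alpha> x)\<^sup>2"
    using T by (simp_all add: ct)
  have "\<kappa> * n1 * I x a a = L x * st + 7/8 * (I x a a * ?T) * (ct\<^sup>2 - st\<^sup>2)"
    using n1_pos I_pos[OF x] by (simp add: \<kappa>_def field_simps)
  then have "\<kappa> * n1 * I x a a = L x * st + 7 * (\<alpha> x)\<^sup>2 * (1 - 2 * st\<^sup>2)"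
    by (simp add: T ct)
  then show ?thesis
    unfolding E D scal_lin_linear scal_quad_linear_left scal_quad_linear_right linB quadD G F
    by (simp add: L_def algebra_simps power2_eq_square)
qed

end

section \<open>Uniform estimates on compact sets and the perturbation step in a chart\<close>

context oscillation_setup
begin

text \<open>\<open>V1\<close> contains derivatives of \<open>U\<close> through \<open>L\<close>, so
  \<alpha> is assumed to vanish on an open set around the point.\<close>

lemma oscillate_zero:
  assumes "open W" "W \<subseteq> S" "\<And>x. x \<in> W \<Longrightarrow> \<alpha> x = 0" "x \<in> W"
  shows "oscillate a U V1 V2 l x = 0"
proof -
  have U0: "U y $ j $ k = 0" if "y \<in> W" for y j k
    using assms(3)[OF that] by (simp add: U_def w_def)
  have "partial i (\<lambda>y. U y $ j $ k) x = partial i (\<lambda>y. 0) x" for i j k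
    by (rule partial_cong[OF assms(1,4) U0])
  then have j1: "jet1 U x i j k = 0" for i j k by (simp add: jet1_def partial_const)
  have "L x = 0"
    by (simp add: L_def j1 U0[OF assms(4)] scal_lin_def scal_quad_def dchr_def chr2_def chr_def dinv_def)
  moreover have "tensor_sq (matrix_inv (G x)) (U x) = 0"
    by (simp add: tensor_sq_def U0[OF assms(4)])
  ultimately show ?thesis
    by (simp add: oscillate_def U0[OF assms(4)] V1_def V2_def vec_eq_iff)
qed

lemma scal_coord_uniform:
  assumes "compact C" "C \<subseteq> S" "d > 0"
  shows "\<exists>\<Lambda>. \<forall>l\<ge>\<Lambda>. \<forall>x\<in>C. \<bar>scal_coord (M l) x - (scal_coord G x - (\<alpha> x)\<^sup>2)\<bar> < d"
proof (rule uniform_large_frequency[OF assms(1), where p = "\<lambda>x. x $ a"])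
  fix l :: "nat \<Rightarrow> real" and Y y c s
  assume l: "filterlim l at_top sequentially" and YC: "\<And>n. Y n \<in> C" and y: "y \<in> C" and Y: "Y \<longlonglongrightarrow> y"
    and c: "(\<lambda>n. cos (l n * Y n $ a)) \<longlonglongrightarrow> c" and s: "(\<lambda>n. sin (l n * Y n $ a)) \<longlonglongrightarrow> s"
    and cs: "c\<^sup>2 + s\<^sup>2 = (1::real)"
  have YS: "Y n \<in> S" for n using YC assms(2) by blast
  have yS: "y \<in> S" using y assms(2) by blast
  have 1: "(\<lambda>n. scal_coord (M (l n)) (Y n)) \<longlonglongrightarrow> scal_coord G y - (\<alpha> y)\<^sup>2"
    using scal_coord_tendsto[OF l YS yS Y c s]
    unfolding E0_def[OF l YS yS Y c s, abs_def] D0_def[OF l YS yS Y c s, abs_def] scal_limit[OF yS cs] .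
  have G: "scal_coord G x = scal_lin (I x) (jet2 G x) + scal_quad (I x) (jet1 G x) (jet1 G x)" if "x \<in> S" for x
    by (rule scal_coord_jet[OF S that smG]) (simp add: spd_det spdG)
  have "(\<lambda>n. scal_lin (I (Y n)) (jet2 G (Y n)) + scal_quad (I (Y n)) (jet1 G (Y n)) (jet1 G (Y n)))
      \<longlonglongrightarrow> scal_lin (I y) (jet2 G y) + scal_quad (I y) (jet1 G y) (jet1 G y)"
    by (intro tendsto_add scal_lin_tendsto scal_quad_tendsto smooth_on_tendsto[OF _ S yS Y] smooth_I smooth_jet1 smG)
       (unfold jet2_def, intro smooth_on_partial smG)
  then have 2: "(\<lambda>n. scal_coord G (Y n)) \<longlonglongrightarrow> scal_coord G y"
    using G YS yS by simp
  have "(\<lambda>n. scal_coord (M (l n)) (Y n) - (scal_coord G (Y n) - (\<alpha> (Y n))\<^sup>2)) \<longlonglongrightarrow>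
      (scal_coord G y - (\<alpha> y)\<^sup>2) - (scal_coord G y - (\<alpha> y)\<^sup>2)"
    by (intro tendsto_intros 1 2 smooth_on_tendsto[OF sma S yS Y])
  then have "(\<lambda>n. scal_coord (M (l n)) (Y n) - (scal_coord G (Y n) - (\<alpha> (Y n))\<^sup>2)) \<longlonglongrightarrow> 0" by simp
  from LIMSEQ_D[OF this assms(3)] show "\<exists>n. \<bar>scal_coord (M (l n)) (Y n) - (scal_coord G (Y n) - (\<alpha> (Y n))\<^sup>2)\<bar> < d"
    by auto
qed

text \<open>The perturbation tends to zero, whereas the form of \<open>R\<close> is positive on
  pairs of a point of \<open>C\<close> and a unit vector, which form a compact set. Homogeneity
  extends the inequality to all vectors.\<close>

lemma oscillate_uniform:
  assumes C: "compact C" "C \<subseteq> S" "d > 0"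
    and R: "\<And>j k. continuous_on S (\<lambda>x. R x $ j $ k)" "\<And>x. x \<in> S \<Longrightarrow> spd (R x)"
  shows "\<exists>\<Lambda>. \<forall>l\<ge>\<Lambda>. \<forall>x\<in>C. \<forall>u. \<bar>u \<bullet> (oscillate a U V1 V2 l x *v u)\<bar> \<le> d * (u \<bullet> (R x *v u))"
proof -
  have "\<exists>\<Lambda>. \<forall>l\<ge>\<Lambda>. \<forall>z\<in>C \<times> sphere 0 1. \<bar>snd z \<bullet> (oscillate a U V1 V2 l (fst z) *v snd z)\<bar> \<le> d * (snd z \<bullet> (R (fst z) *v snd z))"
  proof (rule uniform_large_frequency[where p = "\<lambda>z. fst z $ a"])
    show "compact (C \<times> sphere (0::real^'n) 1)" using C by (intro compact_Times) auto
    fix l :: "nat \<Rightarrow> real" and Z z c s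
    assume l: "filterlim l at_top sequentially" and ZC: "\<And>n. Z n \<in> C \<times> sphere (0::real^'n) 1" and z: "z \<in> C \<times> sphere 0 1" and Z: "Z \<longlonglongrightarrow> z"
      and c: "(\<lambda>n. cos (l n * fst (Z n) $ a)) \<longlonglongrightarrow> c" and s: "(\<lambda>n. sin (l n * fst (Z n) $ a)) \<longlonglongrightarrow> s"
      and cs: "c\<^sup>2 + s\<^sup>2 = (1::real)"
    have YS: "fst (Z n) \<in> S" for n using ZC[of n] C by auto
    have yS: "fst z \<in> S" using z C by auto
    have Y: "(\<lambda>n. fst (Z n)) \<longlonglongrightarrow> fst z" "(\<lambda>n. snd (Z n)) \<longlonglongrightarrow> snd z"
      using Z by (auto intro: tendsto_intros)
    have r: "(\<lambda>n. R (fst (Z n)) $ j $ k) \<longlonglongrightarrow> R (fst z) $ j $ k" for j k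
      using R(1)[of j k] continuous_on_eq_continuous_at[OF S] yS isCont_tendsto_compose[OF _ Y(1)] by fastforce
    have "(\<lambda>n. d * (snd (Z n) \<bullet> (R (fst (Z n)) *v snd (Z n))) - \<bar>snd (Z n) \<bullet> (oscillate a U V1 V2 (l n) (fst (Z n)) *v snd (Z n))\<bar>)
       \<longlonglongrightarrow> d * (\<Sum>i\<in>UNIV. \<Sum>j\<in>UNIV. snd z $ i * R (fst z) $ i $ j * snd z $ j) - \<bar>\<Sum>i\<in>UNIV. \<Sum>j\<in>UNIV. snd z $ i * 0 * snd z $ j\<bar>"
      unfolding inner_matrix_vector
      by (intro tendsto_intros r Y oscillate_tendsto[OF l YS yS Y(1) c s])
    moreover have "d * (\<Sum>i\<in>UNIV. \<Sum>j\<in>UNIV. snd z $ i * R (fst z) $ i $ j * snd z $ j) - \<bar>\<Sum>i\<in>UNIV. \<Sum>j\<in>UNIV. snd z $ i * 0 * snd z $ j\<bar> > 0"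
    proof -
      have "snd z \<noteq> 0" using z by (cases z) auto
      then show ?thesis
        using R(2)[OF yS] C(3) by (simp add: spd_def inner_matrix_vector[symmetric])
    qed
    ultimately have "\<forall>\<^sub>F n in sequentially. d * (snd (Z n) \<bullet> (R (fst (Z n)) *v snd (Z n))) - \<bar>snd (Z n) \<bullet> (oscillate a U V1 V2 (l n) (fst (Z n)) *v snd (Z n))\<bar> > 0"
      by (rule order_tendstoD(1))
    then have "\<forall>\<^sub>F n in sequentially. \<bar>snd (Z n) \<bullet> (oscillate a U V1 V2 (l n) (fst (Z n)) *v snd (Z n))\<bar> \<le> d * (snd (Z n) \<bullet> (R (fst (Z n)) *v snd (Z n)))"
      by eventually_elim linarith
    then show "\<exists>n. \<bar>snd (Z n) \<bullet> (oscillate a U V1 V2 (l n) (fst (Z n)) *v snd (Z n))\<bar> \<le> d * (snd (Z n) \<bullet> (R (fst (Z n)) *v snd (Z n)))"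
      using eventually_happens'[OF sequentially_bot] by blast
  qed
  then obtain \<Lambda> where \<Lambda>: "\<And>l x v. l \<ge> \<Lambda> \<Longrightarrow> x \<in> C \<Longrightarrow> norm v = 1 \<Longrightarrow> \<bar>v \<bullet> (oscillate a U V1 V2 l x *v v)\<bar> \<le> d * (v \<bullet> (R x *v v))"
    by (metis SigmaI fst_conv mem_sphere_0 snd_conv)
  have "\<bar>u \<bullet> (oscillate a U V1 V2 l x *v u)\<bar> \<le> d * (u \<bullet> (R x *v u))" if "l \<ge> \<Lambda>" "x \<in> C" for l x u
  proof (cases "u = 0")
    case False
    define v where "v = (1 / norm u) *\<^sub>R u"
    have u: "u = norm u *\<^sub>R v" "norm v = 1" using False by (auto simp: v_def)
    have "\<bar>u \<bullet> (oscillate a U V1 V2 l x *v u)\<bar> = (norm u)\<^sup>2 * \<bar>v \<bullet> (oscillate a U V1 V2 l x *v v)\<bar>"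
      by (subst u(1), subst (2) u(1)) (simp add: matrix_vector_mult_scaleR power2_eq_square abs_mult)
    also have "\<dots> \<le> (norm u)\<^sup>2 * (d * (v \<bullet> (R x *v v)))"
      by (intro mult_left_mono \<Lambda> that u) auto
    also have "\<dots> = d * (u \<bullet> (R x *v u))"
      by (subst (2) u(1), subst (3) u(1)) (simp add: matrix_vector_mult_scaleR power2_eq_square)
    finally show ?thesis .
  qed simp
  then show ?thesis by blast
qed

end

text \<open>On \<open>C\<close> the estimates hold for large frequencies; off \<open>C\<close> the
  amplitude vanishes on an open set and \<open>H\<close> with it. \<open>R\<close> measures the size
  of the change, and the bound by half of \<open>G\<close> keeps \<open>G + H\<close> positive
  definite. Vanishing of \<open>H\<close> on open sets without amplitude permits extension by zero
  and later makes the sequence of metrics stabilise.\<close>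

theorem euclidean_step:
  fixes S :: "(real^'n::finite) set" and G R :: "real^'n \<Rightarrow> real^'n^'n" and \<alpha> :: "real^'n \<Rightarrow> real"
  assumes S: "open S" and n: "CARD('n) \<ge> 3"
    and smG: "\<And>j k. smooth_on (\<lambda>x. G x $ j $ k) S" and sma: "smooth_on \<alpha> S"
    and spdG: "\<And>x. x \<in> S \<Longrightarrow> spd (G x)"
    and R: "\<And>j k. continuous_on S (\<lambda>x. R x $ j $ k)" "\<And>x. x \<in> S \<Longrightarrow> spd (R x)"
    and C: "compact C" "C \<subseteq> S" "\<And>x. x \<in> S - C \<Longrightarrow> \<alpha> x = 0" and d: "d > 0"
  obtains H where "\<And>j k. smooth_on (\<lambda>x. H x $ j $ k) S" "\<And>x j k. x \<in> S \<Longrightarrow> H x $ j $ k = H x $ k $ j"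
    "\<And>W x. open W \<Longrightarrow> W \<subseteq> S \<Longrightarrow> (\<And>y. y \<in> W \<Longrightarrow> \<alpha> y = 0) \<Longrightarrow> x \<in> W \<Longrightarrow> H x = 0"
    "\<And>x u. x \<in> S \<Longrightarrow> \<bar>u \<bullet> (H x *v u)\<bar> \<le> d * (u \<bullet> (R x *v u))"
    "\<And>x u. x \<in> S \<Longrightarrow> \<bar>u \<bullet> (H x *v u)\<bar> \<le> 1/2 * (u \<bullet> (G x *v u))"
    "\<And>x. x \<in> S \<Longrightarrow> \<bar>scal_coord (\<lambda>x. G x + H x) x - (scal_coord G x - (\<alpha> x)\<^sup>2)\<bar> < d"
proof -
  obtain T :: "'n set" where "card T = 3" using n obtain_subset_with_card_n by metis
  then obtain a b c :: 'n where abc: "a \<noteq> b" "a \<noteq> c" "b \<noteq> c" by (auto simp: card_3_iff)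
  interpret oscillation_setup S G \<alpha> a b c
    by unfold_locales (use assms abc in auto)
  have cG: "continuous_on S (\<lambda>x. G x $ j $ k)" for j k
    using smG smooth_on_imp_continuous_on by blast
  obtain \<Lambda>1 where 1: "\<forall>l\<ge>\<Lambda>1. \<forall>x\<in>C. \<bar>scal_coord (M l) x - (scal_coord G x - (\<alpha> x)\<^sup>2)\<bar> < d"
    using scal_coord_uniform[OF C(1,2) d] by blast
  obtain \<Lambda>2 where 2: "\<forall>l\<ge>\<Lambda>2. \<forall>x\<in>C. \<forall>u. \<bar>u \<bullet> (oscillate a U V1 V2 l x *v u)\<bar> \<le> d * (u \<bullet> (R x *v u))"
    using oscillate_uniform[OF C(1,2) d R] by blast
  obtain \<Lambda>3 where 3: "\<forall>l\<ge>\<Lambda>3. \<forall>x\<in>C. \<forall>u. \<bar>u \<bullet> (oscillate a U V1 V2 l x *v u)\<bar> \<le> 1/2 * (u \<bullet> (G x *v u))"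
    using oscillate_uniform[OF C(1,2) _ cG spdG, of "1/2"] by auto
  define l where "l = max \<Lambda>1 (max \<Lambda>2 \<Lambda>3)"
  let ?H = "oscillate a U V1 V2 l"
  have SC: "open (S - C)" using S C(1) compact_imp_closed by blast
  have out: "?H x = 0" if "x \<in> S - C" for x
    using oscillate_zero[OF SC _ C(3) that] by auto
  have nonneg: "u \<bullet> (R x *v u) \<ge> 0" "u \<bullet> (G x *v u) \<ge> 0" if "x \<in> S" for x u
    using R(2)[OF that] spdG[OF that] by (cases "u = 0"; auto simp: spd_def less_imp_le)+
  show thesis
  proof (rule that)
    show "smooth_on (\<lambda>x. ?H x $ j $ k) S" for j k
      by (rule smooth_on_oscillate[OF S smooth_U smooth_V1 smooth_V2])
    show "?H x $ j $ k = ?H x $ k $ j" if "x \<in> S" for x j k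
      using symU[OF that, of j k] symV1[OF that, of j k] symV2[OF that, of j k] by (simp add: oscillate_def)
    show "?H x = 0" if "open W" "W \<subseteq> S" "\<And>y. y \<in> W \<Longrightarrow> \<alpha> y = 0" "x \<in> W" for W x
      using oscillate_zero[OF that] .
    show "\<bar>u \<bullet> (?H x *v u)\<bar> \<le> d * (u \<bullet> (R x *v u))" if "x \<in> S" for x u
      using 2 out[of x] nonneg(1)[OF that] d that by (cases "x \<in> C") (auto simp: l_def)
    show "\<bar>u \<bullet> (?H x *v u)\<bar> \<le> 1/2 * (u \<bullet> (G x *v u))" if "x \<in> S" for x u
      using 3[rule_format, of l x u] out[of x] nonneg(2)[OF that] that by (cases "x \<in> C") (auto simp: l_def)
    show "\<bar>scal_coord (\<lambda>x. G x + ?H x) x - (scal_coord G x - (\<alpha> x)\<^sup>2)\<bar> < d" if "x \<in> S" for x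
    proof (cases "x \<in> C")
      case True
      then show ?thesis using 1 by (simp add: l_def M_def[abs_def])
    next
      case False
      have "scal_coord (\<lambda>x. G x + ?H x) x = scal_coord G x"
        by (rule scal_coord_cong[OF SC]) (use that False out in auto)
      then show ?thesis using that False C(3) d by simp
    qed
  qed
qed

section \<open>Invariance under coordinate changes\<close>

lemma smooth_on_christoffel:
  assumes "open S" "\<And>j k. smooth_on (\<lambda>x. G x $ j $ k) S" "\<And>x. x \<in> S \<Longrightarrow> det (G x) \<noteq> 0"
  shows "smooth_on (christoffel G k i j) S"
  unfolding christoffel_def[abs_def]
  by (intro smooth_intros smooth_on_matrix_inv smooth_on_partial assms) auto

lemma invertible_transpose: "invertible A \<Longrightarrow> invertible (transpose A)" for A :: "real^'n::finite^'n"
  by (simp add: invertible_det_nz det_transpose)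

lemma sum_rotate: "(\<Sum>a\<in>A. \<Sum>b\<in>B. \<Sum>c\<in>C. f a b c) = (\<Sum>c\<in>C. \<Sum>a\<in>A. \<Sum>b\<in>B. f a b c)"
proof -
  have "(\<Sum>a\<in>A. \<Sum>b\<in>B. \<Sum>c\<in>C. f a b c) = (\<Sum>a\<in>A. \<Sum>c\<in>C. \<Sum>b\<in>B. f a b c)"
    by (rule sum.cong[OF refl], rule sum.swap)
  also have "\<dots> = (\<Sum>c\<in>C. \<Sum>a\<in>A. \<Sum>b\<in>B. f a b c)" by (rule sum.swap)
  finally show ?thesis .
qed

text \<open>\<open>Gt\<close> is the pullback of \<open>G\<close> under \<open>T\<close>, written in
  components.\<close>

locale coordinate_change =
  fixes W W' :: "(real^'n::finite) set" and T :: "real^'n \<Rightarrow> real^'n" and G Gt :: "real^'n \<Rightarrow> real^'n^'n"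
  assumes W: "open W" "open W'" and T: "smooth_on T W'" "T ` W' \<subseteq> W"
    and smG: "\<And>j k. smooth_on (\<lambda>x. G x $ j $ k) W" and detG: "\<And>x. x \<in> W \<Longrightarrow> det (G x) \<noteq> 0"
    and symG: "\<And>x j k. x \<in> W \<Longrightarrow> G x $ j $ k = G x $ k $ j"
    and inv: "\<And>y. y \<in> W' \<Longrightarrow> invertible (\<chi> k a. partial a T y $ k)"
    and Gt: "\<And>y i j. y \<in> W' \<Longrightarrow> Gt y $ i $ j = (\<Sum>p\<in>UNIV. \<Sum>q\<in>UNIV. partial i T y $ p * partial j T y $ q * G (T y) $ p $ q)"
begin

definition "J a k y = partial a T y $ k"

definition "JJ b a k y = partial b (J a k) y"

lemma TW: "y \<in> W' \<Longrightarrow> T y \<in> W" using T by blast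

lemma smooth_J: "smooth_on (J a k) W'"
  unfolding J_def[abs_def] by (intro smooth_on_vec_nth smooth_on_partial T W)

lemma J_eq: "y \<in> W' \<Longrightarrow> J a k y = partial a (\<lambda>y. T y $ k) y"
  unfolding J_def using partial_component[OF smooth_onD[OF T(1)]] by simp

lemma JJ_sym: "y \<in> W' \<Longrightarrow> JJ b a k y = JJ a b k y"
proof -
  assume y: "y \<in> W'"
  have "JJ b a k y = partial b (partial a (\<lambda>y. T y $ k)) y" for a b
    unfolding JJ_def by (rule partial_cong[OF W(2) y J_eq])
  then show ?thesis
    using partial_commute[OF W(2) smooth_on_vec_nth[OF W(2) T(1)] y] by simp
qed

lemma smooth_compose_T: "smooth_on f W \<Longrightarrow> smooth_on (\<lambda>y. f (T y)) W'"
  by (rule smooth_on_compose[OF _ W(2) T])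

lemma partial_compose_T:
  fixes f :: "real^'n \<Rightarrow> real"
  shows "smooth_on f W \<Longrightarrow> y \<in> W' \<Longrightarrow> partial b (\<lambda>y. f (T y)) y = (\<Sum>r\<in>UNIV. J b r y * partial r f (T y))"
  unfolding J_def by (intro partial_compose smooth_onD[of f W] smooth_onD[OF T(1)] TW)

definition "Jm y = (\<chi> k a. J a k y)"

lemma Jm_inv: "y \<in> W' \<Longrightarrow> Jm y ** matrix_inv (Jm y) = mat 1" "y \<in> W' \<Longrightarrow> matrix_inv (Jm y) ** Jm y = mat 1"
  using inv matrix_inv_works unfolding Jm_def J_def by blast+

lemma Gt_matrix: "y \<in> W' \<Longrightarrow> Gt y = transpose (Jm y) ** G (T y) ** Jm y"
proof -
  assume y: "y \<in> W'"
  have "Gt y $ i $ j = (\<Sum>q\<in>UNIV. \<Sum>p\<in>UNIV. J i p y * G (T y) $ p $ q * J j q y)" for i j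
    unfolding Gt[OF y] J_def by (subst sum.swap) (simp add: mult_ac)
  then show ?thesis
    by (simp add: vec_eq_iff matrix_matrix_mult_def transpose_def Jm_def sum_distrib_right)
qed

lemma inverse_matrix: "y \<in> W' \<Longrightarrow> Jm y ** matrix_inv (Gt y) ** transpose (Jm y) = matrix_inv (G (T y))"
proof -
  assume y: "y \<in> W'"
  have iG: "invertible (G (T y))" using detG[OF TW[OF y]] by (simp add: invertible_det_nz)
  have iJ: "invertible (Jm y)" using Jm_inv[OF y] by (auto simp: invertible_def)
  have "matrix_inv (Gt y) = matrix_inv (Jm y) ** matrix_inv (G (T y)) ** matrix_inv (transpose (Jm y))"
  proof (rule matrix_inv_unique)
    have "Gt y ** (matrix_inv (Jm y) ** matrix_inv (G (T y)) ** matrix_inv (transpose (Jm y)))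
      = transpose (Jm y) ** (G (T y) ** (Jm y ** matrix_inv (Jm y)) ** matrix_inv (G (T y))) ** matrix_inv (transpose (Jm y))"
      unfolding Gt_matrix[OF y] by (simp only: matrix_mul_assoc)
    then show "Gt y ** (matrix_inv (Jm y) ** matrix_inv (G (T y)) ** matrix_inv (transpose (Jm y))) = mat 1"
      using matrix_inv_works[OF iG] matrix_inv_works[OF iJ] matrix_inv_works[of "transpose (Jm y)"] iJ by (simp add: invertible_transpose)
  qed
  then have "Jm y ** matrix_inv (Gt y) ** transpose (Jm y) = (Jm y ** matrix_inv (Jm y)) ** matrix_inv (G (T y)) ** (matrix_inv (transpose (Jm y)) ** transpose (Jm y))"
    by (simp only: matrix_mul_assoc)
  then show ?thesis
    using matrix_inv_works[OF iJ] matrix_inv_works[of "transpose (Jm y)"] iJ by (simp add: invertible_transpose)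
qed

lemma det_Gt: "y \<in> W' \<Longrightarrow> det (Gt y) \<noteq> 0"
  using Jm_inv invertible_det_nz[of "Jm y"] detG[OF TW]
  by (auto simp: Gt_matrix det_mul det_transpose invertible_def)

lemma inverse_sum:
  assumes y: "y \<in> W'"
  shows "(\<Sum>a\<in>UNIV. \<Sum>l\<in>UNIV. J a k y * matrix_inv (Gt y) $ a $ l * J l q y) = matrix_inv (G (T y)) $ k $ q"
proof -
  have "matrix_inv (G (T y)) $ k $ q = (Jm y ** matrix_inv (Gt y) ** transpose (Jm y)) $ k $ q"
    by (simp add: inverse_matrix[OF y])
  also have "\<dots> = (\<Sum>l\<in>UNIV. \<Sum>a\<in>UNIV. J a k y * matrix_inv (Gt y) $ a $ l * J l q y)"
    by (simp add: matrix_matrix_mult_def transpose_def Jm_def sum_distrib_right)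
  also have "\<dots> = (\<Sum>a\<in>UNIV. \<Sum>l\<in>UNIV. J a k y * matrix_inv (Gt y) $ a $ l * J l q y)"
    by (rule sum.swap)
  finally show ?thesis by simp
qed

lemma smooth_Gt: "smooth_on (\<lambda>y. Gt y $ i $ j) W'"
proof -
  have "smooth_on (\<lambda>y. \<Sum>p\<in>UNIV. \<Sum>q\<in>UNIV. J i p y * J j q y * G (T y) $ p $ q) W'"
    by (intro smooth_intros W smooth_J smooth_compose_T[OF smG])
  then show ?thesis
    by (rule smooth_on_cong[OF W(2), rotated]) (simp add: Gt J_def)
qed

lemma jet1_Gt:
  assumes y: "y \<in> W'"
  shows "jet1 Gt y b c l = (\<Sum>p\<in>UNIV. \<Sum>q\<in>UNIV. JJ b c p y * J l q y * G (T y) $ p $ q)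
     + (\<Sum>p\<in>UNIV. \<Sum>q\<in>UNIV. JJ b l p y * J c q y * G (T y) $ p $ q)
     + (\<Sum>p\<in>UNIV. \<Sum>q\<in>UNIV. \<Sum>r\<in>UNIV. J c p y * J l q y * J b r y * jet1 G (T y) r p q)"
proof -
  note d = smooth_onD[OF smooth_J y] smooth_onD[OF smooth_compose_T[OF smG] y]
  have "jet1 Gt y b c l = partial b (\<lambda>y. \<Sum>p\<in>UNIV. \<Sum>q\<in>UNIV. (J c p y * J l q y) * G (T y) $ p $ q) y"
    unfolding jet1_def by (rule partial_cong[OF W(2) y]) (simp add: Gt J_def)
  also have "\<dots> = (\<Sum>p\<in>UNIV. \<Sum>q\<in>UNIV. partial b (\<lambda>y. (J c p y * J l q y) * G (T y) $ p $ q) y)"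
    by (subst partial_sum, intro differentiable_sum differentiable_mult d finite ballI, 
        intro sum.cong refl partial_sum differentiable_mult d)
  also have "\<dots> = (\<Sum>p\<in>UNIV. \<Sum>q\<in>UNIV. JJ b c p y * J l q y * G (T y) $ p $ q + J c p y * JJ b l q y * G (T y) $ p $ q
     + (\<Sum>r\<in>UNIV. J c p y * J l q y * J b r y * jet1 G (T y) r p q))"
    by (intro sum.cong refl)
       (simp add: partial_mult d differentiable_mult partial_compose_T[OF smG y] sum_distrib_left JJ_def jet1_def algebra_simps)
  also have "\<dots> = (\<Sum>p\<in>UNIV. \<Sum>q\<in>UNIV. JJ b c p y * J l q y * G (T y) $ p $ q)
     + (\<Sum>p\<in>UNIV. \<Sum>q\<in>UNIV. J c p y * JJ b l q y * G (T y) $ p $ q)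
     + (\<Sum>p\<in>UNIV. \<Sum>q\<in>UNIV. \<Sum>r\<in>UNIV. J c p y * J l q y * J b r y * jet1 G (T y) r p q)"
    by (simp add: sum.distrib)
  also have "(\<Sum>p\<in>UNIV. \<Sum>q\<in>UNIV. J c p y * JJ b l q y * G (T y) $ p $ q) = (\<Sum>p\<in>UNIV. \<Sum>q\<in>UNIV. JJ b l p y * J c q y * G (T y) $ p $ q)"
  proof (subst sum.swap, intro sum.cong refl)
    fix p q
    show "J c q y * JJ b l p y * G (T y) $ q $ p = JJ b l p y * J c q y * G (T y) $ p $ q"
      using symG[OF TW[OF y], of q p] by simp
  qed
  finally show ?thesis .
qed

text \<open>Each derivative of \<open>Gt\<close> has two terms with second derivatives of
  \<open>T\<close>. By symmetry of \<open>JJ\<close>, four of the six cancel in the combination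
  \<open>chr\<close> and the other two agree, which leaves one inhomogeneous term.\<close>

lemma chr_Gt:
  assumes y: "y \<in> W'"
  shows "chr (jet1 Gt y) l b c = (\<Sum>q\<in>UNIV. J l q y * ((\<Sum>p\<in>UNIV. G (T y) $ q $ p * JJ b c p y)
     + (\<Sum>i\<in>UNIV. \<Sum>j\<in>UNIV. J b i y * J c j y * chr (jet1 G (T y)) q i j)))"
proof -
  let ?D = "jet1 G (T y)"
  define A where "A b c l = (\<Sum>p\<in>UNIV. \<Sum>q\<in>UNIV. JJ b c p y * J l q y * G (T y) $ p $ q)" for b c l
  define B where "B F = (\<Sum>q\<in>UNIV. \<Sum>i\<in>UNIV. \<Sum>j\<in>UNIV. J l q y * (J b i y * J c j y * F q i j))" for F :: "'n \<Rightarrow> 'n \<Rightarrow> 'n \<Rightarrow> real"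
  have A_sym: "A b c l = A c b l" for b c l unfolding A_def by (simp add: JJ_sym[OF y])
  have D1: "(\<Sum>p\<in>UNIV. \<Sum>q\<in>UNIV. \<Sum>r\<in>UNIV. J c p y * J l q y * J b r y * ?D r p q) = B (\<lambda>q i j. ?D i j q)"
  proof -
    have "(\<Sum>p\<in>UNIV. \<Sum>q\<in>UNIV. \<Sum>r\<in>UNIV. J c p y * J l q y * J b r y * ?D r p q) = (\<Sum>q\<in>UNIV. \<Sum>r\<in>UNIV. \<Sum>p\<in>UNIV. J c p y * J l q y * J b r y * ?D r p q)"
      by (rule sum_rotate[symmetric])
    then show ?thesis unfolding B_def by (simp add: mult_ac)
  qed
  have D2: "(\<Sum>p\<in>UNIV. \<Sum>q\<in>UNIV. \<Sum>r\<in>UNIV. J b p y * J l q y * J c r y * ?D r p q) = B (\<lambda>q i j. ?D j i q)"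
    unfolding B_def by (subst sum.swap) (simp add: mult_ac)
  have D3: "(\<Sum>p\<in>UNIV. \<Sum>q\<in>UNIV. \<Sum>r\<in>UNIV. J b p y * J c q y * J l r y * ?D r p q) = B (\<lambda>q i j. ?D q i j)"
  proof -
    have "(\<Sum>p\<in>UNIV. \<Sum>q\<in>UNIV. \<Sum>r\<in>UNIV. J b p y * J c q y * J l r y * ?D r p q) = (\<Sum>r\<in>UNIV. \<Sum>p\<in>UNIV. \<Sum>q\<in>UNIV. J b p y * J c q y * J l r y * ?D r p q)"
      by (rule sum_rotate)
    then show ?thesis unfolding B_def by (simp add: mult_ac)
  qed
  have "chr (jet1 Gt y) l b c = A b c l + (B (\<lambda>q i j. ?D i j q) + B (\<lambda>q i j. ?D j i q) - B (\<lambda>q i j. ?D q i j)) / 2"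
    unfolding chr_def jet1_Gt[OF y] D1 D2 D3 A_def[symmetric]
    using A_sym[of b c l] A_sym[of b l c] A_sym[of c l b] by simp
  also have "(B (\<lambda>q i j. ?D i j q) + B (\<lambda>q i j. ?D j i q) - B (\<lambda>q i j. ?D q i j)) / 2 = B (\<lambda>q i j. chr ?D q i j)"
    unfolding B_def by (simp add: chr_def sum.distrib[symmetric] sum_subtractf[symmetric] sum_divide_distrib field_simps)
  also have "A b c l = (\<Sum>q\<in>UNIV. J l q y * (\<Sum>p\<in>UNIV. G (T y) $ q $ p * JJ b c p y))"
    unfolding A_def by (subst sum.swap) (simp add: sum_distrib_left mult_ac symG[OF TW[OF y]])
  finally show ?thesis
    by (simp add: B_def sum.distrib distrib_left sum_distrib_left)
qed

text \<open>In matrix form this says \<open>J \<Gamma>\<^sub>c = A\<^sub>c J + \<partial>\<^sub>c J\<close>, a gauge transformation; the curvature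
  then transforms tensorially by gauge covariance.\<close>

lemma christoffel_Gt:
  assumes y: "y \<in> W'"
  shows "(\<Sum>a\<in>UNIV. J a k y * christoffel Gt a b c y)
    = (\<Sum>m\<in>UNIV. (\<Sum>i\<in>UNIV. J b i y * christoffel G k i m (T y)) * J c m y) + JJ b c k y"
proof -
  let ?I = "matrix_inv (G (T y))"
  define Y where "Y q = (\<Sum>p\<in>UNIV. G (T y) $ q $ p * JJ b c p y)
     + (\<Sum>i\<in>UNIV. \<Sum>j\<in>UNIV. J b i y * J c j y * chr (jet1 G (T y)) q i j)" for q
  have "(\<Sum>a\<in>UNIV. J a k y * christoffel Gt a b c y) = (\<Sum>a\<in>UNIV. \<Sum>l\<in>UNIV. \<Sum>q\<in>UNIV. J a k y * matrix_inv (Gt y) $ a $ l * J l q y * Y q)"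
    unfolding christoffel_jet chr2_def chr_Gt[OF y] Y_def[symmetric] jet0_def by (simp add: sum_distrib_left mult.assoc)
  also have "\<dots> = (\<Sum>q\<in>UNIV. \<Sum>a\<in>UNIV. \<Sum>l\<in>UNIV. J a k y * matrix_inv (Gt y) $ a $ l * J l q y * Y q)"
    by (rule sum_rotate)
  also have "\<dots> = (\<Sum>q\<in>UNIV. ?I $ k $ q * Y q)"
    by (simp only: sum_distrib_right[symmetric] inverse_sum[OF y])
  also have "\<dots> = (\<Sum>q\<in>UNIV. \<Sum>p\<in>UNIV. ?I $ k $ q * G (T y) $ q $ p * JJ b c p y)
      + (\<Sum>q\<in>UNIV. \<Sum>i\<in>UNIV. \<Sum>j\<in>UNIV. ?I $ k $ q * (J b i y * J c j y * chr (jet1 G (T y)) q i j))"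
    by (simp add: Y_def distrib_left sum.distrib sum_distrib_left mult.assoc)
  also have "(\<Sum>q\<in>UNIV. \<Sum>p\<in>UNIV. ?I $ k $ q * G (T y) $ q $ p * JJ b c p y) = (\<Sum>p\<in>UNIV. (?I ** G (T y)) $ k $ p * JJ b c p y)"
    by (subst sum.swap) (simp add: matrix_matrix_mult_def sum_distrib_right)
  also have "\<dots> = (\<Sum>p\<in>UNIV. (if p = k then 1 else 0) * JJ b c p y)"
    using detG[OF TW[OF y]] by (intro sum.cong refl) (auto simp: matrix_inv_works invertible_det_nz mat_def)
  also have "\<dots> = JJ b c k y" by (rule sum_indicator_left)
  also have "(\<Sum>q\<in>UNIV. \<Sum>i\<in>UNIV. \<Sum>j\<in>UNIV. ?I $ k $ q * (J b i y * J c j y * chr (jet1 G (T y)) q i j))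
    = (\<Sum>j\<in>UNIV. \<Sum>i\<in>UNIV. \<Sum>q\<in>UNIV. ?I $ k $ q * (J b i y * J c j y * chr (jet1 G (T y)) q i j))"
    by (subst sum_rotate) (rule sum.cong[OF refl], rule sum.swap)
  also have "\<dots> = (\<Sum>m\<in>UNIV. (\<Sum>i\<in>UNIV. J b i y * christoffel G k i m (T y)) * J c m y)"
    unfolding christoffel_jet chr2_def jet0_def by (simp add: sum_distrib_left sum_distrib_right mult_ac)
  finally show ?thesis by simp
qed

section \<open>Gauge covariance of the curvature\<close>

definition "\<Gamma>m c y = (\<chi> a d. christoffel Gt a c d y)"
definition "Am c y = (\<chi> k m. \<Sum>i\<in>UNIV. J c i y * christoffel G k i m (T y))"
definition "dJ c y = (\<chi> k d. JJ c d k y)"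
definition "d\<Gamma> b c y = (\<chi> a d. partial b (christoffel Gt a c d) y)"
definition "dA b c y = (\<chi> k m. partial b (\<lambda>y. \<Sum>i\<in>UNIV. J c i y * christoffel G k i m (T y)) y)"
definition "ddJ b c y = (\<chi> k d. partial b (partial c (J d k)) y)"

lemma gauge: "y \<in> W' \<Longrightarrow> Jm y ** \<Gamma>m c y = Am c y ** Jm y + dJ c y"
  by (simp add: vec_eq_iff matrix_matrix_mult_def Jm_def \<Gamma>m_def Am_def dJ_def christoffel_Gt)

lemma smooth_christoffel_Gt: "smooth_on (christoffel Gt a c d) W'"
  by (rule smooth_on_christoffel[OF W(2) smooth_Gt det_Gt])

lemma smooth_christoffel_T: "smooth_on (\<lambda>y. christoffel G k i m (T y)) W'"
  by (rule smooth_compose_T[OF smooth_on_christoffel[OF W(1) smG detG]])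

lemma ddJ_sym: "y \<in> W' \<Longrightarrow> ddJ b c y = ddJ c b y"
  unfolding ddJ_def using partial_commute[OF W(2) smooth_J] by simp

lemma gauge_derivative:
  assumes y: "y \<in> W'"
  shows "dJ b y ** \<Gamma>m c y + Jm y ** d\<Gamma> b c y = dA b c y ** Jm y + Am c y ** dJ b y + ddJ b c y"
proof -
  let ?A = "\<lambda>k m y. \<Sum>i\<in>UNIV. J c i y * christoffel G k i m (T y)"
  have smA: "smooth_on (?A k m) W'" for k m
    by (intro smooth_intros W smooth_J smooth_christoffel_T)
  note d = smooth_onD[OF smooth_J y] smooth_onD[OF smooth_christoffel_Gt y] smooth_onD[OF smA y]
    smooth_onD[OF smooth_on_partial[OF smooth_J] y]
  have "(\<Sum>a\<in>UNIV. partial b (J a k) y * christoffel Gt a c d y + J a k y * partial b (christoffel Gt a c d) y)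
    = (\<Sum>m\<in>UNIV. partial b (?A k m) y * J d m y + ?A k m y * partial b (J d m) y) + partial b (partial c (J d k)) y" for k d
  proof -
    have "(\<Sum>a\<in>UNIV. partial b (J a k) y * christoffel Gt a c d y + J a k y * partial b (christoffel Gt a c d) y)
       = partial b (\<lambda>y. \<Sum>a\<in>UNIV. J a k y * christoffel Gt a c d y) y"
      by (subst partial_sum, intro differentiable_mult d, simp add: partial_mult d add.commute)
    also have "\<dots> = partial b (\<lambda>y. (\<Sum>m\<in>UNIV. ?A k m y * J d m y) + partial c (J d k) y) y"
      by (rule partial_cong[OF W(2) y]) (simp add: christoffel_Gt JJ_def)
    also have "\<dots> = partial b (\<lambda>y. \<Sum>m\<in>UNIV. ?A k m y * J d m y) y + partial b (partial c (J d k)) y"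
      by (rule partial_add) (intro differentiable_sum differentiable_mult d finite ballI, rule d)
    also have "partial b (\<lambda>y. \<Sum>m\<in>UNIV. ?A k m y * J d m y) y = (\<Sum>m\<in>UNIV. partial b (\<lambda>y. ?A k m y * J d m y) y)"
      by (rule partial_sum) (intro differentiable_mult d)
    also have "\<dots> = (\<Sum>m\<in>UNIV. partial b (?A k m) y * J d m y + ?A k m y * partial b (J d m) y)"
      by (simp only: partial_mult[OF d(3) d(1)] add.commute)
    finally show ?thesis .
  qed
  then show ?thesis
    by (simp add: vec_eq_iff matrix_matrix_mult_def Jm_def \<Gamma>m_def Am_def dJ_def d\<Gamma>_def dA_def ddJ_def JJ_def sum.distrib)
qed

text \<open>The curvature of the connection matrices \<open>\<Gamma>m\<close> of \<open>Gt\<close>;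
  \<open>F\<close> is that of \<open>Am\<close>, the connection of \<open>G\<close> pulled back by
  \<open>T\<close> before the change of frame by \<open>Jm\<close>.\<close>

definition "Rt b c y = d\<Gamma> b c y - d\<Gamma> c b y + \<Gamma>m b y ** \<Gamma>m c y - \<Gamma>m c y ** \<Gamma>m b y"
definition "F b c y = dA b c y - dA c b y + Am b y ** Am c y - Am c y ** Am b y"

lemma riemann_Gt: "riemann Gt a b c d y = Rt b c y $ a $ d"
  by (simp add: riemann_def Rt_def d\<Gamma>_def \<Gamma>m_def matrix_matrix_mult_def sum_subtractf)

text \<open>Insert \<open>gauge\<close> and its derivative. The second derivatives
  \<open>ddJ\<close> are symmetric in the two directions and cancel, and so do all products that
  contain \<open>\<Gamma>m\<close>.\<close>

lemma gauge_curvature: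
  assumes y: "y \<in> W'"
  shows "Jm y ** Rt b c y = F b c y ** Jm y"
proof -
  let ?J = "Jm y" and ?\<Gamma> = "\<lambda>c. \<Gamma>m c y" and ?A = "\<lambda>c. Am c y"
  have dJ: "dJ c y = ?J ** ?\<Gamma> c - ?A c ** ?J" for c using gauge[OF y] by simp
  have JdG: "?J ** d\<Gamma> b c y = dA b c y ** ?J + ?A c ** dJ b y + ddJ b c y - dJ b y ** ?\<Gamma> c" for b c
    using gauge_derivative[OF y, of b c] by (simp add: algebra_simps)
  have "?J ** Rt b c y = ?J ** d\<Gamma> b c y - ?J ** d\<Gamma> c b y + ?J ** ?\<Gamma> b ** ?\<Gamma> c - ?J ** ?\<Gamma> c ** ?\<Gamma> b"
    by (simp add: Rt_def matrix_add_ldistrib matrix_diff_ldistrib matrix_mul_assoc)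
  also have "\<dots> = F b c y ** ?J"
    unfolding JdG dJ F_def ddJ_sym[OF y, of c b]
    by (simp add: matrix_add_ldistrib matrix_diff_ldistrib matrix_add_rdistrib matrix_diff_rdistrib matrix_mul_assoc)
  finally show ?thesis .
qed

text \<open>A pulled back connection has the pulled back curvature: the derivatives of the Jacobian
  contributed by \<open>dA\<close> are symmetric in the two directions and cancel.\<close>

lemma F_eq:
  assumes y: "y \<in> W'"
  shows "F b c y $ k $ m = (\<Sum>i\<in>UNIV. \<Sum>j\<in>UNIV. J b i y * J c j y * riemann G k i j m (T y))"
proof -
  let ?P = "\<lambda>i k j m. partial i (christoffel G k j m) (T y)" and ?C = "\<lambda>k i m. christoffel G k i m (T y)"
  note d = smooth_onD[OF smooth_J y] smooth_onD[OF smooth_christoffel_T y]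
  have dA: "dA b c y $ k $ m = (\<Sum>j\<in>UNIV. JJ b c j y * ?C k j m) + (\<Sum>i\<in>UNIV. \<Sum>j\<in>UNIV. J b i y * J c j y * ?P i k j m)" for b c
  proof -
    have "dA b c y $ k $ m = (\<Sum>j\<in>UNIV. JJ b c j y * ?C k j m + (\<Sum>i\<in>UNIV. J b i y * J c j y * ?P i k j m))"
      unfolding dA_def vec_lambda_beta
      by (subst partial_sum, intro differentiable_mult d)
         (simp add: partial_mult d partial_compose_T[OF smooth_on_christoffel[OF W(1) smG detG] y] JJ_def sum_distrib_left mult_ac add.commute)
    then show ?thesis by (simp add: sum.distrib) (rule sum.swap)
  qed
  have AA: "(Am b y ** Am c y) $ k $ m = (\<Sum>i\<in>UNIV. \<Sum>j\<in>UNIV. J b i y * J c j y * (\<Sum>p\<in>UNIV. ?C k i p * ?C p j m))" for b c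
  proof -
    have "(Am b y ** Am c y) $ k $ m = (\<Sum>p\<in>UNIV. \<Sum>i\<in>UNIV. \<Sum>j\<in>UNIV. J b i y * J c j y * (?C k i p * ?C p j m))"
      by (simp add: matrix_matrix_mult_def Am_def sum_product mult_ac)
    also have "\<dots> = (\<Sum>i\<in>UNIV. \<Sum>j\<in>UNIV. \<Sum>p\<in>UNIV. J b i y * J c j y * (?C k i p * ?C p j m))"
      by (rule sum_rotate[symmetric])
    finally show ?thesis by (simp add: sum_distrib_left)
  qed
  have sw: "(\<Sum>i\<in>UNIV. \<Sum>j\<in>UNIV. J c i y * J b j y * f i j) = (\<Sum>i\<in>UNIV. \<Sum>j\<in>UNIV. J b i y * J c j y * f j i)" for f :: "'n \<Rightarrow> 'n \<Rightarrow> real"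
    by (subst sum.swap) (simp add: mult_ac)
  have "F b c y $ k $ m = (\<Sum>i\<in>UNIV. \<Sum>j\<in>UNIV. J b i y * J c j y * ?P i k j m) - (\<Sum>i\<in>UNIV. \<Sum>j\<in>UNIV. J b i y * J c j y * ?P j k i m)
     + (\<Sum>i\<in>UNIV. \<Sum>j\<in>UNIV. J b i y * J c j y * (\<Sum>p\<in>UNIV. ?C k i p * ?C p j m)) - (\<Sum>i\<in>UNIV. \<Sum>j\<in>UNIV. J b i y * J c j y * (\<Sum>p\<in>UNIV. ?C k j p * ?C p i m))"
    unfolding F_def vector_add_component vector_minus_component dA AA sw[of _] JJ_sym[OF y, of c b] by simp
  then show ?thesis
    by (simp add: riemann_def sum.distrib sum_subtractf right_diff_distrib distrib_left)
qed

text \<open>In the trace \<open>Jm\<close> meets its inverse, so only the two free indices keep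
  Jacobian factors.\<close>

lemma ricci_Gt:
  assumes y: "y \<in> W'"
  shows "ricci Gt c d y = (\<Sum>j\<in>UNIV. \<Sum>m\<in>UNIV. J c j y * J d m y * ricci G j m (T y))"
proof -
  let ?K = "matrix_inv (Jm y)"
  have Rt: "Rt b c y = ?K ** (F b c y ** Jm y)" for b
    using Jm_inv[OF y] by (simp add: gauge_curvature[OF y, symmetric] matrix_mul_assoc)
  have KJ: "(\<Sum>b\<in>UNIV. J b i y * ?K $ b $ k) = (if i = k then 1 else 0)" for i k
  proof -
    have "(Jm y ** ?K) $ i $ k = mat 1 $ i $ k" using Jm_inv[OF y] by simp
    then show ?thesis by (simp add: matrix_matrix_mult_def Jm_def mat_def)
  qed
  have "ricci Gt c d y = (\<Sum>b\<in>UNIV. \<Sum>k\<in>UNIV. ?K $ b $ k * (\<Sum>m\<in>UNIV. F b c y $ k $ m * J d m y))"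
    by (simp add: ricci_def riemann_Gt Rt matrix_matrix_mult_def Jm_def)
  also have "\<dots> = (\<Sum>b\<in>UNIV. \<Sum>k\<in>UNIV. \<Sum>m\<in>UNIV. \<Sum>i\<in>UNIV. \<Sum>j\<in>UNIV. (J b i y * ?K $ b $ k) * (J c j y * J d m y * riemann G k i j m (T y)))"
    unfolding F_eq[OF y] by (simp add: sum_distrib_left sum_distrib_right mult_ac)
  also have "\<dots> = (\<Sum>(b,k,m,i,j)\<in>UNIV. (J b i y * ?K $ b $ k) * (J c j y * J d m y * riemann G k i j m (T y)))"
    by (simp add: sum.cartesian_product UNIV_Times_UNIV split_beta)
  also have "\<dots> = (\<Sum>(j,m,i,k,b)\<in>UNIV. (J b i y * ?K $ b $ k) * (J c j y * J d m y * riemann G k i j m (T y)))"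
    by (rule sum.reindex_bij_witness[of _ "\<lambda>(j,m,i,k,b). (b,k,m,i,j)" "\<lambda>(b,k,m,i,j). (j,m,i,k,b)"]) auto
  also have "\<dots> = (\<Sum>j\<in>UNIV. \<Sum>m\<in>UNIV. \<Sum>i\<in>UNIV. \<Sum>k\<in>UNIV. \<Sum>b\<in>UNIV. (J b i y * ?K $ b $ k) * (J c j y * J d m y * riemann G k i j m (T y)))"
    by (simp add: sum.cartesian_product UNIV_Times_UNIV split_beta)
  also have "\<dots> = (\<Sum>j\<in>UNIV. \<Sum>m\<in>UNIV. \<Sum>i\<in>UNIV. J c j y * J d m y * riemann G i i j m (T y))"
  proof (intro sum.cong refl)
    fix j m i
    have "(\<Sum>k\<in>UNIV. \<Sum>b\<in>UNIV. (J b i y * ?K $ b $ k) * (J c j y * J d m y * riemann G k i j m (T y)))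
      = (\<Sum>k\<in>UNIV. (if k = i then 1 else 0) * (J c j y * J d m y * riemann G k i j m (T y)))"
      by (simp only: sum_distrib_right[symmetric] KJ eq_commute)
    then show "(\<Sum>k\<in>UNIV. \<Sum>b\<in>UNIV. (J b i y * ?K $ b $ k) * (J c j y * J d m y * riemann G k i j m (T y))) = J c j y * J d m y * riemann G i i j m (T y)"
      by (simp only: sum_indicator_left)
  qed
  finally show ?thesis by (simp add: ricci_def sum_distrib_left)
qed

theorem scal_coord_Gt:
  assumes y: "y \<in> W'"
  shows "scal_coord Gt y = scal_coord G (T y)"
proof -
  let ?I = "matrix_inv (Gt y)"
  have "scal_coord Gt y = (\<Sum>c\<in>UNIV. \<Sum>d\<in>UNIV. \<Sum>j\<in>UNIV. \<Sum>m\<in>UNIV. (J c j y * ?I $ c $ d * J d m y) * ricci G j m (T y))"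
    unfolding scal_coord_def ricci_Gt[OF y] by (simp add: sum_distrib_left mult_ac)
  also have "\<dots> = (\<Sum>(c,d,j,m)\<in>UNIV. (J c j y * ?I $ c $ d * J d m y) * ricci G j m (T y))"
    by (simp add: sum.cartesian_product UNIV_Times_UNIV split_beta)
  also have "\<dots> = (\<Sum>(j,m,c,d)\<in>UNIV. (J c j y * ?I $ c $ d * J d m y) * ricci G j m (T y))"
    by (rule sum.reindex_bij_witness[of _ "\<lambda>(j,m,c,d). (c,d,j,m)" "\<lambda>(c,d,j,m). (j,m,c,d)"]) auto
  also have "\<dots> = (\<Sum>j\<in>UNIV. \<Sum>m\<in>UNIV. \<Sum>c\<in>UNIV. \<Sum>d\<in>UNIV. (J c j y * ?I $ c $ d * J d m y) * ricci G j m (T y))"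
    by (simp add: sum.cartesian_product UNIV_Times_UNIV split_beta)
  also have "\<dots> = (\<Sum>j\<in>UNIV. \<Sum>m\<in>UNIV. matrix_inv (G (T y)) $ j $ m * ricci G j m (T y))"
    by (simp only: sum_distrib_right[symmetric] inverse_sum[OF y])
  finally show ?thesis by (simp add: scal_coord_def)
qed

end

section \<open>Metrics on manifolds\<close>

lemma frechet_partial:
  fixes T :: "real^'n::finite \<Rightarrow> real^'m::finite"
  assumes "T differentiable (at x)"
  shows "frechet_derivative T (at x) v = (\<chi> k i. partial i T x $ k) *v v"
proof -
  have lin: "linear (frechet_derivative T (at x))" using assms by (rule linear_frechet_derivative)
  have v: "(\<Sum>i\<in>UNIV. v $ i *\<^sub>R axis i 1) = v"
    by (simp add: vec_eq_iff sum_component axis_def if_distrib sum.delta' cong: if_cong)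
  have "frechet_derivative T (at x) v = (\<Sum>i\<in>UNIV. v $ i *\<^sub>R partial i T x)"
    using linear_sum[OF lin, of "\<lambda>i. v $ i *\<^sub>R axis i 1" UNIV] linear_scale[OF lin]
    by (simp add: v partial_def)
  then show ?thesis
    by (simp add: vec_eq_iff matrix_vector_mult_def sum_component mult.commute)
qed

locale manifold =
  fixes X :: "'a topology" and A :: "('a, 'n::finite) chart set"
  assumes mfd: "smooth_manifold X A"
begin

lemma chart:
  assumes "c \<in> A"
  shows "openin X (fst c)" "open (chart_image c)" "fst c \<subseteq> topspace X"
    "homeomorphic_map (subtopology X (fst c)) (top_of_set (chart_image c)) (snd c)"
    "inj_on (snd c) (fst c)"
proof -
  have *: "is_chart X c" using assms mfd by (simp add: smooth_manifold_def)
  then show 1: "openin X (fst c)" "open (chart_image c)" 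
    and 2: "homeomorphic_map (subtopology X (fst c)) (top_of_set (chart_image c)) (snd c)"
    by (auto simp: is_chart_def)
  show 3: "fst c \<subseteq> topspace X" using 1 openin_subset by blast
  then show "inj_on (snd c) (fst c)"
    using homeomorphic_imp_injective_map[OF 2] by (simp add: Int_absorb1)
qed

lemma chart_inv_left: "c \<in> A \<Longrightarrow> p \<in> fst c \<Longrightarrow> chart_inv c (snd c p) = p"
  by (simp add: chart_inv_def chart)

lemma chart_image_I: "p \<in> fst c \<Longrightarrow> snd c p \<in> chart_image c"
  by (simp add: chart_image_def)

lemma chart_inv_right: "x \<in> chart_image c \<Longrightarrow> snd c (chart_inv c x) = x" "x \<in> chart_image c \<Longrightarrow> chart_inv c x \<in> fst c"
  unfolding chart_inv_def chart_image_def by (auto simp: f_inv_into_f inv_into_into)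

lemma open_chart_image:
  assumes "c \<in> A" "openin X Y"
  shows "open (snd c ` (fst c \<inter> Y))"
proof -
  have "openin (subtopology X (fst c)) (fst c \<inter> Y)"
    using assms(2) by (auto simp: openin_subtopology)
  then have "openin (top_of_set (chart_image c)) (snd c ` (fst c \<inter> Y))"
    using chart(4)[OF assms(1)] homeomorphic_imp_open_map open_map_def by blast
  then show ?thesis using chart(2)[OF assms(1)] openin_open_eq by blast
qed

lemma chart_inv_image: "c \<in> A \<Longrightarrow> V \<subseteq> chart_image c \<Longrightarrow> chart_inv c ` V = {p \<in> fst c. snd c p \<in> V}"
proof
  assume c: "c \<in> A" and V: "V \<subseteq> chart_image c"
  show "chart_inv c ` V \<subseteq> {p \<in> fst c. snd c p \<in> V}"
  proof -
    have "chart_inv c t \<in> fst c \<and> snd c (chart_inv c t) \<in> V" if "t \<in> V" for t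
      using chart_inv_right[of t c] V that by auto
    then show ?thesis by blast
  qed
  show "{p \<in> fst c. snd c p \<in> V} \<subseteq> chart_inv c ` V"
  proof
    fix p assume "p \<in> {p \<in> fst c. snd c p \<in> V}"
    then have "chart_inv c (snd c p) = p" "snd c p \<in> V" using chart_inv_left[OF c] by auto
    then show "p \<in> chart_inv c ` V" by (metis imageI)
  qed
qed

lemma openin_chart_inv:
  assumes c: "c \<in> A" and V: "open V" "V \<subseteq> chart_image c"
  shows "openin X (chart_inv c ` V)"
proof -
  have "continuous_map (subtopology X (fst c)) (top_of_set (chart_image c)) (snd c)"
    using chart(4)[OF c] homeomorphic_imp_continuous_map by blast
  moreover have "openin (top_of_set (chart_image c)) V"
    using V by (simp add: open_subset)
  ultimately have "openin (subtopology X (fst c)) {p \<in> topspace (subtopology X (fst c)). snd c p \<in> V}"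
    by (rule openin_continuous_map_preimage)
  moreover have "{p \<in> topspace (subtopology X (fst c)). snd c p \<in> V} = chart_inv c ` V"
    using chart(3)[OF c] unfolding chart_inv_image[OF c V(2)] by auto
  ultimately show ?thesis
    using chart(1)[OF c] openin_trans_full by metis
qed

text \<open>The inverse chart maps the compact set to a compact set of \<open>X\<close>, which is
  closed because \<open>X\<close> is Hausdorff. Extension by zero outside a chart depends on
  it.\<close>

lemma closedin_chart_inv:
  assumes c: "c \<in> A" and C: "compact C" "C \<subseteq> chart_image c"
  shows "closedin X (chart_inv c ` C)"
proof -
  obtain g where g: "homeomorphic_maps (subtopology X (fst c)) (top_of_set (chart_image c)) (snd c) g"
    using chart(4)[OF c] homeomorphic_map_maps by blast
  have gi: "g x = chart_inv c x" if "x \<in> chart_image c" for x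
  proof -
    have "chart_inv c x \<in> topspace (subtopology X (fst c))"
      using chart_inv_right(2)[OF that] chart(3)[OF c] by (simp add: subset_iff)
    then have "g (snd c (chart_inv c x)) = chart_inv c x"
      using g unfolding homeomorphic_maps_def by blast
    then show ?thesis by (simp add: chart_inv_right that)
  qed
  have "compactin (top_of_set (chart_image c)) C"
    using C by (simp add: compactin_subtopology)
  then have "compactin (subtopology X (fst c)) (g ` C)"
    using g image_compactin unfolding homeomorphic_maps_def by blast
  then have "compactin X (g ` C)" by (simp add: compactin_subtopology)
  moreover have "g ` C = chart_inv c ` C" using gi C by (intro image_cong) auto
  ultimately show ?thesis
    using mfd compactin_imp_closedin by (auto simp: smooth_manifold_def)
qed

abbreviation "overlap c d \<equiv> snd c ` (fst c \<inter> fst d)"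

lemma overlap: "c \<in> A \<Longrightarrow> d \<in> A \<Longrightarrow> open (overlap c d)" "c \<in> A \<Longrightarrow> d \<in> A \<Longrightarrow> smooth_on (transition c d) (overlap c d)"
  using open_chart_image chart(1) mfd by (auto simp: smooth_manifold_def)

lemma transition_apply: "c \<in> A \<Longrightarrow> p \<in> fst c \<Longrightarrow> transition c d (snd c p) = snd d p"
  by (simp add: transition_def chart_inv_left)

lemma transition_image: "c \<in> A \<Longrightarrow> transition c d ` overlap c d \<subseteq> overlap d c"
  by (auto simp: transition_apply)

section \<open>Tangent vectors, components and independence of the chart\<close>

definition "jac c d p = (\<chi> k i. partial i (transition c d) (snd c p) $ k)"

lemma charts_at_iff: "c \<in> charts_at A p \<longleftrightarrow> c \<in> A \<and> p \<in> fst c"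
  by (simp add: charts_at_def)

lemma transition_differentiable:
  "c \<in> charts_at A p \<Longrightarrow> d \<in> charts_at A p \<Longrightarrow> transition c d differentiable (at (snd c p))"
  by (intro smooth_onD[OF overlap(2)]) (auto simp: charts_at_def)

lemma transition_derivative:
  "c \<in> charts_at A p \<Longrightarrow> d \<in> charts_at A p \<Longrightarrow> frechet_derivative (transition c d) (at (snd c p)) v = jac c d p *v v"
  unfolding jac_def by (intro frechet_partial transition_differentiable)

lemma jac_cocycle:
  assumes "c \<in> charts_at A p" "d \<in> charts_at A p" "e \<in> charts_at A p"
  shows "jac d e p *v (jac c d p *v v) = jac c e p *v v"
proof -
  let ?O = "snd c ` (fst c \<inter> (fst d \<inter> fst e))"
  have A: "c \<in> A" "d \<in> A" "e \<in> A" "p \<in> fst c" "p \<in> fst d" "p \<in> fst e" using assms by (auto simp: charts_at_def)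
  have O: "open ?O" using A by (intro open_chart_image openin_Int chart)
  have pO: "snd c p \<in> ?O" using A by auto
  have "frechet_derivative (transition c e) (at (snd c p)) = frechet_derivative (\<lambda>x. transition d e (transition c d x)) (at (snd c p))"
    by (rule frechet_derivative_cong_open[OF O pO]) (auto simp: transition_apply A)
  also have "\<dots> = (\<lambda>v. frechet_derivative (transition d e) (at (snd d p)) (frechet_derivative (transition c d) (at (snd c p)) v))"
  proof -
    have 1: "(transition c d has_derivative frechet_derivative (transition c d) (at (snd c p))) (at (snd c p))"
      using transition_differentiable[OF assms(1,2)] frechet_derivative_works by blast
    have 2: "(transition d e has_derivative frechet_derivative (transition d e) (at (snd d p))) (at (transition c d (snd c p)))"
      using transition_differentiable[OF assms(2,3), unfolded frechet_derivative_works] by (simp only: transition_apply A)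
    show ?thesis
      using frechet_derivative_at[OF has_derivative_compose[OF 1 2]] by simp
  qed
  finally show ?thesis
    using transition_derivative[OF assms(1,3)] transition_derivative[OF assms(1,2)] transition_derivative[OF assms(2,3)]
    by metis
qed

lemma jac_self: "c \<in> charts_at A p \<Longrightarrow> jac c c p *v v = v"
proof -
  assume c: "c \<in> charts_at A p"
  then have A: "c \<in> A" "p \<in> fst c" by (auto simp: charts_at_def)
  have "frechet_derivative (transition c c) (at (snd c p)) = frechet_derivative (\<lambda>x. x) (at (snd c p))"
    by (rule frechet_derivative_cong_open[OF chart(2)[OF A(1)]])
       (auto simp: chart_image_I A transition_def chart_inv_right)
  then have "frechet_derivative (transition c c) (at (snd c p)) v = v"
    using frechet_derivative_at[OF has_derivative_ident] by metis
  then show ?thesis using transition_derivative[OF c c] by simp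
qed

lemma jac_invertible: "c \<in> charts_at A p \<Longrightarrow> d \<in> charts_at A p \<Longrightarrow> invertible (jac c d p)"
proof -
  assume "c \<in> charts_at A p" "d \<in> charts_at A p"
  then have "jac d c p ** jac c d p = mat 1"
    by (simp add: matrix_eq matrix_vector_mul_assoc[symmetric] jac_cocycle jac_self)
  then show ?thesis using invertible_left_inverse by blast
qed

text \<open>The tangent vector at \<open>p\<close> with coordinate vector \<open>w\<close> in the
  chart \<open>c\<close>, inverse to evaluation at \<open>c\<close>.\<close>

definition "tangent c p w = (\<lambda>d. if d \<in> charts_at A p then jac c d p *v w else 0)"

lemma coord_vec_tangent: "coord_vec A c p i = tangent c p (axis i 1)"
  by (simp add: coord_vec_def tangent_def fun_eq_iff jac_def matrix_vector_mult_basis column_def)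

lemma tangent_in: "c \<in> charts_at A p \<Longrightarrow> tangent c p w \<in> tangent_space A p"
  by (auto simp: tangent_space_def tangent_def transition_derivative jac_cocycle)

lemma tangent_apply: "c \<in> charts_at A p \<Longrightarrow> tangent c p w c = w"
  by (simp add: tangent_def jac_self)

lemma tangent_eq: "c \<in> charts_at A p \<Longrightarrow> u \<in> tangent_space A p \<Longrightarrow> tangent c p (u c) = u"
proof
  fix d assume c: "c \<in> charts_at A p" and u: "u \<in> tangent_space A p"
  show "tangent c p (u c) d = u d"
  proof (cases "d \<in> charts_at A p")
    case True
    then have "u d = frechet_derivative (transition c d) (at (snd c p)) (u c)"
      using u c unfolding tangent_space_def by blast
    then have "u d = jac c d p *v u c"
      by (simp only: transition_derivative[OF c True])
    then show ?thesis using True by (simp only: tangent_def if_True)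
  next
    case False
    then have "u d = 0" using u unfolding tangent_space_def by blast
    then show ?thesis using False by (simp only: tangent_def if_False)
  qed
qed

lemma tangent_linear: "tangent c p (r *\<^sub>R u + s *\<^sub>R w) = (\<lambda>d. r *\<^sub>R tangent c p u d + s *\<^sub>R tangent c p w d)"
  by (simp add: tangent_def fun_eq_iff matrix_vector_right_distrib matrix_vector_mult_scaleR)

text \<open>An inner product without positivity, so that the component formulas also cover the
  difference of two metrics.\<close>

definition "bilinear_at p h \<longleftrightarrow>
     (\<forall>u\<in>tangent_space A p. \<forall>v\<in>tangent_space A p. h u v = (h v u :: real)) \<and>
     (\<forall>u\<in>tangent_space A p. \<forall>v\<in>tangent_space A p. \<forall>w\<in>tangent_space A p. \<forall>r s.
        h (\<lambda>c. r *\<^sub>R u c + s *\<^sub>R v c) w = r * h u w + s * h v w)"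

lemma bilinear_expand:
  assumes h: "bilinear_at p (h p)" and c: "c \<in> charts_at A p"
  shows "h p (tangent c p u) (tangent c p v) = u \<bullet> (components A h c (snd c p) *v v)"
proof -
  let ?t = "tangent c p"
  have lin1: "linear (\<lambda>u. h p (?t u) (?t v))" for v
  proof (rule linearI)
    fix u w show "h p (?t (u + w)) (?t v) = h p (?t u) (?t v) + h p (?t w) (?t v)"
    proof -
      have "h p (\<lambda>d. 1 *\<^sub>R ?t u d + 1 *\<^sub>R ?t w d) (?t v) = 1 * h p (?t u) (?t v) + 1 * h p (?t w) (?t v)"
        using h tangent_in[OF c] unfolding bilinear_at_def by blast
      then show ?thesis using tangent_linear[of c p 1 u 1 w] by simp
    qed
  next
    fix r u show "h p (?t (r *\<^sub>R u)) (?t v) = r *\<^sub>R h p (?t u) (?t v)"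
    proof -
      have "h p (\<lambda>d. r *\<^sub>R ?t u d + 0 *\<^sub>R ?t u d) (?t v) = r * h p (?t u) (?t v) + 0 * h p (?t u) (?t v)"
        using h tangent_in[OF c] unfolding bilinear_at_def by blast
      then show ?thesis using tangent_linear[of c p r u 0 u] by simp
    qed
  qed
  have sym: "h p (?t u) (?t v) = h p (?t v) (?t u)" for u v
    using h tangent_in[OF c] by (simp add: bilinear_at_def)
  have e: "(\<Sum>i\<in>UNIV. w $ i *\<^sub>R axis i 1) = (w :: real^'n)" for w
    by (simp add: vec_eq_iff sum_component axis_def if_distrib sum.delta' cong: if_cong)
  have exp: "h p (?t w) (?t v) = (\<Sum>i\<in>UNIV. w $ i * h p (?t (axis i 1)) (?t v))" for w v
    using linear_sum[OF lin1, of "\<lambda>i. w $ i *\<^sub>R axis i 1" UNIV v] linear_scale[OF lin1]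
    by (simp add: e)
  have pc: "chart_inv c (snd c p) = p" using c by (auto simp: charts_at_def chart_inv_left)
  have "h p (?t u) (?t v) = (\<Sum>i\<in>UNIV. u $ i * (\<Sum>j\<in>UNIV. v $ j * h p (?t (axis i 1)) (?t (axis j 1))))"
    by (subst exp, subst sym, subst exp, subst sym) simp
  then show ?thesis
    by (simp add: inner_matrix_vector components_def pc coord_vec_tangent sum_distrib_left mult_ac)
qed

lemma inner_product_bilinear: "inner_product_on (tangent_space A p) b \<Longrightarrow> bilinear_at p b"
  by (simp add: inner_product_on_def bilinear_at_def)

lemma components_transform:
  assumes h: "bilinear_at p (h p)" and c: "c \<in> charts_at A p" and d: "d \<in> charts_at A p"
  shows "components A h d (snd d p) $ i $ j = (\<Sum>q\<in>UNIV. \<Sum>r\<in>UNIV. partial i (transition d c) (snd d p) $ q *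
     partial j (transition d c) (snd d p) $ r * components A h c (snd c p) $ q $ r)"
proof -
  have pd: "chart_inv d (snd d p) = p" using d by (auto simp: charts_at_def chart_inv_left)
  have cv: "coord_vec A d p i = tangent c p (partial i (transition d c) (snd d p))" for i
    using tangent_eq[OF c tangent_in[OF d, of "axis i 1"]] c
    by (simp add: coord_vec_tangent[symmetric]) (simp add: coord_vec_def)
  have "components A h d (snd d p) $ i $ j = h p (coord_vec A d p i) (coord_vec A d p j)"
    by (simp add: components_def pd)
  also have "\<dots> = partial i (transition d c) (snd d p) \<bullet> (components A h c (snd c p) *v partial j (transition d c) (snd d p))"
    unfolding cv by (rule bilinear_expand[where h = h and p = p, OF h c])
  finally show ?thesis by (simp add: inner_matrix_vector mult_ac)
qed

lemma metric_spd:
  assumes h: "riemannian_metric X A h" and c: "c \<in> A" and x: "x \<in> chart_image c"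
  shows "spd (components A h c x)"
proof -
  let ?p = "chart_inv c x"
  have p: "?p \<in> fst c" "snd c ?p = x" using chart_inv_right[OF x] by auto
  then have cp: "c \<in> charts_at A ?p" and pX: "?p \<in> topspace X" using c chart(3)[OF c] by (auto simp only: charts_at_def mem_Collect_eq)
  have ip: "inner_product_on (tangent_space A ?p) (h ?p)" using h pX by (simp add: riemannian_metric_def)
  show ?thesis unfolding spd_def
  proof (intro conjI allI impI)
    fix i j show "components A h c x $ i $ j = components A h c x $ j $ i"
      using ip tangent_in[OF cp] by (simp add: components_def Let_def coord_vec_tangent inner_product_on_def)
  next
    fix u :: "real^'n" assume "u \<noteq> 0"
    then have "tangent c ?p u \<noteq> (\<lambda>c. 0)" using tangent_apply[OF cp, of u] by auto
    then have "h ?p (tangent c ?p u) (tangent c ?p u) > 0"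
      using ip tangent_in[OF cp] by (simp add: inner_product_on_def)
    then show "u \<bullet> (components A h c x *v u) > 0"
      using bilinear_expand[where h = h and p = ?p, OF inner_product_bilinear[OF ip] cp, where u = u and v = u] by (simp add: p)
  qed
qed

lemma metric_smooth: "riemannian_metric X A h \<Longrightarrow> c \<in> A \<Longrightarrow> smooth_on (\<lambda>x. components A h c x $ i $ j) (chart_image c)"
  by (simp add: riemannian_metric_def)

lemma overlap_subset: "overlap c d \<subseteq> chart_image c"
  by (auto simp: chart_image_def)

lemma chart_at: "p \<in> topspace X \<Longrightarrow> chart_at A p \<in> charts_at A p"
proof -
  assume "p \<in> topspace X"
  then have "\<exists>c. c \<in> charts_at A p" using mfd unfolding smooth_manifold_def charts_at_def by blast
  then show ?thesis unfolding chart_at_def by (rule someI_ex)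
qed

text \<open>\<open>scal\<close> uses a chart chosen separately at each point. On its overlap with
  \<open>c\<close> the two component matrices are related by pullback, so
  \<open>scal_coord_Gt\<close> moves the computation to \<open>c\<close>.\<close>

theorem scal_chart:
  assumes h: "riemannian_metric X A h" and c: "c \<in> charts_at A p"
  shows "scal A h p = scal_coord (components A h c) (snd c p)"
proof -
  have cA: "c \<in> A" "p \<in> fst c" using c by (auto simp: charts_at_def)
  then have pX: "p \<in> topspace X" using chart(3) by blast
  define d where "d = chart_at A p"
  have d: "d \<in> charts_at A p" using chart_at[OF pX] by (simp add: d_def)
  then have dA: "d \<in> A" "p \<in> fst d" by (auto simp: charts_at_def)
  interpret coordinate_change "chart_image c" "overlap d c" "transition d c" "components A h c" "components A h d"
  proof
    show "transition d c ` overlap d c \<subseteq> chart_image c"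
      by (rule order_trans[OF transition_image[OF dA(1)] overlap_subset])
    show "det (components A h c x) \<noteq> 0" if "x \<in> chart_image c" for x
      using spd_det metric_spd[OF h cA(1) that] by blast
    show "components A h c x $ j $ k = components A h c x $ k $ j" if "x \<in> chart_image c" for x j k
      using metric_spd[OF h cA(1) that] by (auto simp: spd_def)
    fix y assume y: "y \<in> overlap d c"
    then obtain q where q: "q \<in> fst d" "q \<in> fst c" "y = snd d q" by blast
    then have qc: "c \<in> charts_at A q" "d \<in> charts_at A q" "q \<in> topspace X"
      using cA(1) dA(1) chart(3)[OF cA(1)] unfolding charts_at_iff by blast+
    show "invertible (\<chi> k a. partial a (transition d c) y $ k)"
      using jac_invertible[OF qc(2,1)] q by (simp add: jac_def)
    fix i j
    have "bilinear_at q (h q)" using h qc(3) inner_product_bilinear unfolding riemannian_metric_def by blast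
    then show "components A h d y $ i $ j = (\<Sum>p\<in>UNIV. \<Sum>q\<in>UNIV. partial i (transition d c) y $ p * partial j (transition d c) y $ q
          * components A h c (transition d c y) $ p $ q)"
      unfolding q(3) transition_apply[OF dA(1) q(1)] by (rule components_transform[OF _ qc(1,2)])
  qed (rule chart(2)[OF cA(1)] overlap[OF dA(1) cA(1)] metric_smooth[OF h cA(1)])+
  have "scal_coord (components A h d) (snd d p) = scal_coord (components A h c) (transition d c (snd d p))"
    using cA dA by (intro scal_coord_Gt) auto
  then show ?thesis
    by (simp add: scal_def d_def[symmetric] transition_apply dA)
qed

lemma scal_local:
  assumes Y: "openin X Y" "p \<in> Y" and eq: "\<And>q. q \<in> Y \<Longrightarrow> h q = h' q"
  shows "scal A h p = scal A h' p"
proof -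
  have pX: "p \<in> topspace X" using Y openin_subset by blast
  define d where "d = chart_at A p"
  have d: "d \<in> A" "p \<in> fst d" using chart_at[OF pX] by (auto simp: d_def charts_at_def)
  have "scal_coord (components A h d) (snd d p) = scal_coord (components A h' d) (snd d p)"
  proof (rule scal_coord_cong[OF open_chart_image[OF d(1) Y(1)]])
    show "snd d p \<in> snd d ` (fst d \<inter> Y)" using d Y by auto
    fix y assume "y \<in> snd d ` (fst d \<inter> Y)"
    then show "components A h d y = components A h' d y"
      using eq by (auto simp: components_def chart_inv_left d)
  qed
  then show ?thesis by (simp add: scal_def d_def)
qed

text \<open>Only the quadratic form has to be controlled, at the price of a factor equal to the
  dimension.\<close>

lemma tensor_norm_bound:
  fixes e :: real
  assumes p: "p \<in> topspace X" and g: "inner_product_on (tangent_space A p) (g p)" and g': "spd (components A g (chart_at A p) (snd (chart_at A p) p))"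
    and h: "bilinear_at p (h p)" and le: "\<And>u. u \<in> tangent_space A p \<Longrightarrow> \<bar>h p u u\<bar> \<le> e * g p u u" and e: "e \<ge> 0"
  shows "tensor_norm A g h p \<le> real CARD('n) * e"
proof -
  define c where "c = chart_at A p"
  have c: "c \<in> charts_at A p" using chart_at[OF p] by (simp add: c_def)
  then have pc: "chart_inv c (snd c p) = p" by (auto simp: charts_at_def chart_inv_left)
  let ?G = "components A g c (snd c p)" and ?H = "components A h c (snd c p)"
  have "tensor_sq (matrix_inv ?G) ?H \<le> (CARD('n) * e)\<^sup>2"
  proof (rule tensor_sq_bound)
    show "spd ?G" using g' by (simp add: c_def)
    show "?H $ i $ j = ?H $ j $ i" for i j
      using h tangent_in[OF c] by (simp add: components_def pc coord_vec_tangent bilinear_at_def)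
    show "\<bar>u \<bullet> (?H *v u)\<bar> \<le> e * (u \<bullet> (?G *v u))" for u
      using le[OF tangent_in[OF c, of u]] bilinear_expand[where h = h and p = p, OF h c] bilinear_expand[where h = g and p = p, OF inner_product_bilinear[OF g] c] by simp
  qed
  then have "sqrt (tensor_sq (matrix_inv ?G) ?H) \<le> sqrt ((CARD('n) * e)\<^sup>2)"
    by (rule real_sqrt_le_mono)
  then show ?thesis using e
    by (simp add: tensor_norm_def tensor_sq_def c_def[symmetric] Let_def)
qed

end

section \<open>One perturbation step on the manifold\<close>

context manifold
begin

text \<open>The image of \<open>d\<close> is the union of two open sets: the overlap with
  \<open>c\<close>, and the image of the complement of the closed set of points that
  \<open>C\<close> represents. On the second set the extended function is zero.\<close>

lemma smooth_on_extend:
  assumes c: "c \<in> A" and C: "compact C" "C \<subseteq> chart_image c" and d: "d \<in> A"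
    and f: "smooth_on f (overlap d c)"
    and f0: "\<And>p. p \<in> fst c \<Longrightarrow> p \<in> fst d \<Longrightarrow> snd c p \<notin> C \<Longrightarrow> f (snd d p) = 0"
  shows "smooth_on (\<lambda>x. if chart_inv d x \<in> fst c then f x else 0) (chart_image d)"
proof -
  let ?e = "\<lambda>x. if chart_inv d x \<in> fst c then f x else 0"
  let ?O = "snd d ` (fst d \<inter> (topspace X - chart_inv c ` C))"
  have e1: "smooth_on ?e (overlap d c)"
    by (rule smooth_on_cong[OF overlap(1)[OF d c] _ f]) (use chart_inv_left[OF d] in auto)
  have O: "open ?O" using closedin_chart_inv[OF c C] by (intro open_chart_image d) auto
  have e2: "smooth_on ?e ?O"
  proof (rule smooth_on_cong[OF O _ smooth_on_const[of 0]])
    fix x assume "x \<in> ?O"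
    then obtain p where p: "p \<in> fst d" "p \<notin> chart_inv c ` C" "x = snd d p" by blast
    then have "f (snd d p) = 0" if "p \<in> fst c"
      using that f0 unfolding chart_inv_image[OF c C(2)] by blast
    then show "0 = ?e x" using p by (simp add: chart_inv_left d)
  qed
  have "chart_image d = overlap d c \<union> ?O"
  proof (rule equalityI)
    show "chart_image d \<subseteq> overlap d c \<union> ?O"
    proof
      fix x assume "x \<in> chart_image d"
      then obtain p where p: "p \<in> fst d" "x = snd d p" by (auto simp: chart_image_def)
      have "chart_inv c ` C \<subseteq> fst c" unfolding chart_inv_image[OF c C(2)] by blast
      then show "x \<in> overlap d c \<union> ?O" using p chart(3)[OF d] by blast
    qed
  qed (auto simp: chart_image_def)
  then show ?thesis
    using smooth_on_Un[OF overlap(1)[OF d c] O e1 e2] by simp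
qed

lemma inner_product_nonneg:
  assumes "inner_product_on (tangent_space A p) b" "u \<in> tangent_space A p"
  shows "b u u \<ge> 0"
proof (cases "u = (\<lambda>c. 0)")
  case True
  have "b (\<lambda>c. 0 *\<^sub>R u c + 0 *\<^sub>R u c) u = 0 * b u u + 0 * b u u"
    using assms unfolding inner_product_on_def by blast
  then show ?thesis using True by simp
next
  case False
  then show ?thesis using assms unfolding inner_product_on_def by (meson less_imp_le)
qed

lemma components_add:
  assumes d: "d \<in> A" "x \<in> chart_image d" and c: "c \<in> A"
    and h': "\<And>p u v. h' p u v = h p u v + (if p \<in> fst c then u c \<bullet> (H (snd c p) *v v c) else 0)"
  shows "components A h' d x $ i $ j = components A h d x $ i $ j +
    (if chart_inv d x \<in> fst c then partial i (transition d c) x \<bullet> (H (transition d c x) *v partial j (transition d c) x) else 0)"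
proof -
  let ?p = "chart_inv d x"
  have p: "snd d ?p = x" "?p \<in> fst d" using chart_inv_right[OF d(2)] by auto
  have "coord_vec A d ?p i c = partial i (transition d c) x" if "?p \<in> fst c" for i
    using that c by (simp add: coord_vec_def charts_at_iff p)
  then show ?thesis
    by (simp add: components_def h' Let_def transition_def)
qed

text \<open>\<open>euclidean_step\<close> in the chart \<open>c\<close>, extended by zero. The
  metric \<open>h\<close> is perturbed while the size of the change is measured by the fixed
  \<open>g\<close>. The last property speaks of open sets because the perturbation involves
  derivatives of \<phi>.\<close>

lemma perturb_metric:
  assumes n: "CARD('n) \<ge> 3" and g: "riemannian_metric X A g" and h: "riemannian_metric X A h"
    and c: "c \<in> A" and C: "compact C" "C \<subseteq> chart_image c" and \<phi>: "smooth_fun A \<phi>"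
    and \<phi>0: "\<And>p. p \<in> topspace X \<Longrightarrow> p \<notin> chart_inv c ` C \<Longrightarrow> \<phi> p = 0" and \<delta>: "\<delta> > 0"
  obtains h' where "riemannian_metric X A h'"
    "\<And>p. p \<in> topspace X \<Longrightarrow> \<bar>scal A h' p - (scal A h p - (\<phi> p)\<^sup>2)\<bar> < \<delta>"
    "\<And>p u. p \<in> topspace X \<Longrightarrow> u \<in> tangent_space A p \<Longrightarrow> \<bar>h' p u u - h p u u\<bar> \<le> \<delta> * g p u u"
    "\<And>Y p. openin X Y \<Longrightarrow> (\<And>q. q \<in> Y \<Longrightarrow> \<phi> q = 0) \<Longrightarrow> p \<in> Y \<Longrightarrow> h' p = h p"
proof -
  let ?S = "chart_image c"
  let ?G = "components A h c" and ?R = "components A g c"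
  define \<alpha> where "\<alpha> = \<phi> \<circ> chart_inv c"
  have \<alpha>0: "\<alpha> x = 0" if "x \<in> ?S - C" for x
  proof -
    have x: "chart_inv c x \<in> fst c" "snd c (chart_inv c x) = x" using that chart_inv_right[of x c] by auto
    then have "chart_inv c x \<notin> chart_inv c ` C"
      using that unfolding chart_inv_image[OF c C(2)] by auto
    moreover have "chart_inv c x \<in> topspace X" using x chart(3)[OF c] by blast
    ultimately show ?thesis using \<phi>0 by (simp add: \<alpha>_def)
  qed
  obtain H where H: "\<And>j k. smooth_on (\<lambda>x. H x $ j $ k) ?S" "\<And>x j k. x \<in> ?S \<Longrightarrow> H x $ j $ k = H x $ k $ j"
    "\<And>W x. open W \<Longrightarrow> W \<subseteq> ?S \<Longrightarrow> (\<And>y. y \<in> W \<Longrightarrow> \<alpha> y = 0) \<Longrightarrow> x \<in> W \<Longrightarrow> H x = 0"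
    "\<And>x u. x \<in> ?S \<Longrightarrow> \<bar>u \<bullet> (H x *v u)\<bar> \<le> \<delta> * (u \<bullet> (?R x *v u))"
    "\<And>x u. x \<in> ?S \<Longrightarrow> \<bar>u \<bullet> (H x *v u)\<bar> \<le> 1/2 * (u \<bullet> (?G x *v u))"
    "\<And>x. x \<in> ?S \<Longrightarrow> \<bar>scal_coord (\<lambda>x. ?G x + H x) x - (scal_coord ?G x - (\<alpha> x)\<^sup>2)\<bar> < \<delta>"
  proof (rule euclidean_step[where S = ?S and G = ?G and R = ?R and \<alpha> = \<alpha> and C = C and d = \<delta>])
    show "smooth_on \<alpha> ?S" using \<phi> c unfolding \<alpha>_def smooth_fun_def by blast
    show "continuous_on ?S (\<lambda>x. ?R x $ j $ k)" for j k
      by (intro smooth_on_imp_continuous_on metric_smooth g c)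
  qed (use n C \<alpha>0 \<delta> chart(2)[OF c] metric_smooth[OF h c] metric_spd[OF h c] metric_spd[OF g c] in blast)+
  \<comment> \<open>A tangent vector is the family of its coordinate vectors, so the matrix
    \<open>H\<close> acts on the entries \<open>u c\<close> and \<open>v c\<close>.\<close>
  define h' where "h' p u v = h p u v + (if p \<in> fst c then u c \<bullet> (H (snd c p) *v v c) else 0)" for p u v
  have Hsym: "u \<bullet> (H x *v v) = v \<bullet> (H x *v u)" if "x \<in> ?S" for u v x
    by (intro inner_matrix_vector_commute H that)
  have H0: "H x = 0" if "x \<in> ?S - C" for x
    using H(3)[of "?S - C" x] \<alpha>0 that chart(2)[OF c] compact_imp_closed[OF C(1)] by blast
  have ip: "inner_product_on (tangent_space A p) (h p)" "inner_product_on (tangent_space A p) (g p)" if "p \<in> topspace X" for p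
    using h g that by (auto simp: riemannian_metric_def)
  have bh: "bilinear_at p (h p)" "bilinear_at p (g p)" if "p \<in> topspace X" for p
    using ip[OF that] inner_product_bilinear by blast+
  have expand: "k p u v = u c \<bullet> (components A k c (snd c p) *v v c)"
    if "bilinear_at p (k p)" "p \<in> fst c" "u \<in> tangent_space A p" "v \<in> tangent_space A p" for k p u v
  proof -
    have cp: "c \<in> charts_at A p" using c that by (simp add: charts_at_iff)
    show ?thesis
      using bilinear_expand[where h = k and p = p, OF that(1) cp, of "u c" "v c"] tangent_eq[OF cp] that by simp
  qed
  have comp_c: "components A h' c x = ?G x + H x" if "x \<in> ?S" for x
  proof -
    have pi: "partial i (transition c c) x = axis i 1" for i
      using jac_self[of c "chart_inv c x" "axis i 1"] chart_inv_right[OF that] c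
      by (simp add: charts_at_iff jac_def matrix_vector_mult_basis column_def)
    have tx: "transition c c x = x" by (simp add: transition_def chart_inv_right that)
    have "components A h' c x $ i $ j = (?G x + H x) $ i $ j" for i j
      unfolding components_add[where h = h and h' = h' and H = H, OF c that c h'_def] pi tx
      by (simp add: chart_inv_right that inner_axis' matrix_vector_mult_basis column_def)
    then show ?thesis by (simp only: vec_eq_iff) simp
  qed
  have met: "riemannian_metric X A h'"
    unfolding riemannian_metric_def
  proof (intro conjI ballI allI)
    fix p assume p: "p \<in> topspace X"
    show "inner_product_on (tangent_space A p) (h' p)"
      unfolding inner_product_on_def
    proof (intro conjI ballI allI impI)
      fix u v assume "u \<in> tangent_space A p" "v \<in> tangent_space A p"
      then show "h' p u v = h' p v u"
        using ip(1)[OF p] Hsym[OF chart_image_I[of p c], of "u c" "v c"] by (simp add: h'_def inner_product_on_def)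
    next
      fix u v w r s assume "u \<in> tangent_space A p" "v \<in> tangent_space A p" "w \<in> tangent_space A p"
      then have "h p (\<lambda>c. r *\<^sub>R u c + s *\<^sub>R v c) w = r * h p u w + s * h p v w"
        using ip(1)[OF p] unfolding inner_product_on_def by blast
      then show "h' p (\<lambda>c. r *\<^sub>R u c + s *\<^sub>R v c) w = r * h' p u w + s * h' p v w"
        by (simp add: h'_def inner_add_left algebra_simps)
    next
      fix u assume u: "u \<in> tangent_space A p" "u \<noteq> (\<lambda>c. 0)"
      then have pos: "h p u u > 0" using ip(1)[OF p] unfolding inner_product_on_def by blast
      show "h' p u u > 0"
      proof (cases "p \<in> fst c")
        case True
        \<comment> \<open>At most half of \<open>h p u u\<close> is taken away, so positivity
          survives.\<close>
        have "\<bar>u c \<bullet> (H (snd c p) *v u c)\<bar> \<le> 1/2 * h p u u"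
          using H(5)[OF chart_image_I[OF True], of "u c"] expand[where k = h, OF bh(1)[OF p] True u(1) u(1)] by simp
        then have "h p u u + u c \<bullet> (H (snd c p) *v u c) > 0" using pos by linarith
        then show ?thesis using True by (simp add: h'_def)
      qed (simp add: h'_def pos)
    qed
  next
    fix d i j assume d: "d \<in> A"
    let ?f = "\<lambda>x. partial i (transition d c) x \<bullet> (H (transition d c x) *v partial j (transition d c) x)"
    let ?e = "\<lambda>x. if chart_inv d x \<in> fst c then ?f x else 0"
    have "smooth_on (\<lambda>x. \<Sum>q\<in>UNIV. \<Sum>r\<in>UNIV. partial i (transition d c) x $ q * H (transition d c x) $ q $ r * partial j (transition d c) x $ r) (overlap d c)"
      by (intro smooth_intros smooth_on_vec_nth smooth_on_partial overlap d c smooth_on_compose[OF H(1)]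
          order_trans[OF transition_image overlap_subset])
    then have "smooth_on ?f (overlap d c)" by (simp only: inner_matrix_vector)
    then have "smooth_on ?e (chart_image d)"
    proof (rule smooth_on_extend[OF c C d])
      fix p assume "p \<in> fst c" "p \<in> fst d" "snd c p \<notin> C"
      then show "?f (snd d p) = 0"
        using H0[of "snd c p"] chart_image_I[of p c] by (simp add: transition_apply d)
    qed
    then have "smooth_on (\<lambda>x. components A h d x $ i $ j + ?e x) (chart_image d)"
      by (intro smooth_on_add chart(2)[OF d] metric_smooth h d)
    then show "smooth_on (\<lambda>x. components A h' d x $ i $ j) (chart_image d)"
      by (rule smooth_on_cong[OF chart(2)[OF d], rotated]) (simp add: components_add[where h = h and h' = h' and H = H, OF d _ c h'_def])
  qed
  have local: "h' p = h p" if "openin X Y" "\<And>q. q \<in> Y \<Longrightarrow> \<phi> q = 0" "p \<in> Y" for Y p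
  proof (cases "p \<in> fst c")
    case True
    have "H (snd c p) = 0"
    proof (rule H(3))
      show "open (snd c ` (fst c \<inter> Y))" by (rule open_chart_image[OF c that(1)])
      show "snd c ` (fst c \<inter> Y) \<subseteq> ?S" by (auto simp: chart_image_def)
      show "\<alpha> y = 0" if "y \<in> snd c ` (fst c \<inter> Y)" for y
        using that \<open>\<And>q. q \<in> Y \<Longrightarrow> \<phi> q = 0\<close> by (auto simp: \<alpha>_def chart_inv_left c)
      show "snd c p \<in> snd c ` (fst c \<inter> Y)" using True that(3) by blast
    qed
    then show ?thesis by (simp add: h'_def fun_eq_iff)
  qed (simp add: h'_def fun_eq_iff)
  show thesis
  proof (rule that[OF met _ _ local])
    fix p assume p: "p \<in> topspace X"
    show "\<bar>scal A h' p - (scal A h p - (\<phi> p)\<^sup>2)\<bar> < \<delta>"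
    proof (cases "p \<in> fst c")
      case True
      then have cp: "c \<in> charts_at A p" using c by (simp add: charts_at_iff)
      have "scal A h' p = scal_coord (\<lambda>x. ?G x + H x) (snd c p)"
        unfolding scal_chart[OF met cp]
        by (rule scal_coord_cong[OF chart(2)[OF c] chart_image_I[OF True] comp_c])
      then show ?thesis
        using H(6)[OF chart_image_I[OF True]] by (simp add: scal_chart[OF h cp] \<alpha>_def chart_inv_left c True)
    next
      case False
      \<comment> \<open>An open neighbourhood of \<open>p\<close> on which \<phi> vanishes, so that
        the metric and hence the curvature at \<open>p\<close> are unchanged.\<close>
      let ?Y = "topspace X - chart_inv c ` C"
      have Y: "openin X ?Y" using closedin_chart_inv[OF c C] by auto
      have pY: "p \<in> ?Y" using False p unfolding chart_inv_image[OF c C(2)] by blast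
      have "scal A h' p = scal A h p"
        by (rule scal_local[OF Y pY], rule local[OF Y]) (use \<phi>0 in auto)
      moreover have "\<phi> p = 0" using pY \<phi>0 by blast
      ultimately show ?thesis using \<delta> by simp
    qed
    show "\<bar>h' p u u - h p u u\<bar> \<le> \<delta> * g p u u" if u: "u \<in> tangent_space A p" for u
    proof (cases "p \<in> fst c")
      case True
      then show ?thesis
        using H(4)[OF chart_image_I[OF True], of "u c"] expand[where k = g, OF bh(2)[OF p] True u u] by (simp add: h'_def)
    next
      case False
      have "g p u u \<ge> 0" by (rule inner_product_nonneg[OF ip(2)[OF p] u])
      then show ?thesis using False \<delta> by (simp add: h'_def)
    qed
  qed auto
qed

end

section \<open>Construction of the metric\<close>

context manifold
begin

lemma smooth_fun_extend:
  assumes c: "c \<in> A" and C: "compact C" "C \<subseteq> chart_image c" and f: "smooth_on f (chart_image c)"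
    and f0: "\<And>x. x \<in> chart_image c - C \<Longrightarrow> f x = 0"
  shows "smooth_fun A (\<lambda>p. if p \<in> fst c then f (snd c p) else 0)"
  unfolding smooth_fun_def
proof
  fix d assume d: "d \<in> A"
  have "smooth_on (\<lambda>x. f (transition d c x)) (overlap d c)"
    by (rule smooth_on_compose[OF f overlap[OF d c] order_trans[OF transition_image[OF d] overlap_subset]])
  then have "smooth_on (\<lambda>x. if chart_inv d x \<in> fst c then f (transition d c x) else 0) (chart_image d)"
  proof (rule smooth_on_extend[OF c C d])
    fix p assume "p \<in> fst c" "p \<in> fst d" "snd c p \<notin> C"
    then show "f (transition d c (snd d p)) = 0"
      using f0[of "snd c p"] chart_image_I[of p c] by (simp add: transition_apply d)
  qed
  then show "smooth_on ((\<lambda>p. if p \<in> fst c then f (snd c p) else 0) \<circ> chart_inv d) (chart_image d)"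
    unfolding transition_def o_def .
qed

text \<open>Around each point there is a ball in chart coordinates whose double lies in the chart
  image. Second countability yields, by the Lindelof property, countably many of these that cover
  \<open>X\<close>. Their centres are enumerated, possibly with repetitions, which uses that there
  is at least one point.\<close>

lemma bump_cover:
  assumes "topspace X \<noteq> {}"
  obtains cs :: "nat \<Rightarrow> ('a, 'n) chart" and Cs \<beta> Os where
    "\<And>n. cs n \<in> A" "\<And>n. compact (Cs n)" "\<And>n. Cs n \<subseteq> chart_image (cs n)" "\<And>n. smooth_fun A (\<beta> n)"
    "\<And>n. openin X (Os n)" "(\<Union>n. Os n) = topspace X"
    "\<And>n p. p \<in> Os n \<Longrightarrow> \<beta> n p = (1::real)" "\<And>n p. p \<notin> chart_inv (cs n) ` Cs n \<Longrightarrow> \<beta> n p = 0"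
proof -
  have "\<forall>p\<in>topspace X. \<exists>c r. c \<in> A \<and> p \<in> fst c \<and> r > 0 \<and> cball (snd c p) (2 * r) \<subseteq> chart_image c"
  proof
    fix p assume p: "p \<in> topspace X"
    let ?c = "chart_at A p"
    have c: "?c \<in> A" "p \<in> fst ?c" using chart_at[OF p] by (simp_all add: charts_at_iff)
    obtain e where "e > 0" "cball (snd ?c p) e \<subseteq> chart_image ?c"
      using open_contains_cball chart(2)[OF c(1)] chart_image_I[OF c(2)] by blast
    then have "e / 2 > 0" "cball (snd ?c p) (2 * (e / 2)) \<subseteq> chart_image ?c" by auto
    then show "\<exists>c r. c \<in> A \<and> p \<in> fst c \<and> r > 0 \<and> cball (snd c p) (2 * r) \<subseteq> chart_image c"
      using c by blast
  qed
  then obtain c r where cr: "\<And>p. p \<in> topspace X \<Longrightarrow> c p \<in> A" "\<And>p. p \<in> topspace X \<Longrightarrow> p \<in> fst (c p)"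
    "\<And>p. p \<in> topspace X \<Longrightarrow> r p > 0" "\<And>p. p \<in> topspace X \<Longrightarrow> cball (snd (c p) p) (2 * r p) \<subseteq> chart_image (c p)"
    by metis
  define B where "B p = chart_inv (c p) ` ball (snd (c p) p) (r p)" for p
  have sub: "ball (snd (c p) p) (r p) \<subseteq> chart_image (c p)" if "p \<in> topspace X" for p
  proof -
    have "ball (snd (c p) p) (r p) \<subseteq> cball (snd (c p) p) (2 * r p)" using cr(3)[OF that] by auto
    then show ?thesis using cr(4)[OF that] by blast
  qed
  have openB: "openin X (B p)" if "p \<in> topspace X" for p
    unfolding B_def by (intro openin_chart_inv cr sub that open_ball)
  have inB: "p \<in> B p" if "p \<in> topspace X" for p
    unfolding B_def chart_inv_image[OF cr(1)[OF that] sub[OF that]] using cr that by simp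
  have "Lindelof_space X"
    by (rule second_countable_imp_Lindelof_space) (use mfd in \<open>simp add: smooth_manifold_def\<close>)
  moreover have "\<And>U. U \<in> B ` topspace X \<Longrightarrow> openin X U" "\<Union>(B ` topspace X) = topspace X"
    using openB inB openin_subset by blast+
  ultimately have "\<exists>\<V>. countable \<V> \<and> \<V> \<subseteq> B ` topspace X \<and> \<Union>\<V> = topspace X"
    by (rule Lindelof_spaceD)
  then have "\<exists>D. countable D \<and> D \<subseteq> topspace X \<and> \<Union>(B ` D) = topspace X"
    unfolding ex_countable_subset_image .
  then obtain D where D: "countable D" "D \<subseteq> topspace X" "\<Union>(B ` D) = topspace X"
    by (elim exE conjE)
  have "D \<noteq> {}" using assms unfolding D(3)[symmetric] by blast
  define P where "P = from_nat_into D"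
  have P: "P n \<in> topspace X" for n using from_nat_into[OF \<open>D \<noteq> {}\<close>] D by (auto simp: P_def)
  have rP: "range P = D" unfolding P_def by (rule range_from_nat_into[OF \<open>D \<noteq> {}\<close> D(1)])
  have "\<exists>f. smooth_on f UNIV \<and> (\<forall>x. dist (snd (c (P n)) (P n)) x \<le> r (P n) \<longrightarrow> f x = (1::real)) \<and>
      (\<forall>x. dist (snd (c (P n)) (P n)) x \<ge> 2 * r (P n) \<longrightarrow> f x = 0)" for n
    by (rule bump_exists[OF cr(3)[OF P[of n]], of "snd (c (P n)) (P n)"]) blast
  then obtain f where f: "\<And>n. smooth_on (f n) UNIV"
      "\<And>n x. dist (snd (c (P n)) (P n)) x \<le> r (P n) \<Longrightarrow> f n x = (1::real)"
      "\<And>n x. dist (snd (c (P n)) (P n)) x \<ge> 2 * r (P n) \<Longrightarrow> f n x = 0"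
    by metis
  let ?C = "\<lambda>n. cball (snd (c (P n)) (P n)) (2 * r (P n))"
  let ?\<beta> = "\<lambda>n p. if p \<in> fst (c (P n)) then f n (snd (c (P n)) p) else 0"
  show thesis
  proof (rule that[of "\<lambda>n. c (P n)" ?C ?\<beta> "\<lambda>n. B (P n)"])
    fix n
    show "c (P n) \<in> A" "?C n \<subseteq> chart_image (c (P n))" "openin X (B (P n))"
      using cr P openB by auto
    show "smooth_fun A (?\<beta> n)"
      using f(3) smooth_on_subset[OF f(1)]
      by (intro smooth_fun_extend[where C = "?C n"] cr P compact_cball) auto
    fix p
    show "?\<beta> n p = 1" if "p \<in> B (P n)"
      using that unfolding B_def chart_inv_image[OF cr(1)[OF P] sub[OF P]] by (auto intro!: f(2))
    show "?\<beta> n p = 0" if "p \<notin> chart_inv (c (P n)) ` ?C n"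
      using that f(3)[of n "snd (c (P n)) p"] unfolding chart_inv_image[OF cr(1)[OF P] cr(4)[OF P]] by auto
  next
    show "(\<Union>n. B (P n)) = topspace X" using D(3) rP by (metis image_image)
  qed (rule compact_cball)
qed

end

lemma geometric_partial_sum: "(\<Sum>j<n. d / 2 ^ (j + 1)) = d * (1 - 1 / 2 ^ n)" for d :: real
  by (induction n) (auto simp: field_simps)

theorem theorem1p1:
  fixes X :: "'a topology" and A :: "('a, 'n::finite) chart set"
    and g g0 :: "('a, 'n) tensor2" and k :: "'a \<Rightarrow> real" and \<epsilon> :: real
  assumes "smooth_manifold X A" and "CARD('n) \<ge> 3"
    and "riemannian_metric X A g" and "riemannian_metric X A g0"
    and "smooth_fun A k" and "\<forall>p\<in>topspace X. k p > 0"
    and "\<epsilon> > 0"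
  shows "\<exists>g\<epsilon>. riemannian_metric X A g\<epsilon> \<and>
    (\<forall>p\<in>topspace X. scal A g0 p - k p - \<epsilon> < scal A g\<epsilon> p \<and>
                    scal A g\<epsilon> p < scal A g0 p - k p) \<and>
    C0_norm X A g (tensor_diff g\<epsilon> g0) < ennreal \<epsilon>"
proof (cases "topspace X = {}")
  case True
  \<comment> \<open>The supremum over the empty set is 0, so \<open>g0\<close> itself
    serves.\<close>
  then show ?thesis using assms by (intro exI[of _ g0]) (simp add: C0_norm_def bot_ennreal)
next
  case False
  interpret manifold X A by unfold_locales fact
  obtain cs :: "nat \<Rightarrow> ('a, 'n) chart" and Cs \<beta> Os where cover:
    "\<And>n. cs n \<in> A" "\<And>n. compact (Cs n)" "\<And>n. Cs n \<subseteq> chart_image (cs n)" and \<beta>: "\<And>n. smooth_fun A (\<beta> n)"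
    and Os: "\<And>n. openin X (Os n)" "(\<Union>n. Os n) = topspace X"
    and \<beta>1: "\<And>n p. p \<in> Os n \<Longrightarrow> \<beta> n p = (1::real)" and \<beta>0: "\<And>n p. p \<notin> chart_inv (cs n) ` Cs n \<Longrightarrow> \<beta> n p = 0"
    using bump_cover[OF False] by blast
  define n1 where "n1 = real CARD('n)"
  have n1: "n1 \<ge> 3" using assms(2) by (simp add: n1_def)
  \<comment> \<open>\<open>tensor_norm_bound\<close> costs the factor \<open>n1\<close>, so a total
    change of \<delta> has norm at most \<epsilon>/2. Also \<delta> \<le> \<epsilon>/2, the distance
    of the aimed value of the curvature from both ends of the admissible interval.\<close>
  define \<delta> where "\<delta> = \<epsilon> / (2 * n1)"
  have \<delta>: "\<delta> > 0" "\<delta> \<le> \<epsilon> / 2" using assms(7) n1 by (auto simp: \<delta>_def field_simps)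
  \<comment> \<open>Bumps written as angles make the squares telescope for all their values, as only
    sin^2 + cos^2 = 1 enters. On \<open>Os m\<close> the angle is pi/2 and the factor
    \<open>C m p\<close> is zero.\<close>
  define C where "C j p = cos (pi / 2 * \<beta> j p)" for j p
  define amp where "amp n p = sqrt (k p + \<epsilon> / 2) * (\<Prod>j<n. C j p) * sin (pi / 2 * \<beta> n p)" for n p
  have kpos: "k p + \<epsilon> / 2 > 0" if "p \<in> topspace X" for p using assms(6,7) that by (simp add: add_pos_pos)
  have amp_smooth: "smooth_fun A (amp n)" for n
    unfolding smooth_fun_def
  proof
    fix d assume d: "d \<in> A"
    have b: "smooth_on (\<lambda>x. \<beta> j (chart_inv d x)) (chart_image d)" for j
      using \<beta>[of j] d by (auto simp: smooth_fun_def o_def)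
    have kk: "smooth_on (\<lambda>x. k (chart_inv d x)) (chart_image d)"
      using assms(5) d by (auto simp: smooth_fun_def o_def)
    have pos: "k (chart_inv d x) + \<epsilon> / 2 > 0" if "x \<in> chart_image d" for x
      using chart_inv_right(2)[OF that] chart(3)[OF d] by (intro kpos) auto
    show "smooth_on (amp n \<circ> chart_inv d) (chart_image d)"
      unfolding amp_def C_def o_def by (intro smooth_intros b kk chart(2)[OF d] pos) auto
  qed
  have amp_out: "amp n p = 0" if "p \<notin> chart_inv (cs n) ` Cs n" for n p
    using \<beta>0[OF that] by (simp add: amp_def)
  have amp_late: "amp n p = 0" if "p \<in> Os m" "m < n" for n m p
  proof -
    have "C m p = 0" using \<beta>1[OF that(1)] by (simp add: C_def)
    then have "(\<Prod>j<n. C j p) = 0" using that(2) by (intro prod_zero) auto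
    then show ?thesis by (simp add: amp_def)
  qed
  have amp_sum: "(\<Sum>j<n. (amp j p)\<^sup>2) = (k p + \<epsilon> / 2) * (1 - (\<Prod>j<n. C j p)\<^sup>2)" if "p \<in> topspace X" for n p
  proof (induction n)
    case (Suc n)
    have e: "(amp n p)\<^sup>2 = (k p + \<epsilon> / 2) * (\<Prod>j<n. C j p)\<^sup>2 * (1 - (C n p)\<^sup>2)"
      using kpos[OF that] by (simp add: amp_def power_mult_distrib C_def sin_squared_eq)
    show ?case
      unfolding sum.lessThan_Suc prod.lessThan_Suc power_mult_distrib Suc e by (simp add: field_simps)
  qed simp
  \<comment> \<open>Relation between consecutive metrics: the curvature drops as prescribed up to an
    error, the change is small relative to the fixed \<open>g\<close>, and the sets dealt with
    before are left alone. The errors add up to less than \<delta>.\<close>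
  define R where "R n h h' \<longleftrightarrow>
      (\<forall>p\<in>topspace X. \<bar>scal A h' p - (scal A h p - (amp n p)\<^sup>2)\<bar> < \<delta> / 2 ^ (n + 1)) \<and>
      (\<forall>p\<in>topspace X. \<forall>u\<in>tangent_space A p. \<bar>h' p u u - h p u u\<bar> \<le> \<delta> / 2 ^ (n + 1) * g p u u) \<and>
      (\<forall>m<n. \<forall>p\<in>Os m. h' p = h p)" for n and h h' :: "('a, 'n) tensor2"
  have "\<exists>h'. riemannian_metric X A h' \<and> R n h h'" if h: "riemannian_metric X A h" for n h
  proof (rule perturb_metric[OF assms(2,3) h cover(1)[of n] cover(2,3) amp_smooth[of n], of "\<delta> / 2 ^ (n + 1)"])
    show "amp n p = 0" if "p \<notin> chart_inv (cs n) ` Cs n" for p by (rule amp_out[OF that])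
    show "\<delta> / 2 ^ (n + 1) > 0" using \<delta> by simp
    fix h'
    assume *: "riemannian_metric X A h'"
      "\<And>p. p \<in> topspace X \<Longrightarrow> \<bar>scal A h' p - (scal A h p - (amp n p)\<^sup>2)\<bar> < \<delta> / 2 ^ (n + 1)"
      "\<And>p u. p \<in> topspace X \<Longrightarrow> u \<in> tangent_space A p \<Longrightarrow> \<bar>h' p u u - h p u u\<bar> \<le> \<delta> / 2 ^ (n + 1) * g p u u"
      "\<And>Y p. openin X Y \<Longrightarrow> (\<And>q. q \<in> Y \<Longrightarrow> amp n q = 0) \<Longrightarrow> p \<in> Y \<Longrightarrow> h' p = h p"
    have "h' p = h p" if "m < n" "p \<in> Os m" for m p
      by (rule *(4)[OF Os(1)[of m]]) (use amp_late that in blast)+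
    then show ?thesis using * unfolding R_def by blast
  qed
  \<comment> \<open>Dependent choice, because stage \<open>n\<close> perturbs the metric reached at
    that stage; the clause for \<open>n = 0\<close> fixes the start.\<close>
  then obtain h where "\<forall>n. (riemannian_metric X A (h n) \<and> (n = 0 \<longrightarrow> h n = g0)) \<and> R n (h n) (h (Suc n))"
    using dependent_nat_choice[of "\<lambda>n h. riemannian_metric X A h \<and> (n = 0 \<longrightarrow> h = g0)" R] assms(4) by auto
  then have h: "\<And>n. riemannian_metric X A (h n)" "h 0 = g0" "\<And>n. R n (h n) (h (Suc n))" by auto
  have scal_n: "\<bar>scal A (h n) p - (scal A g0 p - (\<Sum>j<n. (amp j p)\<^sup>2))\<bar> \<le> (\<Sum>j<n. \<delta> / 2 ^ (j + 1))" if "p \<in> topspace X" for n p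
  proof (induction n)
    case (Suc n)
    have "\<bar>scal A (h (Suc n)) p - (scal A (h n) p - (amp n p)\<^sup>2)\<bar> < \<delta> / 2 ^ (n + 1)"
      using h(3)[of n] that by (simp add: R_def)
    with Suc show ?case unfolding sum.lessThan_Suc by linarith
  qed (simp add: h)
  have near_n: "\<bar>h n p u u - g0 p u u\<bar> \<le> (\<Sum>j<n. \<delta> / 2 ^ (j + 1)) * g p u u" if "p \<in> topspace X" "u \<in> tangent_space A p" for n p u
  proof (induction n)
    case (Suc n)
    have "\<bar>h (Suc n) p u u - h n p u u\<bar> \<le> \<delta> / 2 ^ (n + 1) * g p u u"
      using h(3)[of n] that by (simp add: R_def)
    with Suc show ?case unfolding sum.lessThan_Suc distrib_right by linarith
  qed (simp add: h)
  have stable: "h n p = h (Suc m) p" if "p \<in> Os m" "n \<ge> Suc m" for n m p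
    using that(2)
  proof (induction n rule: dec_induct)
    case (step n)
    have "m < n" using step by simp
    then have "h (Suc n) p = h n p" using h(3)[of n] that(1) unfolding R_def by blast
    then show ?case using step by simp
  qed simp
  define N where "N p = (LEAST n. p \<in> Os n)" for p
  \<comment> \<open>Stage \<open>N p\<close> itself may still change the metric at \<open>p\<close>,
    hence \<open>Suc\<close>; later stages do not. By \<open>stable\<close> every other index
    \<open>m\<close> with \<open>p \<in> Os m\<close> gives the same value, so on each
    \<open>Os m\<close> the limit agrees with one smooth metric.\<close>
  define ge where "ge p = h (Suc (N p)) p" for p
  have ge: "ge p = h (Suc m) p" if "p \<in> Os m" for p m
  proof -
    have "p \<in> Os (N p)" "N p \<le> m" unfolding N_def using that by (auto intro: LeastI Least_le)
    then show ?thesis using stable[of p "N p" "Suc m"] by (simp add: ge_def)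
  qed
  have ip: "inner_product_on (tangent_space A p) (ge p)" "inner_product_on (tangent_space A p) (g0 p)"
    "inner_product_on (tangent_space A p) (g p)" if "p \<in> topspace X" for p
    using h(1) assms(3,4) that by (auto simp: riemannian_metric_def ge_def)
  have met: "riemannian_metric X A ge"
    unfolding riemannian_metric_def
  proof (intro conjI ballI allI)
    fix d i j assume d: "d \<in> A"
    show "smooth_on (\<lambda>x. components A ge d x $ i $ j) (chart_image d)"
    proof (rule smooth_on_local)
      fix x assume "x \<in> chart_image d"
      then obtain p where p: "p \<in> fst d" "x = snd d p" by (auto simp: chart_image_def)
      then obtain m where m: "p \<in> Os m" using Os(2) chart(3)[OF d] by blast
      let ?U = "snd d ` (fst d \<inter> Os m)"
      have U: "open ?U" by (rule open_chart_image[OF d Os(1)])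
      have "smooth_on (\<lambda>x. components A (h (Suc m)) d x $ i $ j) ?U"
        by (rule smooth_on_subset[OF metric_smooth[OF h(1) d]]) (auto simp: chart_image_def)
      then have "smooth_on (\<lambda>x. components A ge d x $ i $ j) ?U"
        by (rule smooth_on_cong[OF U, rotated]) (auto simp: components_def chart_inv_left d ge)
      then show "\<exists>U. open U \<and> x \<in> U \<and> smooth_on (\<lambda>x. components A ge d x $ i $ j) U"
        using U p m by blast
    qed
  qed (rule ip)
  have sum_less: "(\<Sum>j<n. \<delta> / 2 ^ (j + 1)) < \<delta>" for n
    unfolding geometric_partial_sum using \<delta> by (simp add: field_simps)
  have scal: "\<bar>scal A ge p - (scal A g0 p - (k p + \<epsilon> / 2))\<bar> < \<delta>" if p: "p \<in> topspace X" for p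
  proof -
    obtain m where m: "p \<in> Os m" using Os(2) p by blast
    \<comment> \<open>The vanishing factor completes the telescoping sum: after stage
      \<open>m\<close> exactly \<open>k p + \<epsilon> / 2\<close> has been subtracted, and only the
      accumulated errors remain.\<close>
    have "C m p = 0" using \<beta>1[OF m] by (simp add: C_def)
    then have "(\<Sum>j<Suc m. (amp j p)\<^sup>2) = k p + \<epsilon> / 2"
      by (simp only: amp_sum[OF p] prod.lessThan_Suc) simp
    moreover have "scal A ge p = scal A (h (Suc m)) p"
      by (rule scal_local[OF Os(1) m ge])
    ultimately show ?thesis using scal_n[OF p, of "Suc m"] sum_less[of "Suc m"] by simp
  qed
  have norm: "tensor_norm A g (tensor_diff ge g0) p \<le> \<epsilon> / 2" if p: "p \<in> topspace X" for p
  proof -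
    have c: "chart_at A p \<in> A" "p \<in> fst (chart_at A p)" using chart_at[OF p] by (simp_all add: charts_at_iff)
    have "tensor_norm A g (tensor_diff ge g0) p \<le> real CARD('n) * \<delta>"
    proof (rule tensor_norm_bound[OF p ip(3)[OF p] metric_spd[OF assms(3) c(1) chart_image_I[OF c(2)]]])
      have "bilinear_at p (ge p)" "bilinear_at p (g0 p)" using ip[OF p] inner_product_bilinear by blast+
      then show "bilinear_at p (tensor_diff ge g0 p)"
        unfolding bilinear_at_def tensor_diff_def by (simp add: algebra_simps)
      fix u assume u: "u \<in> tangent_space A p"
      have "g p u u \<ge> 0" by (rule inner_product_nonneg[OF ip(3)[OF p] u])
      then have "(\<Sum>j<Suc (N p). \<delta> / 2 ^ (j + 1)) * g p u u \<le> \<delta> * g p u u"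
        by (intro mult_right_mono less_imp_le[OF sum_less])
      then show "\<bar>tensor_diff ge g0 p u u\<bar> \<le> \<delta> * g p u u"
        using near_n[OF p u, of "Suc (N p)"] by (simp add: tensor_diff_def ge_def)
    qed (use \<delta> in simp)
    then show ?thesis using n1 by (simp add: \<delta>_def n1_def)
  qed
  \<comment> \<open>The bound \<epsilon>/2 is uniform in the point; pointwise strict inequalities
    would not survive the supremum.\<close>
  have "C0_norm X A g (tensor_diff ge g0) \<le> ennreal (\<epsilon> / 2)"
    unfolding C0_norm_def by (intro SUP_least ennreal_leI norm)
  also have "\<dots> < ennreal \<epsilon>" using assms(7) by (simp add: ennreal_lessI)
  finally have "C0_norm X A g (tensor_diff ge g0) < ennreal \<epsilon>" .
  moreover have "scal A g0 p - k p - \<epsilon> < scal A ge p \<and> scal A ge p < scal A g0 p - k p" if "p \<in> topspace X" for p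
    using scal[OF that] \<delta>(2) by linarith
  ultimately show ?thesis using met by blast
qed

end
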